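(* Let $X$ be a topological space and let $C^*(X)$ be its (normalized singular) cochain complex with $\mathbb{Z}_2$ coefficients, regarded as a DG-algebra with the cup product. Then $C^*(X)$ carries a structure of extended homotopy G-algebra; that is, there exist operations $E^k_{p,q}:C^*(X)^{\otimes p}\otimes C^*(X)^{\otimes q}\to C^*(X)$, $k\ge0$, $p,q\ge1$, making $(C^*(X),d,\smile,\{E^k_{p,q}\})$ an extended homotopy G-algebra.
   Context: All vector spaces are graded over the field $\mathbb{Z}_2$ (so there are no signs), and differentials have degree $+1$. **Homotopy G-algebra.** A DG-algebra $(A,d,\cdot)$ with multilinear operations $E_{1,k}:A\otimes A^{\otimes k}\to A$, $k\ge 1$, of degree $-k$, with the convention $E_{1,0}=\mathrm{id}$, such that for all elements of $A$ and all $k,m,n\ge 1$: (i) $dE_{1,k}(a;b_1,\dots,b_k)+E_{1,k}(da;b_1,\dots,b_k)+\sum_i E_{1,k}(a;b_1,\dots,db_i,\dots,b_k)= b_1E_{1,k-1}(a;b_2,\dots,b_k)+\sum_i E_{1,k-1}(a;b_1,\dots,b_ib_{i+1},\dots,b_k)+E_{1,k-1}(a;b_1,\dots,b_{k-1})b_k$; (ii) $a_1E_{1,k}(a_2;b_1,\dots,b_k)+E_{1,k}(a_1 a_2;b_1,\dots,b_k)+E_{1,k}(a_1;b_1,\dots,b_k)a_2=\sum_{p=1}^{k-1}E_{1,p}(a_1;b_1,\dots,b_p)\, E_{1,k-p}(a_2;b_{p+1},\dots,b_k)$; (iii) $E_{1,n}(E_{1,m}(a;b_1,\dots,b_m);c_1,\dots,c_n)=\sum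 E_{1,n-\sum l_i+m}(a;c_1,\dots,c_{k_1},E_{1,l_1}(b_1;c_{k_1+1},\dots,c_{k_1+l_1}),c_{k_1+l_1+1},\dots,c_{k_m},E_{1,l_m}(b_m;c_{k_m+1},\dots,c_{k_m+l_m}),c_{k_m+l_m+1},\dots,c_n)$, the sum over all integers $k_i,l_i\ge 0$ with $0\le k_1\le k_1+l_1\le k_2\le k_2+l_2\le\dots\le k_m+l_m\le n$. **Extended homotopy G-algebra.** A DG-algebra $(A,d,\cdot)$ with multilinear operations $E^k_{p,q}:A^{\otimes p}\otimes A^{\otimes q}\to A$ ($k\ge 0$, $p,q\ge 1$) of degree $1-k-p-q$ such that $E^0_{p,q}=0$ for $p>1$, $(A,d,\cdot,\{E^0_{1,q}\})$ is a homotopy G-algebra, and the condition ( * ) below holds. Conventions: $E^0_{1,0}=E^0_{0,1}=\mathrm{id}_A$; every other $E^k_{p,0}$ and $E^k_{0,q}$ is $0$; $E^{-1}_{p,q}=0$; and $TE^{i}_{p,q}(x_1,\dots,x_p;y_1,\dots,y_q)=E^i_{q,p}(y_1,\dots,y_q;x_1,\dots,x_p)$, with $T^i$ the $i$-th iterate. For all $k\ge 0$, $m,n\ge 1$: $$( * )\quad \begin{array}{l} dE^k_{m,n}(a_1,\dots,a_m;b_1,\dots,b_n)+\sum_iE^k_{m,n}(a_1,\dots,da_i,\dots,a_m;b_1,\dots,b_n)\\ +\sum_iE^k_{m,n}(a_1,\dots,a_m;b_1,\dots,db_i,\dots,b_n)\\ +\sum_{i}E^k_{m-1,n}(a_1,\dots,a_ia_{i+1},\dots,a_m;b_1,\dots,b_n)+\sum_{i}E^k_{m,n-1}(a_1,\dots,a_m;b_1,\dots,b_ib_{i+1},\dots,b_n)\\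 +\sum_{i=0}^k\sum_{(p,q)}E^{i}_{p,q}(a_1,\dots,a_p;b_1,\dots,b_q)\cdot T^iE^{k-i}_{m-p,n-q}(a_{p+1},\dots,a_m;b_{q+1},\dots,b_n)\\ =E^{k-1}_{m,n}(a_1,\dots,a_m;b_1,\dots,b_n)+E^{k-1}_{n,m}(b_1,\dots,b_n;a_1,\dots,a_m),\end{array}$$ where $(p,q)$ ranges over all pairs with $0\le p\le m$, $0\le q\le n$, $(p,q)\ne(0,0),(m,n)$ (so the sum includes the terms $a_1E^k_{m-1,n}$, $E^k_{m-1,n}a_m$, $b_1E^k_{m,n-1}$, $E^k_{m,n-1}b_n$). *)

theory Defs
  imports
    "HOL-Homology.Simplices"
    "HOL-Library.Z2"
    "HOL-Library.Function_Algebras"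
begin

section \<open>DG-algebras over the field with two elements\<close>

text \<open>
  A graded space is the internal direct sum, inside an ambient \<open>bit\<close>-vector space, of a family of
  subspaces \<open>A n\<close> indexed by the integers.  All operations are functions on the ambient type of
  which only the restriction to the direct sum \<open>total\<close> is relevant.
\<close>

locale graded_space_Z2 = vector_space scale
  for scale :: "bit \<Rightarrow> 'c::ab_group_add \<Rightarrow> 'c" (infixr \<open>*s\<close> 75) +
  fixes A :: "int \<Rightarrow> 'c set"
  assumes subspace_component: "subspace (A n)"
    and independent_components:
      "\<lbrakk>finite N; \<And>n. n \<in> N \<Longrightarrow> x n \<in> A n; (\<Sum>n\<in>N. x n) = 0; n \<in> N\<rbrakk> \<Longrightarrow> x n = 0"
begin

definition total :: "'c set" where
  "total = span (\<Union>n. A n)"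

definition linear_on_total :: "('c \<Rightarrow> 'c) \<Rightarrow> bool" where
  "linear_on_total f \<longleftrightarrow>
     (\<forall>x\<in>total. \<forall>y\<in>total. f (x + y) = f x + f y) \<and> (\<forall>r. \<forall>x\<in>total. f (r *s x) = r *s f x)"

definition multilinear_on_total :: "nat \<Rightarrow> ('c list \<Rightarrow> 'c) \<Rightarrow> bool" where
  "multilinear_on_total p F \<longleftrightarrow>
     (\<forall>us\<in>lists total. \<forall>vs\<in>lists total. length us + 1 + length vs = p \<longrightarrow>
        linear_on_total (\<lambda>x. F (us @ x # vs)))"

text \<open>The entries of the list \<open>xs\<close> are homogeneous, of the degrees listed in \<open>ns\<close>.\<close>

definition homogeneous :: "'c list \<Rightarrow> int list \<Rightarrow> bool" where
  "homogeneous xs ns \<longleftrightarrow> list_all2 (\<lambda>x n. x \<in> A n) xs ns"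

end

locale dg_algebra_Z2 = graded_space_Z2 scale A
  for scale :: "bit \<Rightarrow> 'c::ab_group_add \<Rightarrow> 'c" (infixr \<open>*s\<close> 75) and A :: "int \<Rightarrow> 'c set" +
  fixes d :: "'c \<Rightarrow> 'c"
    and mul :: "'c \<Rightarrow> 'c \<Rightarrow> 'c" (infixl \<open>\<cdot>\<close> 70)
  assumes d_linear: "linear_on_total d"
    and d_degree: "x \<in> A n \<Longrightarrow> d x \<in> A (n + 1)"
    and d_d: "x \<in> total \<Longrightarrow> d (d x) = 0"
    and mult_linear_left: "y \<in> total \<Longrightarrow> linear_on_total (\<lambda>x. x \<cdot> y)"
    and mult_linear_right: "x \<in> total \<Longrightarrow> linear_on_total (\<lambda>y. x \<cdot> y)"
    and mult_degree: "\<lbrakk>x \<in> A m; y \<in> A n\<rbrakk> \<Longrightarrow> x \<cdot> y \<in> A (m + n)"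
    and mult_assoc: "\<lbrakk>x \<in> total; y \<in> total; z \<in> total\<rbrakk> \<Longrightarrow> (x \<cdot> y) \<cdot> z = x \<cdot> (y \<cdot> z)"
    and mult_unit: "\<exists>u\<in>A 0. \<forall>x\<in>total. u \<cdot> x = x \<and> x \<cdot> u = x"
    and d_mult: "\<lbrakk>x \<in> total; y \<in> total\<rbrakk> \<Longrightarrow> d (x \<cdot> y) = d x \<cdot> y + x \<cdot> d y"


section \<open>Operations on lists of arguments\<close>

text \<open>\<open>x\<^sub>1, \<dots>, f x\<^sub>i, \<dots>, x\<^sub>n\<close>, with positions counted from 0\<close>

definition apply_at :: "('c \<Rightarrow> 'c) \<Rightarrow> 'c list \<Rightarrow> nat \<Rightarrow> 'c list" where
  "apply_at f xs i = xs[i := f (xs ! i)]"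

text \<open>\<open>x\<^sub>1, \<dots>, x\<^sub>i x\<^sub>i\<^sub>+\<^sub>1, \<dots>, x\<^sub>n\<close>, with positions counted from 0\<close>

definition merge_at :: "('c \<Rightarrow> 'c \<Rightarrow> 'c) \<Rightarrow> 'c list \<Rightarrow> nat \<Rightarrow> 'c list" where
  "merge_at mul xs i = take i xs @ mul (xs ! i) (xs ! Suc i) # drop (i + 2) xs"

text \<open>\<open>x\<^sub>i\<^sub>+\<^sub>1, \<dots>, x\<^sub>j\<close>\<close>

definition slice :: "nat \<Rightarrow> nat \<Rightarrow> 'c list \<Rightarrow> 'c list" where
  "slice i j xs = take (j - i) (drop i xs)"


section \<open>Homotopy G-algebras\<close>

text \<open>
  \<open>F a bs\<close> is \<open>E\<^sub>1\<^sub>,\<^sub>k (a; b\<^sub>1, \<dots>, b\<^sub>k)\<close> where \<open>k \<ge> 1\<close> is the length of \<open>bs\<close>;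
  \<open>brace F\<close> incorporates the convention \<open>E\<^sub>1\<^sub>,\<^sub>0 = id\<close>.
\<close>

definition brace :: "('c \<Rightarrow> 'c list \<Rightarrow> 'c) \<Rightarrow> 'c \<Rightarrow> 'c list \<Rightarrow> 'c" where
  "brace F a bs = (if bs = [] then a else F a bs)"

text \<open>
  The pairs \<open>((k\<^sub>1, \<dots>, k\<^sub>m), (l\<^sub>1, \<dots>, l\<^sub>m))\<close> with
  \<open>0 \<le> k\<^sub>1 \<le> k\<^sub>1 + l\<^sub>1 \<le> k\<^sub>2 \<le> \<dots> \<le> k\<^sub>m + l\<^sub>m \<le> n\<close>
\<close>

definition brace_indices :: "nat \<Rightarrow> nat \<Rightarrow> (nat list \<times> nat list) set" where
  "brace_indices m n =
     {(ks, ls). length ks = m \<and> length ls = m \<and>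
        (\<forall>i<m. ks ! i + ls ! i \<le> (if Suc i < m then ks ! Suc i else n))}"

text \<open>
  The argument list
  \<open>c\<^sub>1, \<dots>, c\<^bsub>k\<^sub>1\<^esub>, E(b\<^sub>1; c\<^bsub>k\<^sub>1+1\<^esub>, \<dots>, c\<^bsub>k\<^sub>1+l\<^sub>1\<^esub>), \<dots>, E(b\<^sub>m; c\<^bsub>k\<^sub>m+1\<^esub>, \<dots>, c\<^bsub>k\<^sub>m+l\<^sub>m\<^esub>), \<dots>, c\<^sub>n\<close>.
  Here \<open>e i\<close> is the number of entries of \<open>cs\<close> used up before the block \<open>i\<close> (counted from 0).
\<close>

definition brace_insert ::
    "('c \<Rightarrow> 'c list \<Rightarrow> 'c) \<Rightarrow> 'c list \<Rightarrow> 'c list \<Rightarrow> nat list \<Rightarrow> nat list \<Rightarrow> 'c list" where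
  "brace_insert F bs cs ks ls =
     (let m = length bs;
          e = (\<lambda>i. if i = 0 then 0 else ks ! (i - 1) + ls ! (i - 1))
      in concat (map (\<lambda>i. slice (e i) (ks ! i) cs
                          @ [brace F (bs ! i) (slice (ks ! i) (ks ! i + ls ! i) cs)]) [0..<m])
         @ slice (e m) (length cs) cs)"

locale homotopy_G_algebra_Z2 = dg_algebra_Z2 scale A d mul
  for scale :: "bit \<Rightarrow> 'c::ab_group_add \<Rightarrow> 'c" (infixr \<open>*s\<close> 75)
    and A :: "int \<Rightarrow> 'c set"
    and d :: "'c \<Rightarrow> 'c"
    and mul :: "'c \<Rightarrow> 'c \<Rightarrow> 'c" (infixl \<open>\<cdot>\<close> 70) +
  fixes F :: "'c \<Rightarrow> 'c list \<Rightarrow> 'c"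
  assumes F_linear: "\<lbrakk>bs \<in> lists total; bs \<noteq> []\<rbrakk> \<Longrightarrow> linear_on_total (\<lambda>a. F a bs)"
    and F_multilinear: "\<lbrakk>a \<in> total; k \<ge> 1\<rbrakk> \<Longrightarrow> multilinear_on_total k (F a)"
    and F_degree:
      "\<lbrakk>a \<in> A n; homogeneous bs ns; bs \<noteq> []\<rbrakk> \<Longrightarrow> F a bs \<in> A (n + sum_list ns - int (length bs))"
    and F_d:
      "\<lbrakk>a \<in> total; bs \<in> lists total; length bs = k; k \<ge> 1\<rbrakk> \<Longrightarrow>
         d (F a bs) + F (d a) bs + (\<Sum>i<k. F a (apply_at d bs i))
         = hd bs \<cdot> brace F a (tl bs)
           + (\<Sum>i<k - 1. F a (merge_at mul bs i))
           + brace F a (butlast bs) \<cdot> last bs"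
    and F_mult:
      "\<lbrakk>a1 \<in> total; a2 \<in> total; bs \<in> lists total; length bs = k; k \<ge> 1\<rbrakk> \<Longrightarrow>
         a1 \<cdot> F a2 bs + F (a1 \<cdot> a2) bs + F a1 bs \<cdot> a2
         = (\<Sum>p=1..<k. F a1 (take p bs) \<cdot> F a2 (drop p bs))"
    and F_F:
      "\<lbrakk>a \<in> total; bs \<in> lists total; cs \<in> lists total;
        length bs = m; length cs = n; m \<ge> 1; n \<ge> 1\<rbrakk> \<Longrightarrow>
         F (F a bs) cs = (\<Sum>(ks, ls)\<in>brace_indices m n. F a (brace_insert F bs cs ks ls))"


section \<open>Extended homotopy G-algebras\<close>

text \<open>
  \<open>E k xs ys\<close> is \<open>E\<^sup>k\<^sub>p\<^sub>,\<^sub>q (x\<^sub>1, \<dots>, x\<^sub>p; y\<^sub>1, \<dots>, y\<^sub>q)\<close> where \<open>p, q \<ge> 1\<close> are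
  the lengths of \<open>xs\<close> and \<open>ys\<close>.  The operations \<open>ext_ops E\<close> incorporate the conventions
  \<open>E\<^sup>0\<^sub>1\<^sub>,\<^sub>0 = E\<^sup>0\<^sub>0\<^sub>,\<^sub>1 = id\<close> and \<open>E\<^sup>k\<^sub>p\<^sub>,\<^sub>0 = 0\<close>, \<open>E\<^sup>k\<^sub>0\<^sub>,\<^sub>q = 0\<close> otherwise.
\<close>

definition ext_ops :: "(nat \<Rightarrow> 'c list \<Rightarrow> 'c list \<Rightarrow> 'c::zero) \<Rightarrow> nat \<Rightarrow> 'c list \<Rightarrow> 'c list \<Rightarrow> 'c" where
  "ext_ops E k xs ys =
     (if xs \<noteq> [] \<and> ys \<noteq> [] then E k xs ys
      else if k = 0 \<and> length (xs @ ys) = 1 then hd (xs @ ys)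
      else 0)"

text \<open>The operations of upper index \<open>k - 1\<close>, with the convention \<open>E\<^sup>-\<^sup>1 = 0\<close>\<close>

definition pred_ops :: "(nat \<Rightarrow> 'c list \<Rightarrow> 'c list \<Rightarrow> 'c::zero) \<Rightarrow> nat \<Rightarrow> 'c list \<Rightarrow> 'c list \<Rightarrow> 'c" where
  "pred_ops E k xs ys = (if k = 0 then 0 else E (k - 1) xs ys)"

definition swap_args :: "('c list \<Rightarrow> 'c list \<Rightarrow> 'c) \<Rightarrow> 'c list \<Rightarrow> 'c list \<Rightarrow> 'c" where
  "swap_args G xs ys = G ys xs"

locale extended_homotopy_G_algebra_Z2 =
  homotopy_G_algebra_Z2 scale A d mul "\<lambda>a bs. E 0 [a] bs"
  for scale :: "bit \<Rightarrow> 'c::ab_group_add \<Rightarrow> 'c" (infixr \<open>*s\<close> 75)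
    and A :: "int \<Rightarrow> 'c set"
    and d :: "'c \<Rightarrow> 'c"
    and mul :: "'c \<Rightarrow> 'c \<Rightarrow> 'c" (infixl \<open>\<cdot>\<close> 70)
    and E :: "nat \<Rightarrow> 'c list \<Rightarrow> 'c list \<Rightarrow> 'c" +
  assumes E_multilinear_left:
      "\<lbrakk>p \<ge> 1; ys \<in> lists total; ys \<noteq> []\<rbrakk> \<Longrightarrow> multilinear_on_total p (\<lambda>xs. E k xs ys)"
    and E_multilinear_right:
      "\<lbrakk>q \<ge> 1; xs \<in> lists total; xs \<noteq> []\<rbrakk> \<Longrightarrow> multilinear_on_total q (\<lambda>ys. E k xs ys)"
    and E_degree:
      "\<lbrakk>homogeneous xs ms; homogeneous ys ns; length xs = p; length ys = q; p \<ge> 1; q \<ge> 1\<rbrakk> \<Longrightarrow>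
         E k xs ys \<in> A (sum_list ms + sum_list ns + (1 - int k - int p - int q))"
    and E_0_eq_0:
      "\<lbrakk>xs \<in> lists total; ys \<in> lists total; length xs > 1; ys \<noteq> []\<rbrakk> \<Longrightarrow> E 0 xs ys = 0"
    and E_d:
      "\<lbrakk>as \<in> lists total; bs \<in> lists total; length as = m; length bs = n; m \<ge> 1; n \<ge> 1\<rbrakk> \<Longrightarrow>
         d (E k as bs)
         + (\<Sum>i<m. E k (apply_at d as i) bs)
         + (\<Sum>i<n. E k as (apply_at d bs i))
         + (\<Sum>i<m - 1. E k (merge_at mul as i) bs)
         + (\<Sum>i<n - 1. E k as (merge_at mul bs i))
         + (\<Sum>i=0..k. \<Sum>(p, q)\<in>({0..m} \<times> {0..n}) - {(0, 0), (m, n)}.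
              ext_ops E i (take p as) (take q bs)
              \<cdot> (swap_args ^^ i) (ext_ops E (k - i)) (drop p as) (drop q bs))
         = pred_ops E k as bs + pred_ops E k bs as"


section \<open>The normalized singular cochain algebra\<close>

text \<open>
  The degeneracy map collapsing the edge from vertex \<open>i\<close> to vertex \<open>i + 1\<close>, in barycentric
  coordinates
\<close>

definition simplicial_degeneracy :: "nat \<Rightarrow> (nat \<Rightarrow> real) \<Rightarrow> nat \<Rightarrow> real" where
  "simplicial_degeneracy i x =
     (\<lambda>j. if j < i then x j else if j = i then x i + x (Suc i) else x (Suc j))"

definition degenerate_simplex :: "nat \<Rightarrow> 'a topology \<Rightarrow> ((nat \<Rightarrow> real) \<Rightarrow> 'a) \<Rightarrow> bool" where
  "degenerate_simplex p X \<sigma> \<longleftrightarrow>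
     (\<exists>m i \<tau>. p = Suc m \<and> i \<le> m \<and> singular_simplex m X \<tau> \<and>
        \<sigma> = restrict (\<tau> \<circ> simplicial_degeneracy i) (standard_simplex p))"

text \<open>
  A cochain assigns to each dimension \<open>p\<close> and each singular \<open>p\<close>-simplex an element of \<open>bit\<close>, where
  functions on the singular simplices are extended by 0 to all functions.  The normalized cochains
  of degree \<open>n\<close> are concentrated in dimension \<open>n\<close> and vanish on degenerate simplices; for
  negative \<open>n\<close> there is only the zero cochain.
\<close>

type_synonym 'a cochain = "nat \<Rightarrow> ((nat \<Rightarrow> real) \<Rightarrow> 'a) \<Rightarrow> bit"

definition cochain_scale :: "bit \<Rightarrow> 'a cochain \<Rightarrow> 'a cochain" where
  "cochain_scale r c = (\<lambda>p \<sigma>. r * c p \<sigma>)"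

definition normalized_cochains :: "'a topology \<Rightarrow> int \<Rightarrow> 'a cochain set" where
  "normalized_cochains X n =
     {c. \<forall>p \<sigma>. c p \<sigma> \<noteq> 0 \<longrightarrow> int p = n \<and> singular_simplex p X \<sigma> \<and> \<not> degenerate_simplex p X \<sigma>}"

definition coboundary :: "'a topology \<Rightarrow> 'a cochain \<Rightarrow> 'a cochain" where
  "coboundary X c =
     (\<lambda>p \<sigma>. if p \<ge> 1 \<and> singular_simplex p X \<sigma> then \<Sum>k\<le>p. c (p - 1) (singular_face p k \<sigma>) else 0)"

text \<open>The faces of a singular simplex spanned by its first \<open>p + 1\<close> and last \<open>q + 1\<close> vertices\<close>

definition front_face :: "nat \<Rightarrow> ((nat \<Rightarrow> real) \<Rightarrow> 'a) \<Rightarrow> (nat \<Rightarrow> real) \<Rightarrow> 'a" where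
  "front_face p \<sigma> = restrict \<sigma> (standard_simplex p)"

definition back_face :: "nat \<Rightarrow> nat \<Rightarrow> ((nat \<Rightarrow> real) \<Rightarrow> 'a) \<Rightarrow> (nat \<Rightarrow> real) \<Rightarrow> 'a" where
  "back_face n q \<sigma> =
     restrict (\<sigma> \<circ> (\<lambda>x j. if j < n - q then 0 else x (j - (n - q)))) (standard_simplex q)"

definition cup :: "'a topology \<Rightarrow> 'a cochain \<Rightarrow> 'a cochain \<Rightarrow> 'a cochain" where
  "cup X a b =
     (\<lambda>n \<sigma>. if singular_simplex n X \<sigma>
            then \<Sum>p\<le>n. a p (front_face p \<sigma>) * b (n - p) (back_face n (n - p) \<sigma>)
            else 0)"

end

theory Submission
  imports Defs
begin

text \<open>
  The operations are built on a combinatorial model and then transported to singular cochains.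

  \<^bold>\<open>The model.\<close> A word \<open>w\<close> in the vertices \<open>0, \<dots>, p\<close> and a singular \<open>p\<close>-simplex \<open>\<sigma>\<close> determine the
  singular simplex \<open>\<sigma> \<circ> w\<close> (\<open>subsimplex\<close>).  Evaluating a cochain on all of these turns it into a
  function on words (\<open>pull\<close>).  Functions on words form a DG-algebra with the evident differential and
  cup product, pulling back is a homomorphism, the word \<open>0 1 \<dots> p\<close> gives back the value on \<open>\<sigma>\<close>
  (\<open>pull_all\<close>), and degree and normalization can be tested after pulling back
  (\<open>normalized_cochains_iff\<close>).  So any operations on functions on words that are natural under maps of
  the alphabet induce operations on cochains, and every identity is inherited
  (\<open>pull_cochain_op\<close>, \<open>supported_eqI\<close>).

  \<^bold>\<open>Upper index 0.\<close> The braces are explicit: \<open>E\<^sub>1\<^sub>,\<^sub>k (a; b\<^sub>1, \<dots>, b\<^sub>k)\<close> sums, over all ways to mark \<open>k\<close>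
  contiguous subwords of \<open>w\<close> that follow each other and share at most end letters, the product of the
  \<open>b\<^sub>i\<close> on the marked subwords with \<open>a\<close> on the word in which each marked subword is replaced by its two
  end letters.  A recursion on the first letter of \<open>w\<close> reduces the three identities of a homotopy G-algebra to one-step computations
  (\<open>word_d_word_brace\<close>, \<open>word_brace_word_cup\<close>, \<open>word_brace_word_brace\<close>).

  \<^bold>\<open>Upper index \<open>k \<ge> 1\<close>.\<close> An operation with two lists of arguments is a function on \<open>BA \<otimes> BA\<close> with values
  in \<open>A\<close>, where \<open>BA\<close> is the bar construction.  Such functions carry a cup product and a differential
  \<open>D\<close>, and the structure equation says that the defect
  \<open>Q\<^sup>k = D E\<^sup>k + \<Sum>\<^sub>i E\<^sup>i \<smile> T\<^sup>i E\<^sup>k\<^sup>-\<^sup>i + (1 + T) E\<^sup>k\<^sup>-\<^sup>1\<close> vanishes.  If all lower defects vanish, then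
  \<open>D Q\<^sup>k = E\<^sup>0 \<smile> Q\<^sup>k + Q\<^sup>k \<smile> T\<^sup>k E\<^sup>0\<close> for every choice of \<open>E\<^sup>k\<close> (\<open>total_d_defect\<close>); so the
  obstruction to choosing \<open>E\<^sup>k\<close> is always a cycle.  The functions on words have the contracting
  homotopy \<open>f \<mapsto> f (v w)\<close>, so that cycle can be bounded explicitly: \<open>E\<^sup>k\<close> is defined by a recursion on
  the number of arguments plus the length of the word (\<open>filling\<close>), where the apex \<open>v\<close> is the first
  letter of the word in question, which makes the operations natural.  The homotopy formula has an error term, the evaluation at a vertex, which
  contributes nothing because \<open>Q\<^sup>k\<close> has negative degree (\<open>filling_solves\<close>).
\<close>

section \<open>Groups of exponent two and multiadditive functions on lists\<close>

text \<open>
  The class is closed under function spaces, so sums of operations cancel by the same two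
  simplification rules at every number of remaining arguments.
\<close>

class ab_group_add2 = ab_group_add +
  assumes add_self [simp]: "x + x = 0"
begin

lemma add_left_self [simp]: "x + (x + y) = y"
  by (simp flip: add.assoc)

lemma eq_iff_add_eq_0: "x = y \<longleftrightarrow> x + y = 0"
  by (metis add_left_self add_self add_0_right)

end

lemmas add2_simps = add_ac add_left_self add_self add_0_right add_0_left

lemma add_eq_move: "x + y = z \<Longrightarrow> x = y + (z::'a::ab_group_add2)"
  by (metis add_left_self add.commute)

instance bit :: ab_group_add2
  by standard (case_tac x; simp)

instance "fun" :: (type, ab_group_add2) ab_group_add2
  by standard (simp add: fun_eq_iff)

text \<open>
  Sums of operations are taken in function spaces, and their arguments are supplied one by one.
\<close>

lemma sum_fun_apply: "(\<Sum>i\<in>A. f i) x = (\<Sum>i\<in>A. f i x)"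
  by (induction A rule: infinite_finite_induct) auto

definition multiadditive :: "('v::plus list \<Rightarrow> 'r::plus) \<Rightarrow> bool" where
  "multiadditive \<phi> \<longleftrightarrow>
     (\<forall>us x y vs. \<phi> (us @ (x + y) # vs) = \<phi> (us @ x # vs) + \<phi> (us @ y # vs))"

text \<open>
  Statements about functions on lists are proved by induction on the list with the function
  generalized: the function with its first argument fixed is the one to which the induction
  hypothesis applies.
\<close>

abbreviation (input) feed :: "'v \<Rightarrow> ('v list \<Rightarrow> 'r) \<Rightarrow> 'v list \<Rightarrow> 'r" where
  "feed x \<phi> \<equiv> \<lambda>xs. \<phi> (x # xs)"

lemma multiadditive_feed: "multiadditive \<phi> \<Longrightarrow> multiadditive (feed x \<phi>)"
  unfolding multiadditive_def by (metis append_Cons)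

lemma multiadditive_head:
  "multiadditive \<phi> \<Longrightarrow> \<phi> ((x + y) # vs) = \<phi> (x # vs) + \<phi> (y # vs)"
  unfolding multiadditive_def by (metis append_Nil)

lemma multiadditive_0:
  fixes \<phi> :: "'v::ab_group_add2 list \<Rightarrow> 'r::ab_group_add2"
  assumes "multiadditive \<phi>"
  shows "\<phi> (0 # vs) = 0"
  using multiadditive_head[OF assms, of 0 0 vs] by simp

lemma multiadditive_add:
  fixes \<phi> \<psi> :: "'v::ab_group_add2 list \<Rightarrow> 'r::ab_group_add2"
  shows "multiadditive \<phi> \<Longrightarrow> multiadditive \<psi> \<Longrightarrow> multiadditive (\<phi> + \<psi>)"
  unfolding multiadditive_def by (simp add: add_ac)

lemma multiadditive_sum:
  fixes \<phi> :: "'i \<Rightarrow> 'v::ab_group_add2 list \<Rightarrow> 'r::ab_group_add2"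
  shows "(\<And>i. i \<in> A \<Longrightarrow> multiadditive (\<phi> i)) \<Longrightarrow> multiadditive (\<lambda>xs. \<Sum>i\<in>A. \<phi> i xs)"
  unfolding multiadditive_def by (simp add: sum.distrib)

section \<open>Convolution over the cuts of a list\<close>

text \<open>
  The product \<open>f\<close> may itself be a convolution; iterating once gives the cup product of operations with
  two lists of arguments.
\<close>

definition conv :: "('r \<Rightarrow> 's \<Rightarrow> 't::comm_monoid_add) \<Rightarrow> ('v list \<Rightarrow> 'r) \<Rightarrow> ('v list \<Rightarrow> 's) \<Rightarrow> 'v list \<Rightarrow> 't" where
  "conv f \<phi> \<psi> xs = (\<Sum>p\<le>length xs. f (\<phi> (take p xs)) (\<psi> (drop p xs)))"

lemma conv_Nil: "conv f \<phi> \<psi> [] = f (\<phi> []) (\<psi> [])"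
  by (simp add: conv_def)

lemma conv_Cons:
  "conv f \<phi> \<psi> (x # xs) = f (\<phi> []) (\<psi> (x # xs)) + conv f (feed x \<phi>) \<psi> xs"
  unfolding conv_def by (simp add: sum.atMost_Suc_shift del: sum.atMost_Suc)

definition biadditive :: "('r::plus \<Rightarrow> 's::plus \<Rightarrow> 't::plus) \<Rightarrow> bool" where
  "biadditive f \<longleftrightarrow> (\<forall>x y z. f (x + y) z = f x z + f y z) \<and> (\<forall>x y z. f x (y + z) = f x y + f x z)"

lemma biadditive_left: "biadditive f \<Longrightarrow> f (x + y) z = f x z + f y z"
  unfolding biadditive_def by auto

lemma biadditive_right: "biadditive f \<Longrightarrow> f x (y + z) = f x y + f x z"
  unfolding biadditive_def by auto

lemma biadditive_0:
  fixes f :: "'r::ab_group_add2 \<Rightarrow> 's::ab_group_add2 \<Rightarrow> 't::ab_group_add2"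
  assumes "biadditive f"
  shows "f 0 z = 0" "f x 0 = 0"
  using biadditive_left[OF assms, of 0 0 z] biadditive_right[OF assms, of x 0 0] by simp_all

lemma biadditive_sum:
  fixes f :: "'r::ab_group_add2 \<Rightarrow> 's::ab_group_add2 \<Rightarrow> 't::ab_group_add2"
  assumes "biadditive f"
  shows "f (\<Sum>i\<in>A. g i) z = (\<Sum>i\<in>A. f (g i) z)" "f x (\<Sum>i\<in>A. h i) = (\<Sum>i\<in>A. f x (h i))"
  by (induction A rule: infinite_finite_induct;
      simp add: biadditive_0[OF assms] biadditive_left[OF assms] biadditive_right[OF assms])+

lemma biadditive_conv:
  fixes f :: "'r::ab_group_add2 \<Rightarrow> 's::ab_group_add2 \<Rightarrow> 't::ab_group_add2"
  assumes "biadditive f"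
  shows "biadditive (conv f)"
  unfolding biadditive_def
  by (auto simp: fun_eq_iff conv_def sum.distrib biadditive_left[OF assms] biadditive_right[OF assms])

lemma conv_zero:
  fixes f :: "'r::ab_group_add2 \<Rightarrow> 's::ab_group_add2 \<Rightarrow> 't::ab_group_add2"
  assumes "biadditive f"
  shows "conv f (\<lambda>_. 0) \<psi> xs = 0" "conv f \<phi> (\<lambda>_. 0) xs = 0"
  by (simp_all add: conv_def biadditive_0[OF assms])

lemma conv_add:
  fixes f :: "'r::ab_group_add2 \<Rightarrow> 's::ab_group_add2 \<Rightarrow> 't::ab_group_add2"
  assumes "biadditive f"
  shows "conv f (\<lambda>u. \<phi> u + \<phi>' u) \<psi> xs = conv f \<phi> \<psi> xs + conv f \<phi>' \<psi> xs"
    and "conv f \<phi> (\<lambda>u. \<psi> u + \<psi>' u) xs = conv f \<phi> \<psi> xs + conv f \<phi> \<psi>' xs"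
  by (simp_all add: conv_def sum.distrib biadditive_left[OF assms] biadditive_right[OF assms])

lemma conv_assoc:
  fixes f :: "'r::ab_group_add2 \<Rightarrow> 'r \<Rightarrow> 'r"
  assumes f: "biadditive f" and assoc: "\<And>x y z. f (f x y) z = f x (f y z)"
  shows "conv f (conv f \<phi> \<psi>) \<theta> xs = conv f \<phi> (conv f \<psi> \<theta>) xs"
proof (induction xs arbitrary: \<phi>)
  case Nil
  then show ?case by (simp add: conv_Nil assoc)
next
  case (Cons x xs)
  have "conv f (\<lambda>u. f (\<phi> []) (\<psi> (x # u))) \<theta> xs = f (\<phi> []) (conv f (feed x \<psi>) \<theta> xs)"
    by (simp add: conv_def biadditive_sum[OF f] assoc)
  then show ?case
    by (simp add: conv_Cons conv_Nil conv_add[OF f] Cons assoc biadditive_right[OF f] add_ac)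
qed

definition bimultiadditive :: "('v::plus list \<Rightarrow> 'v list \<Rightarrow> 'r::plus) \<Rightarrow> bool" where
  "bimultiadditive \<Phi> \<longleftrightarrow> (\<forall>ys. multiadditive (\<lambda>xs. \<Phi> xs ys)) \<and> (\<forall>xs. multiadditive (\<Phi> xs))"


section \<open>The differential of the bar construction\<close>

text \<open>
  An ungraded DG-ring of characteristic two; degrees enter later, through relations that the
  operations respect.
\<close>

locale dg_ring2 =
  fixes d :: "'v::ab_group_add2 \<Rightarrow> 'v" and mul :: "'v \<Rightarrow> 'v \<Rightarrow> 'v" (infixl \<open>\<cdot>\<close> 70)
  assumes d_add: "d (x + y) = d x + d y"
    and d_d: "d (d x) = 0"
    and mul_biadditive: "biadditive mul"
    and mul_assoc: "(x \<cdot> y) \<cdot> z = x \<cdot> (y \<cdot> z)"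
    and d_mul: "d (x \<cdot> y) = d x \<cdot> y + x \<cdot> d y"
begin

lemma d_0: "d 0 = 0"
  using d_add[of 0 0] by simp

lemma d_sum: "d (\<Sum>i\<in>A. f i) = (\<Sum>i\<in>A. d (f i))"
  by (induction A rule: infinite_finite_induct) (auto simp: d_0 d_add)

definition internal :: "('v list \<Rightarrow> 'r::comm_monoid_add) \<Rightarrow> 'v list \<Rightarrow> 'r" where
  "internal \<phi> xs = (\<Sum>i<length xs. \<phi> (apply_at d xs i))"

definition merge :: "('v list \<Rightarrow> 'r::comm_monoid_add) \<Rightarrow> 'v list \<Rightarrow> 'r" where
  "merge \<phi> xs = (\<Sum>i<length xs - 1. \<phi> (merge_at mul xs i))"

text \<open>
  Precomposition with the bar differential, which applies \<open>d\<close> to one entry or multiplies two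
  neighbours.  Both parts are also needed separately: only \<open>internal\<close> keeps the number of arguments.
\<close>

definition bar :: "('v list \<Rightarrow> 'r::comm_monoid_add) \<Rightarrow> 'v list \<Rightarrow> 'r" where
  "bar \<phi> xs = internal \<phi> xs + merge \<phi> xs"

text \<open>
  The product of the fixed entry \<open>x\<close> with the next one; this is the summand of \<open>merge\<close> that the
  recursion on the list does not see in the tail.
\<close>

definition merge_first :: "'v \<Rightarrow> ('v list \<Rightarrow> 'r::comm_monoid_add) \<Rightarrow> 'v list \<Rightarrow> 'r" where
  "merge_first x \<phi> xs = (case xs of [] \<Rightarrow> 0 | y # ys \<Rightarrow> \<phi> (x \<cdot> y # ys))"

lemma merge_first_simps [simp]:
  "merge_first x \<phi> [] = 0" "merge_first x \<phi> (y # ys) = \<phi> (x \<cdot> y # ys)"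
  by (simp_all add: merge_first_def)

lemma merge_first_apply: "merge_first x \<Phi> xs z = merge_first x (\<lambda>u. \<Phi> u z) xs"
  and merge_first_zero [simp]: "merge_first x (\<lambda>u. 0) xs = 0"
  by (simp_all add: merge_first_def split: list.split)

lemma internal_Nil [simp]: "internal \<phi> [] = 0"
  by (simp add: internal_def)

lemma internal_Cons: "internal \<phi> (x # xs) = \<phi> (d x # xs) + internal (feed x \<phi>) xs"
  by (simp add: internal_def sum.lessThan_Suc_shift apply_at_def del: sum.lessThan_Suc)

lemma merge_Nil [simp]: "merge \<phi> [] = 0"
  by (simp add: merge_def)

lemma merge_Cons: "merge \<phi> (x # xs) = merge_first x \<phi> xs + merge (feed x \<phi>) xs"
proof (cases xs)
  case Nil
  then show ?thesis by (simp add: merge_def)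
next
  case (Cons y ys)
  then show ?thesis
    by (simp add: merge_def sum.lessThan_Suc_shift merge_at_def del: sum.lessThan_Suc)
qed

lemma bar_Nil [simp]: "bar \<phi> [] = 0"
  by (simp add: bar_def)

lemma bar_Cons:
  "bar \<phi> (x # xs) = \<phi> (d x # xs) + merge_first x \<phi> xs + bar (feed x \<phi>) xs"
  by (simp add: bar_def internal_Cons merge_Cons add_ac)

lemma internal_add: "internal (\<lambda>u. \<phi> u + \<psi> u) xs = internal \<phi> xs + internal \<psi> xs"
  and merge_add: "merge (\<lambda>u. \<phi> u + \<psi> u) xs = merge \<phi> xs + merge \<psi> xs"
  and bar_add: "bar (\<lambda>u. \<phi> u + \<psi> u) xs = bar \<phi> xs + bar \<psi> xs"
  by (simp_all add: internal_def merge_def bar_def sum.distrib add_ac)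

lemma internal_zero [simp]: "internal (\<lambda>u. 0) xs = 0"
  and merge_zero [simp]: "merge (\<lambda>u. 0) xs = 0"
  and bar_zero [simp]: "bar (\<lambda>u. 0) xs = 0"
  by (simp_all add: internal_def merge_def bar_def)

lemma bar_linear:
  assumes "\<And>x y. g (x + y) = g x + g y" "g 0 = 0"
  shows "bar (\<lambda>u. g (\<phi> u)) xs = g (bar \<phi> xs)"
proof -
  have "g (\<Sum>i\<in>A. h i) = (\<Sum>i\<in>A. g (h i))" for A :: "nat set" and h
    by (induction A rule: infinite_finite_induct) (auto simp: assms)
  then show ?thesis by (simp add: bar_def internal_def merge_def assms)
qed

lemma internal_apply: "internal \<Phi> xs z = internal (\<lambda>u. \<Phi> u z) xs"
  and bar_apply: "bar \<Phi> xs z = bar (\<lambda>u. \<Phi> u z) xs"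
  by (simp_all add: bar_def internal_def merge_def sum_fun_apply)

lemma bar_sum: "bar (\<lambda>u. \<Sum>i\<in>A. \<Phi> i u) xs = (\<Sum>i\<in>A. bar (\<Phi> i) xs)"
  by (induction A rule: infinite_finite_induct) (auto simp: bar_add)

text \<open>
  The differentials in the two lists of arguments act on different variables.
\<close>

lemma bar_bar_commute:
  "bar (\<lambda>u. bar (\<Phi> u) ys) xs = bar (\<lambda>v. bar (\<lambda>u. \<Phi> u v) xs) ys"
  by (simp add: bar_def[of _ xs] internal_def[of _ xs] merge_def[of _ xs] bar_add bar_sum)

text \<open>
  Multiplying two neighbours and then cutting is the same as cutting at a place other than between
  them and then multiplying inside one of the two pieces.  The sum over one list therefore matches
  the two sums over pieces term by term.
\<close>

lemma bar_conv:
  fixes f :: "'r::ab_group_add2 \<Rightarrow> 's::ab_group_add2 \<Rightarrow> 't::ab_group_add2"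
  assumes f: "biadditive f"
  shows "bar (conv f \<phi> \<psi>) xs = conv f (bar \<phi>) \<psi> xs + conv f \<phi> (bar \<psi>) xs"
proof (induction xs arbitrary: \<phi>)
  case Nil
  then show ?case by (simp add: conv_Nil biadditive_0[OF f])
next
  case (Cons x xs)
  have lin: "bar (\<lambda>u. f (\<phi> []) (feed x \<psi> u)) xs = f (\<phi> []) (bar (feed x \<psi>) xs)"
    by (intro bar_linear) (auto simp: biadditive_right[OF f] biadditive_0[OF f])
  have mf: "conv f (merge_first x \<phi>) \<psi> xs + f (\<phi> []) (merge_first x \<psi> xs)
      = merge_first x (conv f \<phi> \<psi>) xs"
  proof (cases xs)
    case Nil
    then show ?thesis by (simp add: conv_Nil biadditive_0[OF f])
  next
    case C: (Cons y ys)
    then show ?thesis by (simp add: conv_Cons biadditive_0[OF f] add_ac)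
  qed
  have "bar (conv f \<phi> \<psi>) (x # xs) = conv f \<phi> \<psi> (d x # xs) + merge_first x (conv f \<phi> \<psi>) xs
     + (f (\<phi> []) (bar (feed x \<psi>) xs) + (conv f (bar (feed x \<phi>)) \<psi> xs + conv f (feed x \<phi>) (bar \<psi>) xs))"
    by (simp add: bar_Cons conv_Cons bar_add lin Cons)
  also have "\<dots> = conv f (bar \<phi>) \<psi> (x # xs) + conv f \<phi> (bar \<psi>) (x # xs)"
    by (simp add: conv_Cons biadditive_0[OF f] bar_Cons conv_add[OF f] biadditive_right[OF f]
        add_ac flip: mf)
  finally show ?case .
qed

lemma multiadditive_merge_first:
  fixes \<phi> :: "'v list \<Rightarrow> 'r::ab_group_add2"
  assumes "multiadditive \<phi>"
  shows "multiadditive (merge_first x \<phi>)"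
  unfolding multiadditive_def
proof (intro allI)
  fix us y z vs
  show "merge_first x \<phi> (us @ (y + z) # vs) = merge_first x \<phi> (us @ y # vs) + merge_first x \<phi> (us @ z # vs)"
  proof (cases us)
    case Nil
    then show ?thesis
      by (simp add: biadditive_right[OF mul_biadditive] multiadditive_head[OF assms])
  next
    case (Cons u us')
    then show ?thesis
      using assms unfolding multiadditive_def by (metis append_Cons merge_first_simps(2))
  qed
qed

lemma merge_first_add:
  fixes \<phi> :: "'v list \<Rightarrow> 'r::ab_group_add2"
  assumes "multiadditive \<phi>"
  shows "merge_first (x + y) \<phi> xs = merge_first x \<phi> xs + merge_first y \<phi> xs"
  by (cases xs) (simp_all add: biadditive_left[OF mul_biadditive] multiadditive_head[OF assms])

lemma multiadditive_internal:
  fixes \<phi> :: "'v list \<Rightarrow> 'r::ab_group_add2"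
  assumes "multiadditive \<phi>"
  shows "multiadditive (internal \<phi>)"
proof -
  have "internal \<phi> (us @ (x + y) # vs) = internal \<phi> (us @ x # vs) + internal \<phi> (us @ y # vs)" for us x y vs
    using assms
  proof (induction us arbitrary: \<phi>)
    case Nil
    then show ?case by (simp add: internal_Cons d_add multiadditive_head internal_add add_ac)
  next
    case (Cons u us)
    have "\<phi> (d u # us @ (x + y) # vs) = \<phi> (d u # us @ x # vs) + \<phi> (d u # us @ y # vs)"
      using Cons.prems unfolding multiadditive_def by (metis append_Cons)
    then show ?case using Cons.IH[OF multiadditive_feed[OF Cons.prems]]
      by (simp add: internal_Cons add_ac)
  qed
  then show ?thesis unfolding multiadditive_def by blast
qed

lemma multiadditive_merge:
  fixes \<phi> :: "'v list \<Rightarrow> 'r::ab_group_add2"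
  assumes "multiadditive \<phi>"
  shows "multiadditive (merge \<phi>)"
proof -
  have "merge \<phi> (us @ (x + y) # vs) = merge \<phi> (us @ x # vs) + merge \<phi> (us @ y # vs)" for us x y vs
    using assms
  proof (induction us arbitrary: \<phi>)
    case Nil
    then show ?case by (simp add: merge_Cons merge_first_add multiadditive_head merge_add add_ac)
  next
    case (Cons u us)
    have "merge_first u \<phi> (us @ (x + y) # vs) = merge_first u \<phi> (us @ x # vs) + merge_first u \<phi> (us @ y # vs)"
      using multiadditive_merge_first[OF Cons.prems] unfolding multiadditive_def by metis
    then show ?case using Cons.IH[OF multiadditive_feed[OF Cons.prems]]
      by (simp add: merge_Cons add_ac)
  qed
  then show ?thesis unfolding multiadditive_def by blast
qed

text \<open>
  Steps at distant places commute and cancel in pairs.  What remains is \<open>d d = 0\<close>, the Leibniz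
  rule for \<open>d\<close> on a product of neighbours, and associativity for two products of three neighbours.
\<close>

lemma bar_bar:
  fixes \<phi> :: "'v list \<Rightarrow> 'r::ab_group_add2"
  assumes "multiadditive \<phi>"
  shows "bar (bar \<phi>) xs = 0"
  using assms
proof (induction xs arbitrary: \<phi>)
  case Nil
  then show ?case by simp
next
  case (Cons x xs)
  have mf: "merge_first (d x) \<phi> xs + merge_first x (bar \<phi>) xs + bar (merge_first x \<phi>) xs = 0"
  proof (cases xs)
    case Nil
    then show ?thesis by simp
  next
    case C: (Cons y ys)
    have "merge_first (x \<cdot> y) \<phi> ys = merge_first y (merge_first x \<phi>) ys"
      by (cases ys) (simp_all add: mul_assoc)
    then show ?thesis
      by (simp add: C bar_Cons d_mul multiadditive_head[OF Cons.prems] add_ac)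
  qed
  have "bar (bar \<phi>) (x # xs) = \<phi> (d (d x) # xs)
      + (merge_first (d x) \<phi> xs + merge_first x (bar \<phi>) xs + bar (merge_first x \<phi>) xs)
      + bar (bar (feed x \<phi>)) xs"
    by (simp add: bar_Cons bar_add add_ac)
  then show ?case
    using Cons.IH[OF multiadditive_feed[OF Cons.prems]]
    by (simp add: mf d_d multiadditive_0[OF Cons.prems])
qed

text \<open>
  The differential on functions on the tensor square of the bar construction.  Values of \<open>bar \<Phi>\<close> are
  functions of the second list, since \<open>bar\<close> is polymorphic in the codomain.
\<close>

definition total_d :: "('v list \<Rightarrow> 'v list \<Rightarrow> 'v) \<Rightarrow> 'v list \<Rightarrow> 'v list \<Rightarrow> 'v" where
  "total_d \<Phi> = (\<lambda>xs ys. d (\<Phi> xs ys) + bar \<Phi> xs ys + bar (\<Phi> xs) ys)"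

abbreviation cupop :: "('v list \<Rightarrow> 'v list \<Rightarrow> 'v) \<Rightarrow> ('v list \<Rightarrow> 'v list \<Rightarrow> 'v) \<Rightarrow> 'v list \<Rightarrow> 'v list \<Rightarrow> 'v"
    (infixl \<open>\<smile>\<close> 70) where
  "cupop \<equiv> conv (conv mul)"

lemma cupop_biadditive: "biadditive cupop"
  by (intro biadditive_conv mul_biadditive)

lemmas cupop_left = biadditive_left[OF cupop_biadditive]
lemmas cupop_right = biadditive_right[OF cupop_biadditive]
lemmas cupop_0 = biadditive_0[OF cupop_biadditive]
lemmas cupop_sum = biadditive_sum[OF cupop_biadditive]

lemma cupop_apply:
  "(\<Phi> \<smile> \<Psi>) xs ys = (\<Sum>p\<le>length xs. \<Sum>q\<le>length ys.
     \<Phi> (take p xs) (take q ys) \<cdot> \<Psi> (drop p xs) (drop q ys))"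
  by (simp add: conv_def sum_fun_apply)

lemma cupop_assoc: "(\<Phi> \<smile> \<Psi>) \<smile> \<theta> = \<Phi> \<smile> (\<Psi> \<smile> \<theta>)"
proof
  fix xs
  show "((\<Phi> \<smile> \<Psi>) \<smile> \<theta>) xs = (\<Phi> \<smile> (\<Psi> \<smile> \<theta>)) xs"
    by (intro conv_assoc biadditive_conv mul_biadditive ext mul_assoc)
qed

lemma swap_cupop: "swap_args (\<Phi> \<smile> \<Psi>) = swap_args \<Phi> \<smile> swap_args \<Psi>"
  by (intro ext) (simp only: swap_args_def cupop_apply, rule sum.swap)

lemma total_d_apply:
  "total_d \<Phi> xs ys = d (\<Phi> xs ys) + bar (\<lambda>u. \<Phi> u ys) xs + bar (\<Phi> xs) ys"
  by (simp add: total_d_def bar_apply)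

lemma swap_total_d: "total_d (swap_args \<Phi>) = swap_args (total_d \<Phi>)"
  by (simp add: fun_eq_iff swap_args_def[abs_def] total_d_apply add_ac)

lemma total_d_add: "total_d (\<Phi> + \<Psi>) = total_d \<Phi> + total_d \<Psi>"
  by (simp add: fun_eq_iff total_d_apply plus_fun_def bar_add d_add add_ac)

lemma total_d_0: "total_d 0 = 0"
  using total_d_add[of 0 0] by simp

lemma total_d_sum: "total_d (\<Sum>i\<in>A. \<Phi> i) = (\<Sum>i\<in>A. total_d (\<Phi> i))"
  by (induction A rule: infinite_finite_induct)
    (simp_all only: sum.infinite sum.empty sum.insert total_d_0 total_d_add not_False_eq_True)

text \<open>
  The three commuting summands of the differential have square zero, and the mixed terms occur twice.
\<close>

lemma total_d_total_d:
  assumes "bimultiadditive \<Phi>"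
  shows "total_d (total_d \<Phi>) = 0"
proof (intro ext)
  fix xs ys
  have a: "bar (\<lambda>u. bar (\<lambda>v. \<Phi> v ys) u) xs = 0"
    using assms by (intro bar_bar) (auto simp: bimultiadditive_def multiadditive_def)
  have b: "bar (bar (\<Phi> xs)) ys = 0"
    using assms by (intro bar_bar) (auto simp: bimultiadditive_def)
  have c: "bar (\<lambda>u. d (\<phi> u)) zs = d (bar \<phi> zs)" for \<phi> zs
    by (intro bar_linear d_add d_0)
  show "total_d (total_d \<Phi>) xs ys = (0 :: 'v list \<Rightarrow> 'v list \<Rightarrow> 'v) xs ys"
    by (simp add: total_d_apply[abs_def] bar_add d_add d_d a b c bar_bar_commute[of \<Phi>] add_ac)
qed

lemma total_d_cupop: "total_d (\<Phi> \<smile> \<Psi>) = total_d \<Phi> \<smile> \<Psi> + \<Phi> \<smile> total_d \<Psi>"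
proof (intro ext)
  fix xs ys
  have 1: "bar (\<Phi> \<smile> \<Psi>) xs ys = (bar \<Phi> \<smile> \<Psi>) xs ys + (\<Phi> \<smile> bar \<Psi>) xs ys"
    by (simp add: bar_conv[OF biadditive_conv[OF mul_biadditive]])
  have 2: "bar ((\<Phi> \<smile> \<Psi>) xs) ys = ((\<lambda>u. bar (\<Phi> u)) \<smile> \<Psi>) xs ys + (\<Phi> \<smile> (\<lambda>u. bar (\<Psi> u))) xs ys"
  proof -
    have "bar ((\<Phi> \<smile> \<Psi>) xs) ys
        = (\<Sum>p\<le>length xs. bar (conv mul (\<Phi> (take p xs)) (\<Psi> (drop p xs))) ys)"
      unfolding bar_sum[symmetric] by (rule arg_cong[where f="\<lambda>\<phi>. bar \<phi> ys"])
        (simp add: fun_eq_iff conv_def[of "conv mul"] sum_fun_apply)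
    then show ?thesis
      by (simp add: bar_conv[OF mul_biadditive] sum.distrib conv_def[of "conv mul"] sum_fun_apply)
  qed
  have 3: "d ((\<Phi> \<smile> \<Psi>) xs ys) = ((\<lambda>u v. d (\<Phi> u v)) \<smile> \<Psi>) xs ys + (\<Phi> \<smile> (\<lambda>u v. d (\<Psi> u v))) xs ys"
    by (simp add: cupop_apply d_sum d_mul sum.distrib)
  have 4: "total_d \<Phi> = (\<lambda>u v. d (\<Phi> u v)) + bar \<Phi> + (\<lambda>u. bar (\<Phi> u))" for \<Phi>
    by (simp add: fun_eq_iff total_d_def)
  show "total_d (\<Phi> \<smile> \<Psi>) xs ys = (total_d \<Phi> \<smile> \<Psi> + \<Phi> \<smile> total_d \<Psi>) xs ys"
    unfolding total_d_def[of "\<Phi> \<smile> \<Psi>"] 1 2 3 unfolding 4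
    by (simp add: cupop_left cupop_right add_ac)
qed

end

section \<open>Interchanging the two lists of arguments\<close>

lemma swap_args_swap_args [simp]: "swap_args (swap_args \<Phi>) = \<Phi>"
  by (simp add: fun_eq_iff swap_args_def)

lemma swap_args_add: "swap_args (\<Phi> + \<Psi>) = swap_args \<Phi> + swap_args \<Psi>"
  by (simp add: fun_eq_iff swap_args_def)

lemma swap_args_0: "swap_args 0 = 0"
  by (simp add: fun_eq_iff swap_args_def)

lemma swaps_add: "(swap_args ^^ i) (\<Phi> + \<Psi>) = (swap_args ^^ i) \<Phi> + (swap_args ^^ i) \<Psi>"
  by (induction i) (simp_all only: funpow.simps o_apply id_apply swap_args_add)

lemma swaps_0: "(swap_args ^^ i) 0 = 0"
  by (induction i) (simp_all only: funpow.simps o_apply id_apply swap_args_0)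

lemma swaps_sum: "(swap_args ^^ i) (\<Sum>j\<in>A. \<Phi> j) = (\<Sum>j\<in>A. (swap_args ^^ i) (\<Phi> j))"
  by (induction A rule: infinite_finite_induct)
    (simp_all only: sum.infinite sum.empty sum.insert swaps_0 swaps_add not_False_eq_True)

lemma swaps_swaps: "(swap_args ^^ i) ((swap_args ^^ j) \<Phi>) = (swap_args ^^ (i + j)) \<Phi>"
  by (simp add: funpow_add)

lemma swaps_swap: "(swap_args ^^ i) (swap_args \<Phi>) = (swap_args ^^ Suc i) \<Phi>"
  by (simp add: funpow_swap1)

section \<open>Operations compatible with relations\<close>

text \<open>
  Degree, normalization and naturality are handled uniformly as compatibility with a family of
  relations \<open>S n\<close>, with \<open>n\<close> read as a degree.  The last argument is the degree of a list in the bar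
  construction, where each entry is desuspended, whence \<open>n - 1\<close>.  With this convention the number
  of arguments never appears in the degree bookkeeping.
\<close>

inductive rels :: "(int \<Rightarrow> 'v \<Rightarrow> 'w \<Rightarrow> bool) \<Rightarrow> 'v list \<Rightarrow> 'w list \<Rightarrow> int \<Rightarrow> bool" for S where
  rels_Nil: "rels S [] [] 0"
| rels_Cons: "S n x x' \<Longrightarrow> rels S xs xs' m \<Longrightarrow> rels S (x # xs) (x' # xs') (n - 1 + m)"

lemma rels_length: "rels S xs xs' m \<Longrightarrow> length xs' = length xs"
  by (induction rule: rels.induct) auto

lemma rels_split:
  "rels S xs xs' m \<Longrightarrow> \<exists>m1 m2. rels S (take p xs) (take p xs') m1 \<and> rels S (drop p xs) (drop p xs') m2 \<and> m = m1 + m2"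
proof (induction arbitrary: p rule: rels.induct)
  case rels_Nil
  then show ?case using rels.rels_Nil by fastforce
next
  case (rels_Cons n x x' xs xs' m)
  show ?case
  proof (cases p)
    case 0
    then show ?thesis using rels.rels_Nil rels.rels_Cons[of S, OF rels_Cons.hyps] by fastforce
  next
    case (Suc q)
    obtain m1 m2 where "rels S (take q xs) (take q xs') m1" "rels S (drop q xs) (drop q xs') m2" "m = m1 + m2"
      using rels_Cons.IH by blast
    then show ?thesis using Suc rels.rels_Cons[of S, OF rels_Cons.hyps(1)]
      by (intro exI[of _ "n - 1 + m1"] exI[of _ m2]) auto
  qed
qed

lemma rels_map:
  assumes "\<And>n x x'. S n x x' \<Longrightarrow> S n (f x) (f' x')"
  shows "rels S xs xs' m \<Longrightarrow> rels S (map f xs) (map f' xs') m"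
  by (induction rule: rels.induct) (auto intro: rels.intros assms)

definition compat1 ::
    "(int \<Rightarrow> 'v \<Rightarrow> 'w \<Rightarrow> bool) \<Rightarrow> int \<Rightarrow> ('v list \<Rightarrow> 'v) \<Rightarrow> ('w list \<Rightarrow> 'w) \<Rightarrow> bool" where
  "compat1 S c \<phi> \<phi>' \<longleftrightarrow> (\<forall>xs xs' m. rels S xs xs' m \<longrightarrow> S (m + c) (\<phi> xs) (\<phi>' xs'))"

definition compat2 ::
    "(int \<Rightarrow> 'v \<Rightarrow> 'w \<Rightarrow> bool) \<Rightarrow> int \<Rightarrow> ('v list \<Rightarrow> 'v list \<Rightarrow> 'v) \<Rightarrow> ('w list \<Rightarrow> 'w list \<Rightarrow> 'w) \<Rightarrow> bool" where
  "compat2 S c \<Phi> \<Phi>' \<longleftrightarrow>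
     (\<forall>xs xs' m ys ys' n. rels S xs xs' m \<longrightarrow> rels S ys ys' n \<longrightarrow> S (m + n + c) (\<Phi> xs ys) (\<Phi>' xs' ys'))"

lemma compat1_feed:
  assumes "compat1 S c \<phi> \<phi>'" "S n x x'"
  shows "compat1 S (n - 1 + c) (feed x \<phi>) (feed x' \<phi>')"
  unfolding compat1_def
proof (intro allI impI)
  fix xs xs' m assume "rels S xs xs' m"
  then have "S (n - 1 + m + c) (\<phi> (x # xs)) (\<phi>' (x' # xs'))"
    using assms rels_Cons[of S] unfolding compat1_def by blast
  then show "S (m + (n - 1 + c)) (\<phi> (x # xs)) (\<phi>' (x' # xs'))"
    by (simp add: algebra_simps)
qed

lemma compat2_left:
  assumes "compat2 S c \<Phi> \<Phi>'" "rels S ys ys' n"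
  shows "compat1 S (n + c) (\<lambda>u. \<Phi> u ys) (\<lambda>u. \<Phi>' u ys')"
  using assms unfolding compat1_def compat2_def by (metis add.assoc)

lemma compat1D: "compat1 S c \<phi> \<phi>' \<Longrightarrow> rels S xs xs' m \<Longrightarrow> k = m + c \<Longrightarrow> S k (\<phi> xs) (\<phi>' xs')"
  unfolding compat1_def by blast

lemma compat2_right:
  assumes "compat2 S c \<Phi> \<Phi>'" "rels S xs xs' m"
  shows "compat1 S (m + c) (\<Phi> xs) (\<Phi>' xs')"
  using assms unfolding compat1_def compat2_def by (metis add.assoc add.commute)

lemma compat2_swap: "compat2 S c \<Phi> \<Phi>' \<Longrightarrow> compat2 S c (swap_args \<Phi>) (swap_args \<Phi>')"
  unfolding compat2_def swap_args_def by (metis add.commute)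

lemma compat2_swaps:
  "compat2 S c \<Phi> \<Phi>' \<Longrightarrow> compat2 S c ((swap_args ^^ i) \<Phi>) ((swap_args ^^ i) \<Phi>')"
  by (induction i) (auto intro: compat2_swap)

section \<open>The standard homotopy for several arguments\<close>

text \<open>
  The standard homotopy on a tensor power,
  \<open>\<Sum>\<^sub>j \<phi> (\<eta> x\<^sub>1, \<dots>, \<eta> x\<^bsub>j-1\<^esub>, h x\<^sub>j, x\<^bsub>j+1\<^esub>, \<dots>, x\<^sub>n)\<close>,
  where \<open>h\<close> is a homotopy between the identity and \<open>\<eta>\<close>.
\<close>

primrec contract :: "('v \<Rightarrow> 'v) \<Rightarrow> ('v \<Rightarrow> 'v) \<Rightarrow> ('v list \<Rightarrow> 'r::comm_monoid_add) \<Rightarrow> 'v list \<Rightarrow> 'r" where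
  "contract h \<eta> \<phi> [] = 0"
| "contract h \<eta> \<phi> (x # xs) = \<phi> (h x # xs) + contract h \<eta> (feed (\<eta> x) \<phi>) xs"

lemma contract_add:
  fixes \<phi> \<psi> :: "'v list \<Rightarrow> 'r::comm_monoid_add"
  shows "contract h \<eta> (\<lambda>u. \<phi> u + \<psi> u) xs = contract h \<eta> \<phi> xs + contract h \<eta> \<psi> xs"
  by (induction xs arbitrary: \<phi> \<psi>) (simp_all add: add_ac)

lemma contract_zero [simp]: "contract h \<eta> (\<lambda>_. 0) xs = 0"
  by (induction xs) simp_all

lemma multiadditive_contract:
  fixes \<phi> :: "'v::ab_group_add2 list \<Rightarrow> 'r::ab_group_add2"
  assumes "multiadditive \<phi>" and h: "\<And>x y. h (x + y) = h x + h y" and \<eta>: "\<And>x y. \<eta> (x + y) = \<eta> x + \<eta> y"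
  shows "multiadditive (contract h \<eta> \<phi>)"
proof -
  have "contract h \<eta> \<phi> (us @ (x + y) # vs) = contract h \<eta> \<phi> (us @ x # vs) + contract h \<eta> \<phi> (us @ y # vs)" for us x y vs
    using assms(1)
  proof (induction us arbitrary: \<phi>)
    case Nil
    then have "(\<lambda>u. \<phi> ((\<eta> x + \<eta> y) # u)) = (\<lambda>u. \<phi> (\<eta> x # u) + \<phi> (\<eta> y # u))"
      by (simp add: multiadditive_head fun_eq_iff)
    then show ?case using Nil by (simp add: h \<eta> multiadditive_head contract_add add_ac)
  next
    case (Cons u us)
    have "\<phi> (h u # us @ (x + y) # vs) = \<phi> (h u # us @ x # vs) + \<phi> (h u # us @ y # vs)"
      using Cons.prems unfolding multiadditive_def by (metis append_Cons)
    then show ?case using Cons.IH[OF multiadditive_feed[OF Cons.prems]] by (simp add: add_ac)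
  qed
  then show ?thesis unfolding multiadditive_def by blast
qed

lemma multiadditive_map:
  assumes "multiadditive \<phi>" and "\<And>x y. \<eta> (x + y) = \<eta> x + \<eta> y"
  shows "multiadditive (\<lambda>xs. \<phi> (map \<eta> xs))"
  using assms unfolding multiadditive_def by simp

text \<open>
  The same homotopy for the concatenation of the two lists.
\<close>

definition contract2 ::
    "('v \<Rightarrow> 'v) \<Rightarrow> ('v \<Rightarrow> 'v) \<Rightarrow> ('v list \<Rightarrow> 'v list \<Rightarrow> 'r::comm_monoid_add) \<Rightarrow> 'v list \<Rightarrow> 'v list \<Rightarrow> 'r" where
  "contract2 h \<eta> \<Phi> xs ys = contract h \<eta> (\<lambda>u. \<Phi> u ys) xs + contract h \<eta> (\<Phi> (map \<eta> xs)) ys"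

lemma contract_cong:
  "(\<And>us. length us = length xs \<Longrightarrow> \<phi> us = \<psi> us) \<Longrightarrow> contract h \<eta> \<phi> xs = contract h \<eta> \<psi> xs"
proof (induction xs arbitrary: \<phi> \<psi>)
  case (Cons x xs)
  have "\<phi> (h x # xs) = \<psi> (h x # xs)" by (rule Cons.prems) simp
  moreover have "contract h \<eta> (feed (\<eta> x) \<phi>) xs = contract h \<eta> (feed (\<eta> x) \<psi>) xs"
    by (rule Cons.IH, rule Cons.prems) simp
  ultimately show ?case by simp
qed simp

lemma contract_apply: "contract h \<eta> \<Phi> xs z = contract h \<eta> (\<lambda>u. \<Phi> u z) xs"
  by (induction xs arbitrary: \<Phi>) simp_all

lemma contract2_apply: "contract2 h \<eta> \<Phi> xs ys z = contract2 h \<eta> (\<lambda>u v. \<Phi> u v z) xs ys"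
  by (simp add: contract2_def contract_apply)

lemma contract2_cong:
  "(\<And>us vs. length us = length xs \<Longrightarrow> length vs = length ys \<Longrightarrow> \<Phi> us vs = \<Psi> us vs) \<Longrightarrow>
    contract2 h \<eta> \<Phi> xs ys = contract2 h \<eta> \<Psi> xs ys"
  unfolding contract2_def by (intro arg_cong2[where f="(+)"] contract_cong) auto

lemma bimultiadditive_add:
  fixes \<Phi> \<Psi> :: "'v::ab_group_add2 list \<Rightarrow> 'v list \<Rightarrow> 'r::ab_group_add2"
  shows "bimultiadditive \<Phi> \<Longrightarrow> bimultiadditive \<Psi> \<Longrightarrow> bimultiadditive (\<lambda>xs ys. \<Phi> xs ys + \<Psi> xs ys)"
  unfolding bimultiadditive_def multiadditive_def by (simp add: add_ac)

lemma bimultiadditive_plus: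
  fixes \<Phi> \<Psi> :: "'v::ab_group_add2 list \<Rightarrow> 'v list \<Rightarrow> 'r::ab_group_add2"
  shows "bimultiadditive \<Phi> \<Longrightarrow> bimultiadditive \<Psi> \<Longrightarrow> bimultiadditive (\<Phi> + \<Psi>)"
  unfolding bimultiadditive_def multiadditive_def by (simp add: add_ac)

lemma bimultiadditive_0: "bimultiadditive (0 :: 'v::ab_group_add2 list \<Rightarrow> 'v list \<Rightarrow> 'r::ab_group_add2)"
  unfolding bimultiadditive_def multiadditive_def by simp

lemma bimultiadditive_sum:
  fixes \<Phi> :: "'i \<Rightarrow> 'v::ab_group_add2 list \<Rightarrow> 'v list \<Rightarrow> 'r::ab_group_add2"
  shows "(\<And>i. i \<in> A \<Longrightarrow> bimultiadditive (\<Phi> i)) \<Longrightarrow> bimultiadditive (\<Sum>i\<in>A. \<Phi> i)"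
  by (induction A rule: infinite_finite_induct)
     (simp_all only: sum.infinite sum.empty sum.insert bimultiadditive_0 bimultiadditive_plus insertI1 insertI2
        not_False_eq_True)

lemma bimultiadditive_swap: "bimultiadditive \<Phi> \<Longrightarrow> bimultiadditive (swap_args \<Phi>)"
  unfolding bimultiadditive_def swap_args_def[abs_def] by simp

lemma bimultiadditive_swaps: "bimultiadditive \<Phi> \<Longrightarrow> bimultiadditive ((swap_args ^^ i) \<Phi>)"
  by (induction i) (auto intro: bimultiadditive_swap)

lemma multiadditive_contract_parameter:
  fixes \<Psi> :: "'v::ab_group_add2 list \<Rightarrow> 'w list \<Rightarrow> 'r::ab_group_add2"
  assumes "\<And>v. multiadditive (\<lambda>u. \<Psi> u v)"
  shows "multiadditive (\<lambda>xs. contract h \<eta> (\<Psi> xs) ys)"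
  using assms
proof (induction ys arbitrary: \<Psi>)
  case Nil
  then show ?case by (simp add: multiadditive_def)
next
  case (Cons y ys)
  then have "multiadditive (\<lambda>xs. contract h \<eta> (feed (\<eta> y) (\<Psi> xs)) ys)" by simp
  then show ?case
    using multiadditive_add[OF Cons.prems[of "h y # ys"]] by (simp add: plus_fun_def)
qed

lemma bimultiadditive_contract2:
  fixes \<Phi> :: "'v::ab_group_add2 list \<Rightarrow> 'v list \<Rightarrow> 'r::ab_group_add2"
  assumes \<Phi>: "bimultiadditive \<Phi>" and h: "\<And>x y. h (x + y) = h x + h y" and \<eta>: "\<And>x y. \<eta> (x + y) = \<eta> x + \<eta> y"
  shows "bimultiadditive (contract2 h \<eta> \<Phi>)"
proof -
  have \<Phi>1: "multiadditive (\<lambda>u. \<Phi> u v)" and \<Phi>2: "multiadditive (\<Phi> u)" for u v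
    using \<Phi> by (auto simp: bimultiadditive_def)
  have "multiadditive (\<lambda>xs. \<Phi> (map \<eta> xs) v)" for v
    using multiadditive_map[of "\<lambda>u. \<Phi> u v" \<eta>, OF \<Phi>1 \<eta>] .
  then have "multiadditive (\<lambda>xs. contract h \<eta> (\<Phi> (map \<eta> xs)) ys)" for ys
    by (rule multiadditive_contract_parameter)
  then have "multiadditive (\<lambda>xs. contract2 h \<eta> \<Phi> xs ys)" for ys
    using multiadditive_add[OF multiadditive_contract[OF \<Phi>1[of ys] h \<eta>]]
    by (simp add: contract2_def plus_fun_def)
  moreover have "multiadditive (contract2 h \<eta> \<Phi> xs)" for xs
    using multiadditive_add[OF multiadditive_contract_parameter[of "\<lambda>v u. \<Phi> u v" h \<eta> xs] multiadditive_contract[OF \<Phi>2[of "map \<eta> xs"] h \<eta>]] \<Phi>2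
    by (simp add: contract2_def[abs_def] plus_fun_def)
  ultimately show ?thesis by (simp add: bimultiadditive_def)
qed

section \<open>Twisted sequences of operations\<close>

context dg_ring2 begin

lemma swaps_cupop: "(swap_args ^^ i) (\<Phi> \<smile> \<Psi>) = (swap_args ^^ i) \<Phi> \<smile> (swap_args ^^ i) \<Psi>"
  by (induction i) (simp_all only: funpow.simps o_apply id_apply swap_cupop)

lemma swaps_total_d: "total_d ((swap_args ^^ i) \<Phi>) = (swap_args ^^ i) (total_d \<Phi>)"
  by (induction i) (simp_all only: funpow.simps o_apply id_apply swap_total_d)

definition cup_sum :: "(nat \<Rightarrow> 'v list \<Rightarrow> 'v list \<Rightarrow> 'v) \<Rightarrow> nat \<Rightarrow> 'v list \<Rightarrow> 'v list \<Rightarrow> 'v" where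
  "cup_sum E k = (\<Sum>i\<le>k. E i \<smile> (swap_args ^^ i) (E (k - i)))"

definition symmetrized_pred :: "(nat \<Rightarrow> 'v list \<Rightarrow> 'v list \<Rightarrow> 'v) \<Rightarrow> nat \<Rightarrow> 'v list \<Rightarrow> 'v list \<Rightarrow> 'v" where
  "symmetrized_pred E k = (case k of 0 \<Rightarrow> 0 | Suc j \<Rightarrow> E j + swap_args (E j))"

definition defect :: "(nat \<Rightarrow> 'v list \<Rightarrow> 'v list \<Rightarrow> 'v) \<Rightarrow> nat \<Rightarrow> 'v list \<Rightarrow> 'v list \<Rightarrow> 'v" where
  "defect E k = total_d (E k) + cup_sum E k + symmetrized_pred E k"

lemma swap_symmetrized_pred: "swap_args (symmetrized_pred E k) = symmetrized_pred E k"
  by (cases k) (simp_all only: symmetrized_pred_def nat.case swap_args_0 swap_args_add swap_args_swap_args add.commute)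

text \<open>
  The obstruction to solving for \<open>E k\<close> is a twisted cycle, whatever \<open>E k\<close> is.  Differentiating the sum
  of the \<open>E i \<smile> T\<^sup>i E (k - i)\<close> and substituting \<open>defect + cup_sum + symmetrized_pred\<close> for each
  \<open>total_d (E i)\<close>, the triple cup products occur twice by associativity, and the terms
  with \<open>symmetrized_pred\<close> add up to \<open>total_d (symmetrized_pred E k)\<close>, because \<open>T\<close> is an involution.
\<close>

lemma total_d_defect:
  assumes lower: "\<And>i. i < k \<Longrightarrow> defect E i = 0"
    and dd: "total_d (total_d (E k)) = 0"
  shows "total_d (defect E k) = E 0 \<smile> defect E k + defect E k \<smile> (swap_args ^^ k) (E 0)"
proof -
  define T where "T i = (swap_args ^^ i :: ('v list \<Rightarrow> 'v list \<Rightarrow> 'v) \<Rightarrow> _)" for i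
  define P where "P = symmetrized_pred E"
  have T_simps: "T i (\<Phi> + \<Psi>) = T i \<Phi> + T i \<Psi>" "T i (\<Phi> \<smile> \<Psi>) = T i \<Phi> \<smile> T i \<Psi>"
      "T i (T j \<Phi>) = T (i + j) \<Phi>" "T i (swap_args \<Phi>) = T (Suc i) \<Phi>" "T i 0 = 0"
      "T i (\<Sum>j\<in>A. f j) = (\<Sum>j\<in>A. T i (f j))" "total_d (T i \<Phi>) = T i (total_d \<Phi>)" for i j \<Phi> \<Psi> A and f :: "nat \<Rightarrow> _"
    unfolding T_def by (rule swaps_add swaps_cupop swaps_swaps swaps_swap swaps_0 swaps_sum swaps_total_d)+
  have dE: "total_d (E i) = defect E i + (cup_sum E i + P i)" for i
    by (simp only: defect_def P_def add2_simps)
  \<comment> \<open>Only the undetermined index \<open>k\<close> contributes, since all lower defects vanish.\<close>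
  have first: "(\<Sum>i\<le>k. defect E i \<smile> T i (E (k - i))) = defect E k \<smile> T k (E 0)"
  proof -
    have "(\<Sum>i\<le>k. defect E i \<smile> T i (E (k - i))) = (\<Sum>i\<in>{k}. defect E i \<smile> T i (E (k - i)))"
      by (rule sum.mono_neutral_right) (auto simp: lower cupop_0)
    then show ?thesis by simp
  qed
  have second: "(\<Sum>i\<le>k. E i \<smile> T i (defect E (k - i))) = E 0 \<smile> defect E k"
  proof -
    have "(\<Sum>i\<le>k. E i \<smile> T i (defect E (k - i))) = (\<Sum>i\<in>{0}. E i \<smile> T i (defect E (k - i)))"
      by (rule sum.mono_neutral_right) (auto simp: lower T_simps cupop_0)
    then show ?thesis by (simp add: T_def)
  qed
  \<comment> \<open>The triple products \<open>E a \<smile> T\<^sup>a E b \<smile> T\<^sup>a\<^sup>+\<^sup>b E c\<close> with \<open>a + b + c = k\<close>, bracketed in either way.\<close>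
  define g where "g a b = E a \<smile> (T a (E b) \<smile> T (a + b) (E (k - (a + b))))" for a b
  have "(\<Sum>i\<le>k. cup_sum E i \<smile> T i (E (k - i))) = (\<Sum>i\<le>k. \<Sum>j\<le>i. g j (i - j))"
    by (intro sum.cong refl) (simp add: cup_sum_def cupop_sum g_def cupop_assoc flip: T_def)
  also have "\<dots> = (\<Sum>(i, j)\<in>{(i, j). i + j \<le> k}. g i j)"
    by (rule sum.triangle_reindex_eq[symmetric])
  also have "{(i, j). i + j \<le> k} = Sigma {..k} (\<lambda>i. {..k - i})"
    by auto
  also have "(\<Sum>(i, j)\<in>\<dots>. g i j) = (\<Sum>i\<le>k. \<Sum>j\<le>k - i. g i j)"
    by (rule sum.Sigma[symmetric]) auto
  also have "\<dots> = (\<Sum>i\<le>k. E i \<smile> T i (cup_sum E (k - i)))"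
    by (intro sum.cong refl) (simp add: cup_sum_def cupop_sum g_def T_simps flip: T_def)
  finally have quadratic: "(\<Sum>i\<le>k. cup_sum E i \<smile> T i (E (k - i))) = (\<Sum>i\<le>k. E i \<smile> T i (cup_sum E (k - i)))" .
  have linear: "(\<Sum>i\<le>k. P i \<smile> T i (E (k - i))) + (\<Sum>i\<le>k. E i \<smile> T i (P (k - i))) = total_d (P k)"
  proof (cases k)
    case 0
    then show ?thesis by (simp only: P_def symmetrized_pred_def nat.case atMost_0 sum.insert sum.empty finite.emptyI
          empty_iff not_False_eq_True T_simps cupop_0 total_d_0 add_0_right diff_0_eq_0)
  next
    case (Suc n)
    have "(\<Sum>i\<le>k. P i \<smile> T i (E (k - i))) = (\<Sum>i\<le>n. (E i + swap_args (E i)) \<smile> T (Suc i) (E (n - i)))"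
      unfolding Suc sum.atMost_Suc_shift
      by (simp only: P_def symmetrized_pred_def nat.case cupop_0 add_0_left diff_Suc_Suc)
    moreover have "(\<Sum>i\<le>k. E i \<smile> T i (P (k - i))) = (\<Sum>i\<le>n. E i \<smile> T i (E (n - i) + swap_args (E (n - i))))"
      unfolding Suc sum.atMost_Suc
      by (simp only: P_def symmetrized_pred_def nat.case cupop_0 T_simps add_0_right diff_self_eq_0)
        (intro sum.cong refl, simp only: atMost_iff Suc_diff_le nat.case T_simps)
    moreover have "cup_sum E n = (\<Sum>i\<le>n. E i \<smile> T i (E (n - i)))"
      by (simp only: cup_sum_def T_def)
    moreover have "swap_args (cup_sum E n) = (\<Sum>i\<le>n. swap_args (E i) \<smile> T (Suc i) (E (n - i)))"
    proof -
      have "swap_args (\<Sum>j\<in>A. f j) = (\<Sum>j\<in>A. swap_args (f j))" for A and f :: "nat \<Rightarrow> 'v list \<Rightarrow> 'v list \<Rightarrow> 'v"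
        using swaps_sum[of 1 f A] by simp
      then show ?thesis
        by (simp only: cup_sum_def swap_cupop T_def funpow.simps o_apply)
    qed
    moreover have "total_d (P k) = cup_sum E n + swap_args (cup_sum E n)"
    proof -
      have "total_d (E n) = cup_sum E n + P n"
        using lower[of n] by (simp only: dE Suc lessI add_0_left)
      moreover have P_Suc: "P (Suc n) = E n + swap_args (E n)"
        by (simp only: P_def symmetrized_pred_def nat.case)
      moreover have "swap_args (P n) = P n"
        unfolding P_def by (rule swap_symmetrized_pred)
      ultimately show ?thesis
        by (simp only: Suc P_Suc total_d_add swap_total_d swap_args_add)
          (simp only: add2_simps)
    qed
    ultimately show ?thesis
      by (simp only: cupop_left cupop_right T_simps sum.distrib add2_simps)
  qed
  have "total_d (cup_sum E k) = (\<Sum>i\<le>k. total_d (E i) \<smile> T i (E (k - i))) + (\<Sum>i\<le>k. E i \<smile> T i (total_d (E (k - i))))"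
    by (simp only: cup_sum_def total_d_sum total_d_cupop sum.distrib T_simps flip: T_def)
  also have "\<dots> = defect E k \<smile> T k (E 0) + E 0 \<smile> defect E k + total_d (P k)"
    unfolding dE[of ] cupop_left cupop_right T_simps sum.distrib
    by (simp only: first second quadratic flip: linear)
      (simp only: add2_simps)
  finally show ?thesis
    unfolding defect_def[of E k] total_d_add dd P_def[symmetric]
    by (simp only: flip: defect_def P_def T_def)
      (simp only: P_def[symmetric] add2_simps)
qed


end

section \<open>Closure properties of compatible operations\<close>

text \<open>
  Closure of the operations that respect a relation under everything used to build new operations.
  The relation is binary so that it can compare a cochain with its pullback.
\<close>

locale dg_relation = dg_ring2 d mul
  for d :: "'v::ab_group_add2 \<Rightarrow> 'v" and mul :: "'v \<Rightarrow> 'v \<Rightarrow> 'v" (infixl \<open>\<cdot>\<close> 70) +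
  fixes S :: "int \<Rightarrow> 'v \<Rightarrow> 'v \<Rightarrow> bool"
  assumes S_0: "S n 0 0"
    and S_add: "S n x x' \<Longrightarrow> S n y y' \<Longrightarrow> S n (x + y) (x' + y')"
    and S_d: "S n x x' \<Longrightarrow> S (n + 1) (d x) (d x')"
    and S_mul: "S m x x' \<Longrightarrow> S n y y' \<Longrightarrow> S (m + n) (x \<cdot> y) (x' \<cdot> y')"
begin

lemma S_sum: "(\<And>i. i \<in> A \<Longrightarrow> S n (f i) (f' i)) \<Longrightarrow> S n (\<Sum>i\<in>A. f i) (\<Sum>i\<in>A. f' i)"
  by (induction A rule: infinite_finite_induct) (auto intro: S_0 S_add)

lemma S_d_compat:
  assumes "compat2 S c \<Phi> \<Phi>'"
  shows "compat2 S (c + 1) (\<lambda>xs ys. d (\<Phi> xs ys)) (\<lambda>xs ys. d (\<Phi>' xs ys))"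
  using assms unfolding compat2_def by (metis S_d add.assoc)

lemma compat1_merge: "compat1 S c \<phi> \<phi>' \<Longrightarrow> compat1 S (c + 1) (merge \<phi>) (merge \<phi>')"
proof -
  have "S (m + (c + 1)) (merge \<phi> xs) (merge \<phi>' xs')"
    if "rels S xs xs' m" "compat1 S c \<phi> \<phi>'" for xs xs' m
    using that
  proof (induction arbitrary: \<phi> \<phi>' c rule: rels.induct)
    case rels_Nil
    then show ?case by (simp add: S_0)
  next
    case (rels_Cons n x x' xs xs' m)
    have "S (m + (n - 1 + c + 1)) (merge (feed x \<phi>) xs) (merge (feed x' \<phi>') xs')"
      by (rule rels_Cons.IH[OF compat1_feed[of S, OF rels_Cons.prems rels_Cons.hyps(1)]])
    then have 1: "S (n - 1 + m + (c + 1)) (merge (feed x \<phi>) xs) (merge (feed x' \<phi>') xs')"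
      by (simp add: algebra_simps)
    have 2: "S (n - 1 + m + (c + 1)) (merge_first x \<phi> xs) (merge_first x' \<phi>' xs')"
      using rels_Cons.hyps(2)
    proof cases
      case rels_Nil
      then show ?thesis by (simp add: S_0)
    next
      case (rels_Cons n' y y' ys ys' m')
      show ?thesis unfolding rels_Cons(1,2) merge_first_simps
        by (rule compat1D[OF \<open>compat1 S c \<phi> \<phi>'\<close> rels.rels_Cons[of S, OF S_mul[OF \<open>S n x x'\<close> rels_Cons(4)] rels_Cons(5)]])
          (simp add: rels_Cons(3))
    qed
    show ?case unfolding merge_Cons by (rule S_add[OF 2 1])
  qed
  then show "compat1 S c \<phi> \<phi>' \<Longrightarrow> ?thesis" unfolding compat1_def by blast
qed

lemma compat2_merge:
  assumes "compat2 S c \<Phi> \<Phi>'"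
  shows "compat2 S (c + 1) (\<lambda>xs ys. merge (\<lambda>u. \<Phi> u ys) xs) (\<lambda>xs ys. merge (\<lambda>u. \<Phi>' u ys) xs)"
    and "compat2 S (c + 1) (\<lambda>xs ys. merge (\<Phi> xs) ys) (\<lambda>xs ys. merge (\<Phi>' xs) ys)"
  unfolding compat2_def
proof (safe, goal_cases)
  case (1 xs xs' m ys ys' n)
  show ?case
    by (rule compat1D[OF compat1_merge[OF compat2_left[OF assms 1(2)]] 1(1)]) simp
next
  case (2 xs xs' m ys ys' n)
  show ?case
    by (rule compat1D[OF compat1_merge[OF compat2_right[OF assms 2(1)]] 2(2)]) simp
qed

lemma compat2_0: "compat2 S c 0 0"
  unfolding compat2_def by (simp add: S_0)

lemma compat2_add:
  "compat2 S c \<Phi> \<Phi>' \<Longrightarrow> compat2 S c \<Psi> \<Psi>' \<Longrightarrow> compat2 S c (\<lambda>xs ys. \<Phi> xs ys + \<Psi> xs ys) (\<lambda>xs ys. \<Phi>' xs ys + \<Psi>' xs ys)"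
  unfolding compat2_def by (blast intro: S_add)

lemma compat2_plus:
  "compat2 S c \<Phi> \<Phi>' \<Longrightarrow> compat2 S c \<Psi> \<Psi>' \<Longrightarrow> compat2 S c (\<Phi> + \<Psi>) (\<Phi>' + \<Psi>')"
  using compat2_add by (simp add: plus_fun_def)

lemma compat2_sum:
  "(\<And>i. i \<in> A \<Longrightarrow> compat2 S c (\<Phi> i) (\<Phi>' i)) \<Longrightarrow> compat2 S c (\<Sum>i\<in>A. \<Phi> i) (\<Sum>i\<in>A. \<Phi>' i)"
  by (induction A rule: infinite_finite_induct)
    (simp_all only: sum.infinite sum.empty sum.insert compat2_0 compat2_plus insertI1 insertI2 not_False_eq_True)

lemma compat2_cupop:
  assumes "compat2 S c \<Phi> \<Phi>'" "compat2 S c' \<Psi> \<Psi>'"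
  shows "compat2 S (c + c') (\<Phi> \<smile> \<Psi>) (\<Phi>' \<smile> \<Psi>')"
  unfolding compat2_def
proof (intro allI impI)
  fix xs xs' m ys ys' n assume xs: "rels S xs xs' m" and ys: "rels S ys ys' n"
  show "S (m + n + (c + c')) ((\<Phi> \<smile> \<Psi>) xs ys) ((\<Phi>' \<smile> \<Psi>') xs' ys')"
    unfolding cupop_apply rels_length[OF xs] rels_length[OF ys]
  proof (intro S_sum)
    fix p q
    obtain m1 m2 where m: "rels S (take p xs) (take p xs') m1" "rels S (drop p xs) (drop p xs') m2" "m = m1 + m2"
      using rels_split[OF xs] by blast
    obtain n1 n2 where n: "rels S (take q ys) (take q ys') n1" "rels S (drop q ys) (drop q ys') n2" "n = n1 + n2"
      using rels_split[OF ys] by blast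
    have "S ((m1 + n1 + c) + (m2 + n2 + c')) (\<Phi> (take p xs) (take q ys) \<cdot> \<Psi> (drop p xs) (drop q ys))
        (\<Phi>' (take p xs') (take q ys') \<cdot> \<Psi>' (drop p xs') (drop q ys'))"
      by (rule S_mul) (use assms m n in \<open>auto simp: compat2_def\<close>)
    then show "S (m + n + (c + c')) (\<Phi> (take p xs) (take q ys) \<cdot> \<Psi> (drop p xs) (drop q ys))
        (\<Phi>' (take p xs') (take q ys') \<cdot> \<Psi>' (drop p xs') (drop q ys'))"
      by (simp add: m(3) n(3) algebra_simps)
  qed
qed

context
  fixes h h' \<eta> \<eta>' :: "'v \<Rightarrow> 'v"
  assumes h: "S n x x' \<Longrightarrow> S (n - 1) (h x) (h' x')"
    and \<eta>: "S n x x' \<Longrightarrow> S n (\<eta> x) (\<eta>' x')"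
begin

lemma compat1_contract: "compat1 S c \<phi> \<phi>' \<Longrightarrow> compat1 S (c - 1) (contract h \<eta> \<phi>) (contract h' \<eta>' \<phi>')"
proof -
  have "S (m + (c - 1)) (contract h \<eta> \<phi> xs) (contract h' \<eta>' \<phi>' xs')"
    if "rels S xs xs' m" "compat1 S c \<phi> \<phi>'" for xs xs' m
    using that
  proof (induction arbitrary: \<phi> \<phi>' c rule: rels.induct)
    case rels_Nil
    then show ?case by (simp add: S_0)
  next
    case (rels_Cons n x x' xs xs' m)
    have "S (m + (n - 1 + c - 1)) (contract h \<eta> (feed (\<eta> x) \<phi>) xs) (contract h' \<eta>' (feed (\<eta>' x') \<phi>') xs')"
      by (rule rels_Cons.IH[OF compat1_feed[of S, OF rels_Cons.prems \<eta>[OF rels_Cons.hyps(1)]]])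
    then have 1: "S (n - 1 + m + (c - 1)) (contract h \<eta> (feed (\<eta> x) \<phi>) xs) (contract h' \<eta>' (feed (\<eta>' x') \<phi>') xs')"
      by (simp add: algebra_simps)
    have "S ((n - 1) - 1 + m + c) (\<phi> (h x # xs)) (\<phi>' (h' x' # xs'))"
      using rels_Cons.prems rels.rels_Cons[of S, OF h[OF rels_Cons.hyps(1)] rels_Cons.hyps(2)]
      unfolding compat1_def by blast
    then have "S (n - 1 + m + (c - 1)) (\<phi> (h x # xs)) (\<phi>' (h' x' # xs'))"
      by (simp add: algebra_simps)
    then show ?case using 1 by (simp add: S_add)
  qed
  then show "compat1 S c \<phi> \<phi>' \<Longrightarrow> ?thesis" unfolding compat1_def by blast
qed

lemma compat2_contract2:
  assumes "compat2 S c \<Phi> \<Phi>'"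
  shows "compat2 S (c - 1) (contract2 h \<eta> \<Phi>) (contract2 h' \<eta>' \<Phi>')"
  unfolding compat2_def contract2_def
proof (intro allI impI S_add)
  fix xs xs' m ys ys' n assume xs: "rels S xs xs' m" and ys: "rels S ys ys' n"
  show "S (m + n + (c - 1)) (contract h \<eta> (\<lambda>u. \<Phi> u ys) xs) (contract h' \<eta>' (\<lambda>u. \<Phi>' u ys') xs')"
    by (rule compat1D[OF compat1_contract[OF compat2_left[OF assms ys]] xs]) simp
  have \<eta>xs: "rels S (map \<eta> xs) (map \<eta>' xs') m"
    using rels_map[of S \<eta> \<eta>'] \<eta> xs by blast
  show "S (m + n + (c - 1)) (contract h \<eta> (\<Phi> (map \<eta> xs)) ys) (contract h' \<eta>' (\<Phi>' (map \<eta>' xs')) ys')"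
    by (rule compat1D[OF compat1_contract[OF compat2_right[OF assms \<eta>xs]] ys]) simp
qed

end

end


section \<open>The homotopy formula for operations\<close>

context dg_ring2 begin

definition internal2 :: "('v list \<Rightarrow> 'v list \<Rightarrow> 'r::comm_monoid_add) \<Rightarrow> 'v list \<Rightarrow> 'v list \<Rightarrow> 'r" where
  "internal2 \<Phi> xs ys = internal (\<lambda>u. \<Phi> u ys) xs + internal (\<Phi> xs) ys"

lemma internal2_apply: "internal2 \<Phi> xs ys z = internal2 (\<lambda>u v. \<Phi> u v z) xs ys"
  by (simp add: internal2_def internal_apply)

lemma internal2_cong:
  "(\<And>us vs. length us = length xs \<Longrightarrow> length vs = length ys \<Longrightarrow> \<Phi> us vs = \<Psi> us vs) \<Longrightarrow>
    internal2 \<Phi> xs ys = internal2 \<Psi> xs ys"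
  unfolding internal2_def internal_def by (intro arg_cong2[where f="(+)"] sum.cong) (auto simp: apply_at_def)

lemma internal2_add:
  "internal2 (\<lambda>us vs. \<Phi> us vs + \<Psi> us vs) xs ys = internal2 \<Phi> xs ys + internal2 \<Psi> xs ys"
  by (simp add: internal2_def internal_add add_ac)

context
  fixes h \<eta> :: "'v \<Rightarrow> 'v"
  assumes h_add: "h (x + y) = h x + h y"
    and \<eta>_add: "\<eta> (x + y) = \<eta> x + \<eta> y"
    and homotopy: "d (h x) + h (d x) = x + \<eta> x"
    and d_\<eta>: "d (\<eta> x) = 0"
    and \<eta>_d: "\<eta> (d x) = 0"
begin

text \<open>
  The standard homotopy is a homotopy between \<open>\<phi>\<close> and \<open>\<phi>\<close> with \<open>\<eta>\<close> applied to all arguments.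
  The contributions of \<open>h x\<close> and \<open>\<eta> x\<close> for the first argument telescope with those of the tail.
\<close>

lemma internal_contract:
  fixes \<phi> :: "'v list \<Rightarrow> 'r::ab_group_add2"
  assumes "multiadditive \<phi>"
  shows "internal (contract h \<eta> \<phi>) xs + contract h \<eta> (internal \<phi>) xs = \<phi> xs + \<phi> (map \<eta> xs)"
  using assms
proof (induction xs arbitrary: \<phi>)
  case Nil
  then show ?case by simp
next
  case (Cons x xs)
  note m0 = multiadditive_0[OF Cons.prems]
  have "\<phi> (d (h x) # xs) + \<phi> (h (d x) # xs) = \<phi> (x # xs) + \<phi> (\<eta> x # xs)"
    using multiadditive_head[OF Cons.prems] homotopy[of x] by metis
  then have "\<phi> (d (h x) # xs) = \<phi> (h (d x) # xs) + (\<phi> (x # xs) + \<phi> (\<eta> x # xs))"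
    by (metis add_left_self add.commute)
  moreover have "internal (contract h \<eta> (feed (\<eta> x) \<phi>)) xs
      = contract h \<eta> (internal (feed (\<eta> x) \<phi>)) xs + (\<phi> (\<eta> x # xs) + \<phi> (\<eta> x # map \<eta> xs))"
    using Cons.IH[OF multiadditive_feed[OF Cons.prems], of "\<eta> x"] by (metis add_left_self add.commute)
  ultimately show ?case
    by (simp add: internal_Cons contract_add internal_add d_\<eta> \<eta>_d m0 add_ac)
qed

lemma internal_map_\<eta>:
  fixes \<phi> :: "'v list \<Rightarrow> 'r::ab_group_add2"
  assumes "multiadditive \<phi>"
  shows "internal (\<lambda>u. \<phi> (map \<eta> u)) xs = 0" and "internal \<phi> (map \<eta> xs) = 0"
proof -
  have "internal (\<lambda>u. \<phi> (map \<eta> u)) xs = 0 \<and> internal \<phi> (map \<eta> xs) = 0"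
    using assms
  proof (induction xs arbitrary: \<phi>)
    case (Cons x xs)
    from Cons.IH[OF multiadditive_feed[OF Cons.prems], of "\<eta> x"] show ?case
      by (simp add: internal_Cons \<eta>_d d_\<eta> multiadditive_0[OF Cons.prems])
  qed simp
  then show "internal (\<lambda>u. \<phi> (map \<eta> u)) xs = 0" and "internal \<phi> (map \<eta> xs) = 0" by auto
qed

lemma contract_internal_commute:
  fixes \<Phi> :: "'v list \<Rightarrow> 'v list \<Rightarrow> 'r::ab_group_add2"
  shows "contract h \<eta> (\<lambda>u. internal (\<Phi> u) ys) xs = internal (\<lambda>v. contract h \<eta> (\<lambda>u. \<Phi> u v) xs) ys"
  by (induction xs arbitrary: \<Phi>) (simp_all add: internal_add)

text \<open>
  The two one-list homotopies compose, passing through the intermediate function in which \<open>\<eta>\<close> is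
  applied to the first list only.  The cross terms vanish, because \<open>\<eta>\<close> annihilates and is annihilated by
  \<open>d\<close>, or cancel, because the two lists are independent.
\<close>

lemma internal2_contract2:
  fixes \<Phi> :: "'v list \<Rightarrow> 'v list \<Rightarrow> 'r::ab_group_add2"
  assumes "bimultiadditive \<Phi>"
  shows "internal2 (contract2 h \<eta> \<Phi>) xs ys + contract2 h \<eta> (internal2 \<Phi>) xs ys
     = \<Phi> xs ys + \<Phi> (map \<eta> xs) (map \<eta> ys)"
proof -
  have \<Phi>1: "multiadditive (\<lambda>u. \<Phi> u v)" and \<Phi>2: "multiadditive (\<Phi> u)" for u v
    using assms by (auto simp: bimultiadditive_def)
  have "multiadditive (\<lambda>xs. contract h \<eta> (\<Phi> xs) ys)"
    by (rule multiadditive_contract_parameter[OF \<Phi>1])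
  then have z1: "internal (\<lambda>u. contract h \<eta> (\<Phi> (map \<eta> u)) ys) xs = 0"
    using internal_map_\<eta>(1)[of "\<lambda>u. contract h \<eta> (\<Phi> u) ys" xs] by simp
  have z2: "internal (\<lambda>u. \<Phi> u v) (map \<eta> xs) = 0" for v
    by (rule internal_map_\<eta>(2)[OF \<Phi>1])
  define A B C D X where "A = internal (contract h \<eta> (\<lambda>u. \<Phi> u ys)) xs"
    and "B = contract h \<eta> (internal (\<lambda>u. \<Phi> u ys)) xs"
    and "C = internal (contract h \<eta> (\<Phi> (map \<eta> xs))) ys"
    and "D = contract h \<eta> (internal (\<Phi> (map \<eta> xs))) ys"
    and "X = internal (\<lambda>v. contract h \<eta> (\<lambda>u. \<Phi> u v) xs) ys"
  have "internal2 (contract2 h \<eta> \<Phi>) xs ys = A + X + C"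
    by (simp add: internal2_def contract2_def[abs_def] internal_add z1 A_def C_def X_def add_ac)
  moreover have "contract2 h \<eta> (internal2 \<Phi>) xs ys = B + X + D"
    by (simp add: internal2_def[abs_def] contract2_def contract_add z2 B_def D_def X_def
        contract_internal_commute add_ac)
  moreover have "A + B = \<Phi> xs ys + \<Phi> (map \<eta> xs) ys"
    unfolding A_def B_def by (rule internal_contract[OF \<Phi>1])
  moreover have "C + D = \<Phi> (map \<eta> xs) ys + \<Phi> (map \<eta> xs) (map \<eta> ys)"
    unfolding C_def D_def by (rule internal_contract[OF \<Phi>2])
  moreover have "A + X + C + (B + X + D) = (A + B) + (C + D)"
    by (simp only: add2_simps)
  ultimately show ?thesis
    by (simp only: add2_simps)
qed

end
end

context dg_ring2 begin

lemma multiadditive_conv: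
  fixes f :: "'r::ab_group_add2 \<Rightarrow> 's::ab_group_add2 \<Rightarrow> 't::ab_group_add2"
    and \<phi> :: "'v list \<Rightarrow> 'r" and \<psi> :: "'v list \<Rightarrow> 's"
  assumes f: "biadditive f" and "multiadditive \<phi>" "multiadditive \<psi>"
  shows "multiadditive (conv f \<phi> \<psi>)"
proof -
  have "conv f \<phi> \<psi> (us @ (x + y) # vs) = conv f \<phi> \<psi> (us @ x # vs) + conv f \<phi> \<psi> (us @ y # vs)" for us x y vs
    using assms(2)
  proof (induction us arbitrary: \<phi>)
    case Nil
    then show ?case
      by (simp add: conv_Cons multiadditive_head assms(3) biadditive_right[OF f] conv_add[OF f] add_ac)
  next
    case (Cons u us)
    have "\<psi> (u # us @ (x + y) # vs) = \<psi> (u # us @ x # vs) + \<psi> (u # us @ y # vs)"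
      using assms(3) unfolding multiadditive_def by (metis append_Cons)
    then show ?case
      using Cons.IH[OF multiadditive_feed[OF Cons.prems]] by (simp add: conv_Cons biadditive_right[OF f] add_ac)
  qed
  then show ?thesis unfolding multiadditive_def by blast
qed

lemma multiadditive_fun_iff: "multiadditive \<Phi> \<longleftrightarrow> (\<forall>y. multiadditive (\<lambda>xs. \<Phi> xs y))"
  unfolding multiadditive_def fun_eq_iff plus_fun_apply by blast

lemma bimultiadditive_cupop:
  assumes "bimultiadditive \<Phi>" "bimultiadditive \<Psi>"
  shows "bimultiadditive (\<Phi> \<smile> \<Psi>)"
  unfolding bimultiadditive_def
proof safe
  show "multiadditive (\<lambda>xs. (\<Phi> \<smile> \<Psi>) xs ys)" for ys
    using multiadditive_conv[OF biadditive_conv[OF mul_biadditive], of \<Phi> \<Psi>] assms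
    unfolding bimultiadditive_def by (simp add: multiadditive_fun_iff)
  show "multiadditive ((\<Phi> \<smile> \<Psi>) xs)" for xs
  proof -
    have "(\<Phi> \<smile> \<Psi>) xs = (\<lambda>ys. \<Sum>p\<le>length xs. conv mul (\<Phi> (take p xs)) (\<Psi> (drop p xs)) ys)"
      by (simp add: fun_eq_iff conv_def[of "conv mul"] sum_fun_apply)
    moreover have "multiadditive \<dots>"
      using assms by (intro multiadditive_sum multiadditive_conv mul_biadditive) (auto simp: bimultiadditive_def)
    ultimately show ?thesis by simp
  qed
qed

lemma multiadditive_merge_parameter:
  fixes \<Phi> :: "'v list \<Rightarrow> 'v list \<Rightarrow> 'r::ab_group_add2"
  assumes "\<And>ys. multiadditive (\<lambda>xs. \<Phi> xs ys)"
  shows "multiadditive (\<lambda>xs. merge (\<Phi> xs) ys)"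
  unfolding merge_def by (intro multiadditive_sum assms)

lemma bimultiadditive_merge:
  fixes \<Phi> :: "'v list \<Rightarrow> 'v list \<Rightarrow> 'r::ab_group_add2"
  assumes "bimultiadditive \<Phi>"
  shows "bimultiadditive (\<lambda>xs ys. merge (\<lambda>u. \<Phi> u ys) xs)" and "bimultiadditive (\<lambda>xs ys. merge (\<Phi> xs) ys)"
proof -
  have \<Phi>1: "\<And>v. multiadditive (\<lambda>u. \<Phi> u v)" and \<Phi>2: "\<And>u. multiadditive (\<Phi> u)"
    using assms by (auto simp: bimultiadditive_def)
  show "bimultiadditive (\<lambda>xs ys. merge (\<lambda>u. \<Phi> u ys) xs)"
    unfolding bimultiadditive_def
    using multiadditive_merge[OF \<Phi>1] multiadditive_merge_parameter[of "\<lambda>v u. \<Phi> u v"] \<Phi>2 by simp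
  show "bimultiadditive (\<lambda>xs ys. merge (\<Phi> xs) ys)"
    unfolding bimultiadditive_def
    using multiadditive_merge[OF \<Phi>2] multiadditive_merge_parameter[of \<Phi>] \<Phi>1 by simp
qed

lemma bimultiadditive_d: "bimultiadditive \<Phi> \<Longrightarrow> bimultiadditive (\<lambda>xs ys. d (\<Phi> xs ys))"
  unfolding bimultiadditive_def multiadditive_def by (simp add: d_add)

lemma internal2_internal2:
  fixes \<Phi> :: "'v list \<Rightarrow> 'v list \<Rightarrow> 'v"
  assumes "bimultiadditive \<Phi>"
  shows "internal2 (internal2 \<Phi>) xs ys = 0"
proof -
  have ii: "internal (internal \<phi>) zs = 0" if "multiadditive \<phi>" for \<phi> :: "'v list \<Rightarrow> 'v" and zs
    using that
  proof (induction zs arbitrary: \<phi>)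
    case (Cons z zs)
    then show ?case
      by (simp add: internal_Cons internal_add d_d multiadditive_0 multiadditive_feed add2_simps)
  qed simp
  have comm: "internal (\<lambda>u. internal (\<Phi> u) ys) xs = internal (\<lambda>v. internal (\<lambda>u. \<Phi> u v) xs) ys"
  proof -
    have "internal (\<lambda>v. \<Sum>i\<in>A. \<Psi> i v) zs = (\<Sum>i\<in>A. internal (\<Psi> i) zs)" for A :: "nat set" and \<Psi> :: "nat \<Rightarrow> 'v list \<Rightarrow> 'v" and zs
      by (induction A rule: infinite_finite_induct) (auto simp: internal_add)
    then show ?thesis by (simp add: internal_def[of _ xs])
  qed
  show ?thesis
    using assms
    by (simp add: internal2_def[abs_def] internal_add comm ii bimultiadditive_def)
qed

end

text \<open>
  Bits are used as the elements of a field, not through their description by bit operations.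
\<close>

declare add_bit_eq_xor [simp del] mult_bit_eq_and [simp del]

section \<open>Functions on words and their braces\<close>

text \<open>
  Words in the natural numbers are the ordered simplices of an infinite simplex, possibly degenerate.  The empty word is kept
  for the sake of recursion on the first letter; differential and cup product ignore the value there.
\<close>

type_synonym word_cochain = "nat list \<Rightarrow> bit"

definition shift :: "nat \<Rightarrow> word_cochain \<Rightarrow> word_cochain" where
  "shift x f = (\<lambda>w. f (x # w))"

definition trunc :: "word_cochain \<Rightarrow> word_cochain" where
  "trunc f w = (if w = [] then 0 else f w)"

definition word_d :: "word_cochain \<Rightarrow> word_cochain" where
  "word_d f w = (if length w \<le> 1 then 0 else \<Sum>i<length w. f (take i w @ drop (Suc i) w))"

text \<open>
  The augmented differential, for which the empty word is the face of a one-letter word.  It satisfies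
  a recursion on the first letter without exceptional cases; \<open>word_d\<close> is obtained from it by
  forgetting the value on the empty word.
\<close>

definition aug_d :: "word_cochain \<Rightarrow> word_cochain" where
  "aug_d f w = (\<Sum>i<length w. f (take i w @ drop (Suc i) w))"

definition word_cup :: "word_cochain \<Rightarrow> word_cochain \<Rightarrow> word_cochain" where
  "word_cup f g w = (\<Sum>i<length w. f (take (Suc i) w) * g (drop i w))"

lemma shift_apply: "shift x f w = f (x # w)"
  by (simp add: shift_def)

lemma shift_add: "shift x (f + g) = shift x f + shift x g"
  by (simp add: shift_def fun_eq_iff)

lemma trunc_add: "trunc (f + g) = trunc f + trunc g"
  by (simp add: trunc_def fun_eq_iff)

lemma trunc_eq: "f [] = 0 \<Longrightarrow> trunc f = f"
  by (auto simp: trunc_def)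

lemma shift_trunc [simp]: "shift x (trunc f) = shift x f"
  by (simp add: shift_def trunc_def fun_eq_iff)

lemma aug_d_Nil [simp]: "aug_d f [] = 0"
  by (simp add: aug_d_def)

lemma aug_d_Cons: "aug_d f (x # w) = f w + aug_d (shift x f) w"
  by (simp add: aug_d_def sum.lessThan_Suc_shift shift_def del: sum.lessThan_Suc)

lemma shift_aug_d: "shift x (aug_d f) = f + aug_d (shift x f)"
  by (simp add: fun_eq_iff shift_apply aug_d_Cons)

lemma word_d_eq: "word_d f = aug_d (trunc f)"
proof
  fix w show "word_d f w = aug_d (trunc f) w"
    by (cases w rule: remdups_adj.cases) (auto simp: word_d_def aug_d_def trunc_def intro!: sum.cong)
qed

lemma word_cup_Nil [simp]: "word_cup f g [] = 0"
  by (simp add: word_cup_def)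

lemma word_cup_Cons: "word_cup f g (x # w) = f [x] * g (x # w) + word_cup (shift x f) g w"
  by (simp add: word_cup_def sum.lessThan_Suc_shift shift_def del: sum.lessThan_Suc)

lemma word_cup_trunc_left [simp]: "word_cup (trunc f) g = word_cup f g"
  by (auto simp: word_cup_def trunc_def fun_eq_iff intro!: sum.cong)

lemma word_cup_trunc_right [simp]: "word_cup f (trunc g) = word_cup f g"
  by (auto simp: word_cup_def trunc_def fun_eq_iff intro!: sum.cong)

lemma aug_d_add: "aug_d (f + g) = aug_d f + aug_d g"
  by (simp add: aug_d_def fun_eq_iff sum.distrib)

lemma biadditive_word_cup: "biadditive word_cup"
  by (simp add: biadditive_def word_cup_def fun_eq_iff sum.distrib algebra_simps)

lemmas word_cup_left = biadditive_left[OF biadditive_word_cup]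
lemmas word_cup_right = biadditive_right[OF biadditive_word_cup]

lemma word_cup_left_apply: "word_cup (f + f') g w = word_cup f g w + word_cup f' g w"
  and word_cup_right_apply: "word_cup f (g + g') w = word_cup f g w + word_cup f g' w"
  by (simp_all add: word_cup_left word_cup_right)

lemmas word_cup_0 [simp] = biadditive_0[OF biadditive_word_cup]

definition word_scale :: "bit \<Rightarrow> word_cochain \<Rightarrow> word_cochain" where
  "word_scale r f = (\<lambda>w. r * f w)"

lemma word_scale_apply: "word_scale r f w = r * f w"
  by (simp add: word_scale_def)

lemma word_cup_scale:
  "word_cup (word_scale r f) g w = r * word_cup f g w"
  "word_cup f (word_scale r g) w = r * word_cup f g w"
  by (simp_all add: word_cup_def word_scale_def sum_distrib_left mult_ac)

lemma aug_d_scale: "aug_d (word_scale r f) w = r * aug_d f w"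
  by (simp add: aug_d_def word_scale_def sum_distrib_left)

lemma shift_word_cup: "shift x (word_cup f g) = word_scale (f [x]) (shift x g) + word_cup (shift x f) g"
  by (simp add: fun_eq_iff shift_apply word_cup_Cons word_scale_apply)

lemma word_cup_assoc: "word_cup (word_cup f g) k = word_cup f (word_cup g k)"
proof
  fix w show "word_cup (word_cup f g) k w = word_cup f (word_cup g k) w"
  proof (induction w arbitrary: f)
    case (Cons x w)
    show ?case
      by (simp add: word_cup_Cons[of _ _ x] shift_word_cup word_cup_left word_cup_scale Cons algebra_simps)
  qed simp
qed

lemma aug_d_aug_d: "aug_d (aug_d f) w = 0"
  by (induction w arbitrary: f) (simp_all add: aug_d_Cons shift_aug_d aug_d_add)

text \<open>
  The Leibniz rule for the augmented differential has two correction terms from the empty word.  The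
  induction needs them, since \<open>shift x f\<close> need not vanish on the empty word even if \<open>f\<close> does.
\<close>

lemma aug_d_word_cup:
  assumes "w \<noteq> []"
  shows "aug_d (word_cup f g) w
    = word_cup (aug_d f) g w + word_cup f (aug_d g) w + f [] * g w + f w * g []"
  using assms
proof (induction w arbitrary: f)
  case (Cons x w)
  show ?case
  proof (cases "w = []")
    case True
    then show ?thesis by (simp add: aug_d_Cons word_cup_Cons algebra_simps)
  next
    case False
    then show ?thesis
      using Cons.IH[OF False, of "shift x f"]
      by (simp add: aug_d_Cons word_cup_Cons shift_word_cup shift_aug_d aug_d_add aug_d_scale
          word_cup_left algebra_simps word_scale_apply)
        (simp add: shift_apply)
  qed
qed simp

interpretation W: dg_ring2 word_d word_cup
proof
  fix f g k :: word_cochain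
  show "word_d (f + g) = word_d f + word_d g"
    by (simp only: word_d_eq trunc_add aug_d_add)
  show "word_d (word_d f) = 0"
    by (simp add: word_d_eq trunc_eq fun_eq_iff aug_d_aug_d)
  show "biadditive word_cup" by (rule biadditive_word_cup)
  show "word_cup (word_cup f g) k = word_cup f (word_cup g k)" by (rule word_cup_assoc)
  show "word_d (word_cup f g) = word_cup (word_d f) g + word_cup f (word_d g)"
  proof
    fix w
    have "trunc (word_cup f g) = word_cup (trunc f) (trunc g)" by (simp add: trunc_eq)
    then show "word_d (word_cup f g) w = (word_cup (word_d f) g + word_cup f (word_d g)) w"
      by (cases "w = []") (simp_all add: word_d_eq aug_d_word_cup trunc_def[of _ "[]"] del: word_cup_trunc_left word_cup_trunc_right,
         simp add: trunc_eq)
  qed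
qed

text \<open>
  The block evaluated by \<open>b\<close> may start at any letter of the word.  The letters up to and including this one have
  then been fed to \<open>a\<close>, and \<open>G\<close>, which stands for the brace with the remaining blocks, continues at the
  end of the block.
\<close>

primrec insert_block :: "word_cochain \<Rightarrow> (word_cochain \<Rightarrow> word_cochain) \<Rightarrow> nat list \<Rightarrow> word_cochain \<Rightarrow> bit" where
  "insert_block b G [] a = 0"
| "insert_block b G (x # w) a = word_cup b (G (shift x a)) (x # w) + insert_block b G w (shift x a)"

text \<open>
  The brace \<open>E\<^sub>1\<^sub>,\<^sub>k (a; b\<^sub>1, \<dots>, b\<^sub>k)\<close>, i.e. the action of the surjection \<open>1 2 1 3 1 \<dots> 1 (k+1) 1\<close>.
  The list comes first because the recursion is on it.
\<close>

primrec word_brace :: "word_cochain list \<Rightarrow> word_cochain \<Rightarrow> word_cochain" where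
  "word_brace [] a = a"
| "word_brace (b # bs) a = (\<lambda>w. insert_block b (word_brace bs) w a)"

lemma word_brace_Nil [simp]: "word_brace (b # bs) a [] = 0"
  and word_brace_Cons: "word_brace (b # bs) a (x # w)
    = word_cup b (word_brace bs (shift x a)) (x # w) + word_brace (b # bs) (shift x a) w"
  by simp_all

lemma shift_word_brace: "shift x (word_brace (b # bs) a)
    = shift x (word_cup b (word_brace bs (shift x a))) + word_brace (b # bs) (shift x a)"
  by (simp add: fun_eq_iff shift_apply)

lemmas [simp del] = word_brace.simps(2)

lemma word_brace_add: "word_brace bs (a + a') = word_brace bs a + word_brace bs a'"
proof (induction bs arbitrary: a a')
  case (Cons b bs)
  have "word_brace (b # bs) (a + a') w = word_brace (b # bs) a w + word_brace (b # bs) a' w" for w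
    \<comment> \<open>Induction over words generalizes over cochains and leaves sums of these in eta-expanded form,
      which pointwise evaluation would take apart too early.\<close>
    by (induction w arbitrary: a a')
      (simp_all add: word_brace_Cons shift_add Cons word_cup_right_apply add_ac del: plus_fun_apply)
  then show ?case by (rule ext[OF trans[OF _ plus_fun_apply[symmetric]]])
qed simp

lemma word_brace_0 [simp]: "word_brace bs 0 = 0"
  using word_brace_add[of bs 0 0] by simp

lemma word_brace_scale: "word_brace bs (word_scale r a) = word_scale r (word_brace bs a)"
  using word_brace_0[of bs] by (cases r) (simp_all add: word_scale_def flip: zero_fun_def)

lemma multiadditive_word_brace: "multiadditive (\<lambda>bs. word_brace bs a)"
proof -
  have "word_brace (us @ (x + y) # vs) a w = word_brace (us @ x # vs) a w + word_brace (us @ y # vs) a w" for us x y vs w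
  proof (induction us arbitrary: a w)
    case Nil
    show ?case
      by (induction w arbitrary: a) (simp_all add: word_brace_Cons word_cup_left_apply add_ac del: plus_fun_apply)
  next
    case (Cons u us)
    then have "word_brace (us @ (x + y) # vs) a = word_brace (us @ x # vs) a + word_brace (us @ y # vs) a" for a
      by (rule ext[OF trans[OF _ plus_fun_apply[symmetric]]])
    then show ?case
      by (induction w arbitrary: a) (simp_all add: word_brace_Cons word_cup_right_apply add_ac del: plus_fun_apply)
  qed
  then show ?thesis unfolding multiadditive_def by (simp add: fun_eq_iff)
qed

lemma word_brace_trunc: "word_brace (b # bs) (trunc a) = word_brace (b # bs) a"
proof
  fix w show "word_brace (b # bs) (trunc a) w = word_brace (b # bs) a w"
    by (cases w) (simp_all add: word_brace_Cons)
qed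

lemma word_cup_word_brace_Cons:
  "word_cup (word_brace (b # bs) a) g (x # w)
   = word_cup (word_cup b (word_brace bs (shift x a))) g (x # w) + word_cup (word_brace (b # bs) (shift x a)) g w"
  by (simp add: word_cup_Cons[of _ g] shift_word_brace word_cup_left word_brace_Cons add_ac)

text \<open>
  The word that the product \<open>a1 \<cdot> a2\<close> evaluates is cut at one of its letters.  This letter also cuts \<open>w\<close>
  and separates the blocks left of it from those right of it.
\<close>

lemma word_brace_word_cup:
  "word_brace bs (word_cup a1 a2) = conv word_cup (\<lambda>u. word_brace u a1) (\<lambda>u. word_brace u a2) bs"
proof (induction bs arbitrary: a1 a2)
  case Nil
  then show ?case by (simp add: conv_Nil)
next
  case (Cons b bs)
  have "word_brace (b # bs) (word_cup a1 a2) w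
      = conv word_cup (\<lambda>u. word_brace u a1) (\<lambda>u. word_brace u a2) (b # bs) w" for w
  proof (induction w arbitrary: a1)
    case Nil
    show ?case by (simp add: conv_def sum_fun_apply)
  next
    case C: (Cons x w)
    have "conv word_cup (\<lambda>u. word_brace (b # u) a1) (\<lambda>u. word_brace u a2) bs (x # w)
        = word_cup b (conv word_cup (\<lambda>u. word_brace u (shift x a1)) (\<lambda>u. word_brace u a2) bs) (x # w)
        + conv word_cup (\<lambda>u. word_brace (b # u) (shift x a1)) (\<lambda>u. word_brace u a2) bs w"
      by (simp only: conv_def sum_fun_apply word_cup_word_brace_Cons sum.distrib
          biadditive_sum[OF biadditive_word_cup] word_cup_assoc)
    moreover have "word_brace (b # bs) (word_cup a1 a2) (x # w) =
        a1 [x] * word_brace (b # bs) a2 (x # w)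
        + word_cup b (word_brace bs (word_cup (shift x a1) a2)) (x # w)
        + word_brace (b # bs) (word_cup (shift x a1) a2) w"
      by (simp add: word_brace_Cons shift_word_cup word_brace_add word_brace_scale word_cup_right
          word_cup_scale word_scale_apply algebra_simps)
    ultimately show ?case
      by (simp add: C Cons conv_Cons word_cup_Cons[of a1] add_ac)
  qed
  then show ?case by (simp add: fun_eq_iff)
qed

text \<open>
  The terms \<open>b\<^sub>1 E (a; b\<^sub>2, \<dots>, b\<^sub>k)\<close> and \<open>E (a; b\<^sub>1, \<dots>, b\<^bsub>k-1\<^esub>) b\<^sub>k\<close>, in which \<open>d\<close> removes an end of the
  word seen by \<open>a\<close>.
\<close>

definition left_end :: "word_cochain list \<Rightarrow> word_cochain \<Rightarrow> word_cochain" where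
  "left_end bs a = (case bs of [] \<Rightarrow> 0 | b # bs' \<Rightarrow> word_cup b (word_brace bs' a))"

definition right_end :: "word_cochain list \<Rightarrow> word_cochain \<Rightarrow> word_cochain" where
  "right_end bs a = (if bs = [] then 0 else word_cup (word_brace (butlast bs) a) (last bs))"

text \<open>
  Both sides are expanded along the first letter \<open>x\<close> of the word: either the first block starts at \<open>x\<close>, or \<open>a\<close>
  consumes \<open>x\<close>.  Besides the terms covered by the two induction hypotheses, each side leaves
  \<open>b \<cdot> E (shift x a; bs)\<close> on the tail, \<open>b \<cdot> E (a; bs)\<close> on the whole word, a product of the first two blocks, and,
  for a single block, a correction from the empty word.
\<close>

lemma aug_d_word_brace:
  "aug_d (word_brace bs a) w + word_brace bs (aug_d a) w + W.bar (\<lambda>u. word_brace u a) bs w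
   = left_end bs a w + right_end bs a w"
proof (induction bs arbitrary: a w)
  case Nil
  then show ?case by (simp add: left_end_def right_end_def)
next
  case (Cons b bs)
  show ?case
  proof (induction w arbitrary: a)
    case Nil
    have "W.bar (\<lambda>u. word_brace u a) (b # bs) [] = 0"
      by (cases bs) (simp_all add: W.bar_Cons W.bar_apply W.merge_first_apply)
    then show ?case by (simp add: left_end_def right_end_def)
  next
    case C: (Cons x w)
    define a' where "a' = shift x a"
    define G where "G = word_brace bs a'"
    note add2_simps[simp]
    \<comment> \<open>The Leibniz correction survives only if \<open>b\<close> is the last block and reaches the end of the word.\<close>
    have G0: "b (x # w) * G [] = (if bs = [] then b (x # w) * a [x] else 0)"
      by (cases bs) (simp_all add: G_def a'_def shift_apply)
    have leib: "aug_d (word_cup b G) (x # w) = word_cup (word_d b) G (x # w) + word_cup b (aug_d G) (x # w) + b (x # w) * G []"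
      using aug_d_word_cup[of "x # w" "trunc b" G] by (simp add: word_d_eq trunc_def)
    have 1: "aug_d (word_brace (b # bs) a) (x # w)
      = word_brace (b # bs) a w + word_cup b G w + aug_d (word_cup b G) (x # w) + aug_d (word_brace (b # bs) a') w"
      by (simp add: aug_d_Cons shift_word_brace aug_d_add G_def a'_def)
    have 2: "word_brace (b # bs) (aug_d a) (x # w) = word_cup b (word_brace bs a) (x # w)
      + word_cup b (word_brace bs (aug_d a')) (x # w) + word_brace (b # bs) a w + word_brace (b # bs) (aug_d a') w"
      by (simp add: word_brace_Cons shift_aug_d word_brace_add word_cup_right a'_def)
    have 3: "W.bar (\<lambda>u. word_brace u a) (b # bs) (x # w)
      = word_cup (word_d b) G (x # w) + word_brace (word_d b # bs) a' w
      + W.merge_first b (\<lambda>u. word_brace u a) bs (x # w)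
      + word_cup b (W.bar (\<lambda>u. word_brace u a') bs) (x # w)
      + W.bar (\<lambda>u. word_brace (b # u) a') bs w"
    proof -
      have "W.bar (\<lambda>u. word_cup b (word_brace u a') (x # w)) bs = word_cup b (W.bar (\<lambda>u. word_brace u a') bs) (x # w)"
        by (rule W.bar_linear[of "\<lambda>f. word_cup b f (x # w)"]) (simp_all add: word_cup_right)
      then show ?thesis
        by (simp add: W.bar_Cons word_brace_Cons W.bar_apply[of _ _ "x # w"] W.bar_apply[of _ _ w] W.bar_add G_def a'_def)
    qed
    \<comment> \<open>The two sides are brought to the same normal form.\<close>
    have L: "aug_d (word_brace (b # bs) a) (x # w) + word_brace (b # bs) (aug_d a) (x # w) + W.bar (\<lambda>u. word_brace u a) (b # bs) (x # w)
      = word_cup b G w + word_cup b (word_brace bs a) (x # w) + b (x # w) * G []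
      + word_cup b (\<lambda>w. left_end bs a' w + right_end bs a' w) (x # w)
      + (left_end (b # bs) a' w + right_end (b # bs) a' w)
      + W.merge_first b (\<lambda>u. word_brace u a) bs (x # w) + W.merge_first b (\<lambda>u. word_brace u a') bs w"
    proof -
      have "(\<lambda>w. left_end bs a' w + right_end bs a' w) = aug_d G + word_brace bs (aug_d a') + W.bar (\<lambda>u. word_brace u a') bs"
        by (simp only: fun_eq_iff plus_fun_apply G_def Cons.IH simp_thms)
      moreover have "left_end (b # bs) a' w + right_end (b # bs) a' w = aug_d (word_brace (b # bs) a') w
        + word_brace (b # bs) (aug_d a') w + word_brace (word_d b # bs) a' w
        + W.merge_first b (\<lambda>u. word_brace u a') bs w + W.bar (\<lambda>u. word_brace (b # u) a') bs w"
        using C[of a'] by (simp only: W.bar_Cons plus_fun_apply add_ac)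
      ultimately show ?thesis
        unfolding 1 2 3 leib by (simp only: word_cup_right plus_fun_apply add2_simps)
    qed
    have R: "left_end (b # bs) a (x # w) + right_end (b # bs) a (x # w)
      = word_cup b G w + word_cup b (word_brace bs a) (x # w) + b (x # w) * G []
      + word_cup b (\<lambda>w. left_end bs a' w + right_end bs a' w) (x # w)
      + (left_end (b # bs) a' w + right_end (b # bs) a' w)
      + W.merge_first b (\<lambda>u. word_brace u a) bs (x # w) + W.merge_first b (\<lambda>u. word_brace u a') bs w"
    proof (cases bs)
      case Nil
      then show ?thesis
        by (simp add: left_end_def right_end_def G_def a'_def word_cup_Cons[of a] shift_apply flip: zero_fun_def)
    next
      case D: (Cons b' bs')
      have "word_cup b (\<lambda>w. left_end bs a' w + right_end bs a' w) = word_cup b (left_end bs a') + word_cup b (right_end bs a')"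
        unfolding word_cup_right[symmetric] by (simp add: plus_fun_def)
      then show ?thesis
        unfolding G0
        by (simp add: D left_end_def right_end_def G_def word_cup_word_brace_Cons word_brace_Cons word_cup_assoc flip: a'_def)
    qed
    show ?case unfolding L R ..
  qed
qed

text \<open>
  The value of \<open>a\<close> on the empty word is immaterial for a nonempty list of blocks, so \<open>a\<close> may be
  truncated, which turns the augmented differential into the true one.
\<close>

theorem word_d_word_brace:
  assumes "bs \<noteq> []"
  shows "word_d (word_brace bs a) + word_brace bs (word_d a) + W.bar (\<lambda>u. word_brace u a) bs
   = left_end bs a + right_end bs a"
proof
  fix w
  obtain b bs' where bs: "bs = b # bs'" using assms by (cases bs) auto
  have t: "word_brace u (trunc a) = word_brace u a" if "u \<noteq> []" for u
    using that word_brace_trunc by (cases u) auto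
  have c1: "word_cup c (word_brace u (trunc a)) = word_cup c (word_brace u a)"
    and c2: "word_cup (word_brace u (trunc a)) c = word_cup (word_brace u a) c" for u c
    by (cases "u = []"; simp add: t)+
  have "W.bar (\<lambda>u. word_brace u (trunc a)) bs = W.bar (\<lambda>u. word_brace u a) bs"
    unfolding W.bar_def W.internal_def W.merge_def
    by (intro arg_cong2[where f="(+)"] sum.cong refl t)
      (use assms in \<open>auto simp: apply_at_def merge_at_def\<close>)
  then show "(word_d (word_brace bs a) + word_brace bs (word_d a) + W.bar (\<lambda>u. word_brace u a) bs) w
      = (left_end bs a + right_end bs a) w"
    using aug_d_word_brace[of bs "trunc a" w] assms
    by (simp add: word_d_eq trunc_eq bs t c1 c2 left_end_def right_end_def del: word_cup_trunc_left word_cup_trunc_right)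
qed

text \<open>
  The sum of \<open>G\<close> over all lists in the composition formula for braces: \<open>k\<close> entries of \<open>cs\<close> precede the first block,
  which absorbs the next \<open>l\<close> entries.
\<close>

primrec insertion_sum :: "('c \<Rightarrow> 'c list \<Rightarrow> 'c) \<Rightarrow> 'c list \<Rightarrow> ('c list \<Rightarrow> 'r::comm_monoid_add) \<Rightarrow> 'c list \<Rightarrow> 'r" where
  "insertion_sum F [] G cs = G cs"
| "insertion_sum F (b # bs) G cs = (\<Sum>k\<le>length cs. \<Sum>l\<le>length cs - k.
     insertion_sum F bs (\<lambda>L. G (take k cs @ F b (take l (drop k cs)) # L)) (drop (k + l) cs))"

text \<open>
  Sorting by the first entry of the resulting list: the block with \<open>b\<close>, or the entry \<open>c\<close>.
\<close>

lemma insertion_sum_Cons_Cons: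
  "insertion_sum F (b # bs) G (c # cs) =
     (\<Sum>l\<le>Suc (length cs). insertion_sum F bs (\<lambda>L. G (F b (take l (c # cs)) # L)) (drop l (c # cs)))
     + insertion_sum F (b # bs) (\<lambda>L. G (c # L)) cs"
  by (simp add: sum.atMost_Suc_shift[of _ "length cs"] del: sum.atMost_Suc)

lemma insertion_sum_Nil:
  assumes "\<And>b. F b [] = b"
  shows "insertion_sum F bs G [] = G bs"
  by (induction bs arbitrary: G) (simp_all add: assms)

lemma insertion_sum_add:
  "insertion_sum F bs (\<lambda>L. G L + G' L) cs = insertion_sum F bs G cs + insertion_sum F bs G' cs"
  by (induction bs arbitrary: G G' cs) (simp_all add: sum.distrib)

lemma insertion_sum_linear:
  assumes "\<And>x y. f (x + y) = f x + f y" "f 0 = 0"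
  shows "f (insertion_sum F bs G cs) = insertion_sum F bs (\<lambda>L. f (G L)) cs"
proof -
  have "f (\<Sum>i\<in>A. g i) = (\<Sum>i\<in>A. f (g i))" for A :: "nat set" and g
    by (induction A rule: infinite_finite_induct) (auto simp: assms)
  then show ?thesis by (induction bs arbitrary: G cs) simp_all
qed

lemma insertion_sum_apply: "insertion_sum F bs G cs w = insertion_sum F bs (\<lambda>L. G L w) cs"
  by (rule insertion_sum_linear[of "\<lambda>f. f w"]) simp_all

text \<open>
  An interval marked for \<open>cs\<close> in the word seen by the inner brace lies in a single block of \<open>bs\<close> or outside all
  of them.  Formally, the recursion for the outer brace splits \<open>shift x (E (a; b # bs))\<close> into a product
  \<open>b \<cdot> E (shift x a; bs)\<close> and a term of the same form as the original one; on the product,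
  \<open>word_brace_word_cup\<close> distributes \<open>cs\<close> over \<open>b\<close> and the remaining blocks.
\<close>

theorem word_brace_word_brace:
  "word_brace cs (word_brace bs a) = insertion_sum (\<lambda>b u. word_brace u b) bs (\<lambda>L. word_brace L a) cs"
proof (induction "length bs + length cs" arbitrary: bs cs a rule: less_induct)
  case less
  let ?I = "insertion_sum (\<lambda>b u. word_brace u b)"
  show ?case
  proof (cases bs)
    case Nil
    then show ?thesis by simp
  next
    case bs: (Cons b bs')
    show ?thesis
    proof (cases cs)
      case Nil
      then show ?thesis by (simp add: insertion_sum_Nil)
    next
      case cs: (Cons c cs')
      have "word_brace cs (word_brace bs a) w = ?I bs (\<lambda>L. word_brace L a w) cs" for w
      proof (induction w arbitrary: a)
        case Nil
        have "?I vs (\<lambda>L. 0 :: bit) us = 0" for vs us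
          by (induction vs arbitrary: us) simp_all
        then show ?case
          by (simp add: bs cs insertion_sum_Cons_Cons del: insertion_sum.simps)
      next
        case (Cons x w)
        define a' where "a' = shift x a"
        define G where "G = word_brace bs' a'"
        have unfold: "word_brace (y # L) a (x # w) = word_cup y (word_brace L a') (x # w) + word_brace (y # L) a' w" for y L
          by (simp add: word_brace_Cons a'_def)
        have lin: "word_cup y (?I vs (\<lambda>L. word_brace L a') us) (x # w) = ?I vs (\<lambda>L. word_cup y (word_brace L a') (x # w)) us" for y vs us
          by (rule insertion_sum_linear[of "\<lambda>f. word_cup y f (x # w)"]) (simp_all add: word_cup_right)
        have IH1: "word_brace (drop l cs) G = ?I bs' (\<lambda>L. word_brace L a') (drop l cs)" for l
          unfolding G_def by (rule less) (simp add: bs cs)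
        have IH2: "word_brace cs' (word_brace bs a') = ?I bs (\<lambda>L. word_brace L a') cs'"
          by (rule less) (simp add: cs)
        have "word_brace cs (word_brace bs a) (x # w) = word_brace cs (word_cup b G) (x # w)
            + word_cup c (word_brace cs' (word_brace bs a')) (x # w) + word_brace cs (word_brace bs a') w"
          by (simp add: cs bs word_brace_Cons[of c] shift_word_brace word_brace_add word_cup_right G_def a'_def add_ac)
        also have "word_brace cs (word_cup b G) (x # w) =
            (\<Sum>l\<le>length cs. ?I bs' (\<lambda>L. word_cup (word_brace (take l cs) b) (word_brace L a') (x # w)) (drop l cs))"
          by (simp add: word_brace_word_cup conv_def sum_fun_apply IH1 lin)
        also have "word_cup c (word_brace cs' (word_brace bs a')) (x # w) = ?I bs (\<lambda>L. word_cup c (word_brace L a') (x # w)) cs'"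
          by (simp only: IH2 lin)
        also have "word_brace cs (word_brace bs a') w = ?I bs (\<lambda>L. word_brace L a' w) cs"
          by (rule Cons)
        finally show ?case
          by (simp add: bs cs insertion_sum_Cons_Cons unfold insertion_sum_add sum.distrib add_ac
              del: insertion_sum.simps sum.atMost_Suc)
      qed
      then show ?thesis by (simp add: fun_eq_iff insertion_sum_apply)
    qed
  qed
qed

section \<open>The filling of a twisted cycle\<close>

text \<open>
  The contraction of the words onto the vertex \<open>v\<close>.  The values on the empty word are chosen such
  that the homotopy formula holds there as well.
\<close>

definition cone_at :: "nat \<Rightarrow> word_cochain \<Rightarrow> word_cochain" where
  "cone_at v f w = (if w = [] then 0 else f (v # w))"

definition at_vertex :: "nat \<Rightarrow> word_cochain \<Rightarrow> word_cochain" where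
  "at_vertex v f w = (if w = [] then f [] else if length w = 1 then f [v] else 0)"

lemma cone_at_add: "cone_at v (f + g) = cone_at v f + cone_at v g"
  and at_vertex_add: "at_vertex v (f + g) = at_vertex v f + at_vertex v g"
  by (simp_all add: cone_at_def at_vertex_def fun_eq_iff)

lemma cone_at_homotopy: "word_d (cone_at v f) + cone_at v (word_d f) = f + at_vertex v f"
proof
  fix w show "(word_d (cone_at v f) + cone_at v (word_d f)) w = (f + at_vertex v f) w"
  proof (cases w)
    case Nil
    then show ?thesis by (simp add: word_d_def cone_at_def at_vertex_def)
  next
    case (Cons x u)
    show ?thesis
    proof (cases "u = []")
      case True
      then show ?thesis using Cons by (simp add: word_d_def cone_at_def at_vertex_def add2_simps)
    next
      case False
      have "word_d (cone_at v f) w = aug_d (shift v f) w"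
        unfolding word_d_def aug_d_def using Cons False
        by (auto simp: cone_at_def shift_def intro!: sum.cong)
      moreover have "word_d f (v # w) = f w + aug_d (shift v f) w"
        using Cons by (simp add: word_d_eq aug_d_Cons trunc_def)
      ultimately show ?thesis using Cons False by (simp add: cone_at_def at_vertex_def add2_simps)
    qed
  qed
qed

lemma word_d_at_vertex: "word_d (at_vertex v f) = 0"
proof
  fix w show "word_d (at_vertex v f) w = 0 w"
    by (cases w rule: remdups_adj.cases) (auto simp: word_d_def at_vertex_def sum.lessThan_Suc_shift sum.neutral split: if_splits)
qed

lemma at_vertex_word_d: "at_vertex v (word_d f) = 0"
  by (auto simp: at_vertex_def word_d_def fun_eq_iff)

type_synonym word_op = "word_cochain list \<Rightarrow> word_cochain list \<Rightarrow> word_cochain"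

notation W.cupop (infixl \<open>\<smile>\<close> 70)

text \<open>
  The operations of upper index 0, extended by the conventions for empty lists.
\<close>

definition brace_op :: word_op where
  "brace_op as bs = (case as of [] \<Rightarrow> (case bs of [b] \<Rightarrow> b | _ \<Rightarrow> 0) | [a] \<Rightarrow> word_brace bs a | _ \<Rightarrow> 0)"

lemma brace_op_simps [simp]:
  "brace_op [] [] = 0" "brace_op [] [b] = b" "brace_op [] (b # b' # bs) = 0"
  "brace_op [a] bs = word_brace bs a" "brace_op (a # a' # as) bs = 0"
  by (simp_all add: brace_op_def)

lemma bimultiadditive_brace_op: "bimultiadditive brace_op"
proof -
  have 1: "brace_op (us @ (x + y) # vs) bs = brace_op (us @ x # vs) bs + brace_op (us @ y # vs) bs" for us x y vs bs
    by (cases us; cases vs; cases "tl us") (auto simp: brace_op_def word_brace_add split: list.splits)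
  have 2: "brace_op as (us @ (x + y) # vs) = brace_op as (us @ x # vs) + brace_op as (us @ y # vs)" for us x y vs as
  proof (cases as)
    case Nil
    then show ?thesis by (cases us; cases vs; cases "tl us") (auto simp: brace_op_def split: list.splits)
  next
    case (Cons a as')
    then show ?thesis
      using multiadditive_word_brace[of a] by (cases as') (auto simp: multiadditive_def)
  qed
  show ?thesis unfolding bimultiadditive_def multiadditive_def using 1 2 by blast
qed

text \<open>
  The defect of \<open>\<Phi>\<close> without its internal part and without the terms that do not depend on \<open>\<Phi>\<close>.  Each of its
  summands involves \<open>\<Phi>\<close> only for fewer arguments or on shorter words.
\<close>

definition remainder :: "nat \<Rightarrow> word_op \<Rightarrow> word_op" where
  "remainder k \<Phi> = (\<lambda>as bs. word_d (\<Phi> as bs) + W.merge (\<lambda>u. \<Phi> u bs) as + W.merge (\<Phi> as) bs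
     + (brace_op \<smile> \<Phi>) as bs + (\<Phi> \<smile> (swap_args ^^ k) brace_op) as bs)"

lemma swaps_brace_op_Nil: "(swap_args ^^ k) brace_op [] [] = 0"
  by (induction k) (simp_all add: swap_args_def)

lemma word_cup_cong:
  assumes "\<And>u. length u \<le> length w \<Longrightarrow> f u = f' u" "\<And>u. length u \<le> length w \<Longrightarrow> g u = g' u"
  shows "word_cup f g w = word_cup f' g' w"
  unfolding word_cup_def using assms by (intro sum.cong refl) simp

text \<open>
  This locality makes the recursive definition of \<open>filling\<close> possible and drives the induction that
  proves it to be a solution.  The cup products are no exception: the one cut that would leave all
  arguments to \<open>\<Phi>\<close> is multiplied by an operation without arguments, which is zero.
\<close>

lemma remainder_cong:
  assumes \<Phi>\<Psi>: "\<And>us vs u. length us + length vs + length u < length as + length bs + length w \<Longrightarrow> \<Phi> us vs u = \<Psi> us vs u"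
  shows "remainder k \<Phi> as bs w = remainder k \<Psi> as bs w"
proof -
  have "word_d (\<Phi> as bs) w = word_d (\<Psi> as bs) w"
    unfolding word_d_def using \<Phi>\<Psi> by (auto intro!: sum.cong)
  moreover have "W.merge (\<lambda>u. \<Phi> u bs) as w = W.merge (\<lambda>u. \<Psi> u bs) as w" "W.merge (\<Phi> as) bs w = W.merge (\<Psi> as) bs w"
    unfolding W.merge_def sum_fun_apply by (intro sum.cong refl \<Phi>\<Psi>; auto simp: merge_at_def)+
  moreover have "(brace_op \<smile> \<Phi>) as bs w = (brace_op \<smile> \<Psi>) as bs w"
    unfolding W.cupop_apply sum_fun_apply
  proof (intro sum.cong refl)
    fix p q assume "p \<in> {..length as}" "q \<in> {..length bs}"
    then show "word_cup (brace_op (take p as) (take q bs)) (\<Phi> (drop p as) (drop q bs)) w =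
          word_cup (brace_op (take p as) (take q bs)) (\<Psi> (drop p as) (drop q bs)) w"
      by (cases "p = 0 \<and> q = 0") (auto intro!: word_cup_cong \<Phi>\<Psi>)
  qed
  moreover have "(\<Phi> \<smile> (swap_args ^^ k) brace_op) as bs w = (\<Psi> \<smile> (swap_args ^^ k) brace_op) as bs w"
    unfolding W.cupop_apply sum_fun_apply
  proof (intro sum.cong refl)
    fix p q assume "p \<in> {..length as}" "q \<in> {..length bs}"
    then show "word_cup (\<Phi> (take p as) (take q bs)) ((swap_args ^^ k) brace_op (drop p as) (drop q bs)) w =
          word_cup (\<Psi> (take p as) (take q bs)) ((swap_args ^^ k) brace_op (drop p as) (drop q bs)) w"
      by (cases "p = length as \<and> q = length bs") (auto intro!: word_cup_cong \<Phi>\<Psi> simp: swaps_brace_op_Nil)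
  qed
  ultimately show ?thesis unfolding remainder_def by (simp only: plus_fun_apply)
qed

text \<open>
  The right-hand side of the recursion, as an operator.  The apex of the cone is the first letter of the word on which
  the result is evaluated.
\<close>

definition filling_step :: "nat \<Rightarrow> word_op \<Rightarrow> word_op \<Rightarrow> word_op" where
  "filling_step k C \<Phi> as bs w = (if as = [] \<or> bs = [] \<or> w = [] then 0
     else contract2 (cone_at (hd w)) (at_vertex (hd w)) (remainder k \<Phi> + C) as bs w)"

text \<open>
  The fixed point of \<open>filling_step\<close>: by locality, the iterates do not change any more at given
  arguments and a given word once there are more of them than the three lengths together.
\<close>

definition filling :: "nat \<Rightarrow> word_op \<Rightarrow> word_op" where
  "filling k C as bs w = (filling_step k C ^^ Suc (length as + length bs + length w)) 0 as bs w"

lemma filling_step_cong: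
  assumes "\<And>us vs u. length us + length vs + length u < length as + length bs + length w \<Longrightarrow> \<Phi> us vs u = \<Psi> us vs u"
  shows "filling_step k C \<Phi> as bs w = filling_step k C \<Psi> as bs w"
  unfolding filling_step_def contract2_apply
  using assms by (auto intro!: contract2_cong remainder_cong)

lemma filling_step_stable:
  assumes "length as + length bs + length w < n"
  shows "(filling_step k C ^^ n) 0 as bs w = filling k C as bs w"
proof -
  have "(filling_step k C ^^ n) 0 as bs w = (filling_step k C ^^ m) 0 as bs w"
    if "length as + length bs + length w < n" "length as + length bs + length w < m" for n m as bs w
    using that
  proof (induction "length as + length bs + length w" arbitrary: as bs w n m rule: less_induct)
    case less
    obtain n' where n: "n = Suc n'" using less.prems by (cases n) auto
    obtain m' where m: "m = Suc m'" using less.prems by (cases m) auto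
    show ?case unfolding n m funpow.simps o_apply
      by (rule filling_step_cong, rule less.hyps) (use less.prems n m in auto)
  qed
  then show ?thesis unfolding filling_def using assms by blast
qed

lemma filling_eq: "filling k C = filling_step k C (filling k C)"
proof (intro ext)
  fix as bs w
  have "filling k C as bs w = filling_step k C ((filling_step k C ^^ (length as + length bs + length w)) 0) as bs w"
    by (simp add: filling_def)
  also have "\<dots> = filling_step k C (filling k C) as bs w"
    by (intro filling_step_cong filling_step_stable)
  finally show "filling k C as bs w = filling_step k C (filling k C) as bs w" .
qed

lemma filling_Nil [simp]: "filling k C [] bs = 0" "filling k C as [] = 0" "filling k C as bs [] = 0"
  by (subst filling_eq, simp add: filling_step_def fun_eq_iff)+

lemma bimultiadditive_remainder:
  assumes "bimultiadditive \<Phi>"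
  shows "bimultiadditive (remainder k \<Phi>)"
  unfolding remainder_def
  by (intro bimultiadditive_add W.bimultiadditive_d W.bimultiadditive_merge W.bimultiadditive_cupop
      bimultiadditive_swaps bimultiadditive_brace_op assms)

lemma bimultiadditive_filling_step:
  assumes "bimultiadditive \<Phi>" "bimultiadditive C"
  shows "bimultiadditive (filling_step k C \<Phi>)"
proof -
  have "bimultiadditive (contract2 (cone_at v) (at_vertex v) (remainder k \<Phi> + C))" for v
    by (intro bimultiadditive_contract2 bimultiadditive_plus bimultiadditive_remainder assms cone_at_add at_vertex_add)
  then show ?thesis
    unfolding bimultiadditive_def multiadditive_def fun_eq_iff filling_step_def by simp
qed

lemma bimultiadditive_filling:
  assumes "bimultiadditive C"
  shows "bimultiadditive (filling k C)"
proof -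
  have "bimultiadditive ((filling_step k C ^^ n) 0)" for n
    by (induction n) (simp_all only: funpow.simps o_apply id_apply bimultiadditive_0 bimultiadditive_filling_step assms)
  then show ?thesis
    unfolding bimultiadditive_def multiadditive_def fun_eq_iff filling_def by (simp del: funpow.simps)
qed

section \<open>Degree, normalization and naturality\<close>

text \<open>
  The map \<open>g\<close> of alphabets relates the apices of the cones on both sides.  Since \<open>filling\<close> depends on the word through its
  first letter (apex) and its length (number of iterations), the relation has to survive such
  choices made word by word; this is \<open>S_glue\<close>.
\<close>

locale word_relation = dg_relation word_d word_cup S
  for S :: "int \<Rightarrow> word_cochain \<Rightarrow> word_cochain \<Rightarrow> bool" +
  fixes g :: "nat \<Rightarrow> nat"
  assumes S_cone: "S n f f' \<Longrightarrow> S (n - 1) (cone_at (g v) f) (cone_at v f')"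
    and S_at_vertex: "S n f f' \<Longrightarrow> S n (at_vertex (g v) f) (at_vertex v f')"
    and S_glue: "(\<And>v m. S n (X (g v) m) (X' v m)) \<Longrightarrow>
      S n (\<lambda>w. if w = [] then 0 else X (hd w) (length w) w) (\<lambda>w. if w = [] then 0 else X' (hd w) (length w) w)"
    and S_word_brace: "S n a a' \<Longrightarrow> rels S bs bs' m \<Longrightarrow> S (n + m) (word_brace bs a) (word_brace bs' a')"
begin

lemma compat2_brace_op: "compat2 S 1 brace_op brace_op"
  unfolding compat2_def
proof (intro allI impI)
  fix as as' m bs bs' n assume as: "rels S as as' m" and bs: "rels S bs bs' n"
  show "S (m + n + 1) (brace_op as bs) (brace_op as' bs')"
    using as
  proof cases
    case rels_Nil
    from bs show ?thesis
    proof cases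
      case (rels_Cons n x x' xs xs' m)
      from rels_Cons(5) show ?thesis
        by cases (use rels_Nil rels_Cons in \<open>auto simp: S_0\<close>)
    qed (use rels_Nil in \<open>auto simp: S_0\<close>)
  next
    case (rels_Cons n' x x' xs xs' m')
    from rels_Cons(5) show ?thesis
      by cases (use rels_Cons S_word_brace[OF rels_Cons(4) bs] in \<open>auto simp: S_0\<close>)
  qed
qed

lemma compat2_remainder:
  assumes "compat2 S c \<Phi> \<Phi>'"
  shows "compat2 S (c + 1) (remainder k \<Phi>) (remainder k \<Phi>')"
proof -
  have "compat2 S (1 + c) (brace_op \<smile> \<Phi>) (brace_op \<smile> \<Phi>')"
    by (intro compat2_cupop compat2_brace_op assms)
  then have 1: "compat2 S (c + 1) (brace_op \<smile> \<Phi>) (brace_op \<smile> \<Phi>')"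
    by (simp add: add.commute)
  show ?thesis
    unfolding remainder_def
    by (intro compat2_add S_d_compat compat2_merge 1 compat2_cupop compat2_swaps compat2_brace_op assms)
qed

lemma compat2_filling_step:
  assumes "compat2 S c \<Phi> \<Phi>'" and "compat2 S (c + 1) C C'"
  shows "compat2 S c (filling_step k C \<Phi>) (filling_step k C' \<Phi>')"
  unfolding compat2_def
proof (intro allI impI)
  fix as as' m bs bs' n assume as: "rels S as as' m" and bs: "rels S bs bs' n"
  let ?X = "\<lambda>v. contract2 (cone_at v) (at_vertex v) (remainder k \<Phi> + C) as bs"
  let ?X' = "\<lambda>v. contract2 (cone_at v) (at_vertex v) (remainder k \<Phi>' + C') as' bs'"
  have "compat2 S (c + 1 - 1) (contract2 (cone_at (g v)) (at_vertex (g v)) (remainder k \<Phi> + C))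
      (contract2 (cone_at v) (at_vertex v) (remainder k \<Phi>' + C'))" for v
    by (intro compat2_contract2 S_cone S_at_vertex compat2_plus compat2_remainder assms)
  then have "S (m + n + c) (?X (g v)) (?X' v)" for v
    using as bs unfolding compat2_def by simp
  then have "S (m + n + c) (\<lambda>w. if w = [] then 0 else ?X (hd w) w) (\<lambda>w. if w = [] then 0 else ?X' (hd w) w)"
    by (rule S_glue[of _ "\<lambda>v m. ?X v" "\<lambda>v m. ?X' v"])
  moreover have "filling_step k C \<Phi> as bs = (if as = [] \<or> bs = [] then 0 else (\<lambda>w. if w = [] then 0 else ?X (hd w) w))"
    "filling_step k C' \<Phi>' as' bs' = (if as' = [] \<or> bs' = [] then 0 else (\<lambda>w. if w = [] then 0 else ?X' (hd w) w))"
    by (auto simp: filling_step_def fun_eq_iff)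
  moreover have "as = [] \<longleftrightarrow> as' = []" "bs = [] \<longleftrightarrow> bs' = []"
    using rels_length[OF as] rels_length[OF bs] by auto
  ultimately show "S (m + n + c) (filling_step k C \<Phi> as bs) (filling_step k C' \<Phi>' as' bs')"
    by (auto simp: S_0)
qed

lemma compat2_filling:
  assumes "compat2 S (c + 1) C C'"
  shows "compat2 S c (filling k C) (filling k C')"
proof -
  have it: "compat2 S c ((filling_step k C ^^ n) 0) ((filling_step k C' ^^ n) 0)" for n
    by (induction n) (simp_all only: funpow.simps o_apply id_apply compat2_0 compat2_filling_step assms)
  show ?thesis
    unfolding compat2_def
  proof (intro allI impI)
    fix as as' m bs bs' n assume as: "rels S as as' m" and bs: "rels S bs bs' n"
    let ?X = "\<lambda>l. (filling_step k C ^^ Suc (length as + length bs + l)) 0 as bs"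
    let ?X' = "\<lambda>l. (filling_step k C' ^^ Suc (length as + length bs + l)) 0 as' bs'"
    have "S (m + n + c) (?X l) (?X' l)" for l
      using it as bs unfolding compat2_def by blast
    then have "S (m + n + c) (\<lambda>w. if w = [] then 0 else ?X (length w) w) (\<lambda>w. if w = [] then 0 else ?X' (length w) w)"
      by (rule S_glue[of _ "\<lambda>v. ?X" "\<lambda>v. ?X'"])
    moreover have "filling k C as bs = (\<lambda>w. if w = [] then 0 else ?X (length w) w)"
      by (rule ext) (simp add: filling_def[symmetric] del: funpow.simps)
    moreover have "filling k C' as' bs' = (\<lambda>w. if w = [] then 0 else ?X' (length w) w)"
      by (rule ext) (simp add: filling_def[symmetric] rels_length[OF as, symmetric] rels_length[OF bs, symmetric] del: funpow.simps)
    ultimately show "S (m + n + c) (filling k C as bs) (filling k C' as' bs')" by simp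
  qed
qed

end

text \<open>
  A word of length \<open>n + 1\<close> is an \<open>n\<close>-simplex.  The empty word is exempt, because shifting a
  cochain of degree 0 may give a nonzero value there.
\<close>

definition has_degree :: "word_cochain \<Rightarrow> int \<Rightarrow> bool" where
  "has_degree f n \<longleftrightarrow> (\<forall>w. w \<noteq> [] \<longrightarrow> f w \<noteq> 0 \<longrightarrow> int (length w) = n + 1)"

definition same_degree :: "int \<Rightarrow> word_cochain \<Rightarrow> word_cochain \<Rightarrow> bool" where
  "same_degree n f f' \<longleftrightarrow> f' = f \<and> has_degree f n"

definition degenerate_word :: "nat list \<Rightarrow> bool" where
  "degenerate_word w \<longleftrightarrow> (\<exists>us x vs. w = us @ x # x # vs)"

definition normalized_word_cochain :: "word_cochain \<Rightarrow> bool" where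
  "normalized_word_cochain f \<longleftrightarrow> (\<forall>w. degenerate_word w \<longrightarrow> f w = 0)"

definition same_normalized :: "int \<Rightarrow> word_cochain \<Rightarrow> word_cochain \<Rightarrow> bool" where
  "same_normalized n f f' \<longleftrightarrow> f' = f \<and> normalized_word_cochain f"

definition pullback :: "(nat \<Rightarrow> nat) \<Rightarrow> word_cochain \<Rightarrow> word_cochain" where
  "pullback g f = (\<lambda>w. f (map g w))"

definition is_pullback :: "(nat \<Rightarrow> nat) \<Rightarrow> int \<Rightarrow> word_cochain \<Rightarrow> word_cochain \<Rightarrow> bool" where
  "is_pullback g n f f' \<longleftrightarrow> f' = pullback g f"

lemma has_degree_shift: "has_degree f n \<Longrightarrow> has_degree (shift x f) (n - 1)"
  unfolding has_degree_def shift_def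
proof (intro allI impI)
  fix w assume "\<forall>w. w \<noteq> [] \<longrightarrow> f w \<noteq> 0 \<longrightarrow> int (length w) = n + 1" "f (x # w) \<noteq> 0"
  then have "int (length (x # w)) = n + 1" by blast
  then show "int (length w) = n - 1 + 1" by simp
qed

lemma has_degree_word_cup:
  assumes "has_degree f m" "has_degree g n"
  shows "has_degree (word_cup f g) (m + n)"
  unfolding has_degree_def
proof (intro allI impI)
  fix w assume "w \<noteq> []" "word_cup f g w \<noteq> 0"
  then obtain i where i: "i < length w" "f (take (Suc i) w) * g (drop i w) \<noteq> 0"
    unfolding word_cup_def by (meson lessThan_iff sum.neutral)
  then have "f (take (Suc i) w) \<noteq> 0" "g (drop i w) \<noteq> 0" by auto
  moreover have "take (Suc i) w \<noteq> []" "drop i w \<noteq> []" using i by auto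
  ultimately have "int (length (take (Suc i) w)) = m + 1" "int (length (drop i w)) = n + 1"
    using assms unfolding has_degree_def by blast+
  then show "int (length w) = m + n + 1" using i(1) by (simp add: of_nat_diff min_def split: if_splits)
qed

lemma has_degree_word_d:
  assumes "has_degree f n"
  shows "has_degree (word_d f) (n + 1)"
  unfolding has_degree_def
proof (intro allI impI)
  fix w assume "w \<noteq> []" "word_d f w \<noteq> 0"
  then have w: "length w > 1" and "(\<Sum>i<length w. f (take i w @ drop (Suc i) w)) \<noteq> 0"
    unfolding word_d_def by (auto split: if_splits)
  then obtain i where i: "i < length w" "f (take i w @ drop (Suc i) w) \<noteq> 0"
    by (meson lessThan_iff sum.neutral)
  let ?u = "take i w @ drop (Suc i) w"
  have len: "length ?u = length w - 1" using i(1) by simp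
  then have "?u \<noteq> []" using w by fastforce
  then have "int (length ?u) = n + 1" using assms i(2) unfolding has_degree_def by blast
  then show "int (length w) = n + 1 + 1" using len w by linarith
qed

lemma has_degree_add: "has_degree f n \<Longrightarrow> has_degree f' n \<Longrightarrow> has_degree (f + f') n"
  unfolding has_degree_def by (metis add_0_right plus_fun_apply)

lemma has_degree_0: "has_degree 0 n"
  by (simp add: has_degree_def)

lemma rels_same:
  assumes "rels S xs xs' m" and "\<And>n x x'. S n x x' \<Longrightarrow> x' = x"
  shows "xs' = xs"
  using assms(1) by (induction rule: rels.induct) (auto dest: assms(2))

lemma has_degree_word_brace:
  assumes "rels same_degree bs bs' m" and "has_degree a n"
  shows "has_degree (word_brace bs a) (n + m)"
  using assms
proof (induction arbitrary: a n rule: rels.induct)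
  case (rels_Cons k b b' bs bs' m)
  have b: "has_degree b k" using rels_Cons by (simp add: same_degree_def)
  have "int (length w) = n + (k - 1 + m) + 1" if "w \<noteq> []" "word_brace (b # bs) a w \<noteq> 0" for w
    using that rels_Cons.prems
  proof (induction w arbitrary: a n)
    case (Cons x w)
    have "has_degree (word_cup b (word_brace bs (shift x a))) (k + (n - 1 + m))"
      by (intro has_degree_word_cup b rels_Cons.IH has_degree_shift Cons.prems)
    moreover have "word_cup b (word_brace bs (shift x a)) (x # w) \<noteq> 0 \<or> word_brace (b # bs) (shift x a) w \<noteq> 0"
      using Cons.prems(2) by (auto simp: word_brace_Cons)
    moreover have "int (length w) = n - 1 + (k - 1 + m) + 1" if "word_brace (b # bs) (shift x a) w \<noteq> 0"
    proof -
      have "w \<noteq> []" using that by auto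
      then show ?thesis by (rule Cons.IH[OF _ that has_degree_shift[OF Cons.prems(3)]])
    qed
    ultimately show ?case
      unfolding has_degree_def by force
  qed simp
  then show ?case by (simp add: has_degree_def)
qed simp

text \<open>
  Evaluation at a vertex respects every degree, since it annihilates everything of nonzero degree.
\<close>

interpretation degree: word_relation same_degree id
proof
  fix n m :: int and f f' h h' a a' :: word_cochain and v :: nat and bs bs'
  show "same_degree n 0 0" by (simp add: same_degree_def has_degree_0)
  show "same_degree n (f + h) (f' + h')" if "same_degree n f f'" "same_degree n h h'"
    using that by (simp add: same_degree_def has_degree_add)
  show "same_degree (n + 1) (word_d f) (word_d f')" if "same_degree n f f'"
    using that by (simp add: same_degree_def has_degree_word_d)
  show "same_degree (m + n) (word_cup f h) (word_cup f' h')" if "same_degree m f f'" "same_degree n h h'"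
    using that by (simp add: same_degree_def has_degree_word_cup)
  show "same_degree (n - 1) (cone_at (id v) f) (cone_at v f')" if "same_degree n f f'"
    using that by (fastforce simp: same_degree_def has_degree_def cone_at_def)
  show "same_degree n (at_vertex (id v) f) (at_vertex v f')" if "same_degree n f f'"
    using that by (force simp: same_degree_def has_degree_def at_vertex_def)
  show "same_degree n (\<lambda>w. if w = [] then 0 else X (hd w) (length w) w) (\<lambda>w. if w = [] then 0 else X' (hd w) (length w) w)"
    if "\<And>v m. same_degree n (X (id v) m) (X' v m)" for X X'
    using that by (auto simp: same_degree_def has_degree_def)
  show "same_degree (n + m) (word_brace bs a) (word_brace bs' a')" if a: "same_degree n a a'" and bs: "rels same_degree bs bs' m"
    using has_degree_word_brace[OF bs, of a n] rels_same[OF bs] a by (auto simp: same_degree_def)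
qed

lemma degenerate_word_Cons:
  "degenerate_word (x # w) \<longleftrightarrow> (w \<noteq> [] \<and> hd w = x) \<or> degenerate_word w"
proof
  assume "degenerate_word (x # w)"
  then obtain us y vs where "x # w = us @ y # y # vs" unfolding degenerate_word_def by blast
  then show "(w \<noteq> [] \<and> hd w = x) \<or> degenerate_word w"
    unfolding degenerate_word_def by (cases us) auto
next
  assume r: "(w \<noteq> [] \<and> hd w = x) \<or> degenerate_word w"
  then show "degenerate_word (x # w)"
  proof
    assume "w \<noteq> [] \<and> hd w = x"
    then have "x # w = [] @ x # x # tl w" by (cases w) auto
    then show ?thesis unfolding degenerate_word_def by blast
  next
    assume "degenerate_word w"
    then obtain us y vs where "w = us @ y # y # vs" unfolding degenerate_word_def by blast
    then have "x # w = (x # us) @ y # y # vs" by simp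
    then show ?thesis unfolding degenerate_word_def by blast
  qed
qed

lemma not_degenerate_Nil [simp]: "\<not> degenerate_word []"
  by (simp add: degenerate_word_def)

lemma normalized_shift: "normalized_word_cochain f \<Longrightarrow> normalized_word_cochain (shift x f)"
  by (simp add: normalized_word_cochain_def shift_def degenerate_word_Cons)

lemma normalized_shift_shift: "normalized_word_cochain f \<Longrightarrow> shift x (shift x f) = 0"
  by (simp add: normalized_word_cochain_def shift_def degenerate_word_Cons fun_eq_iff)

text \<open>
  Front and back parts share the letter at the cut, so two equal neighbours are never separated.
\<close>

lemma normalized_word_cup:
  assumes f: "normalized_word_cochain f" and g: "normalized_word_cochain g"
  shows "normalized_word_cochain (word_cup f g)"
proof -
  have "word_cup f g w = 0" if "degenerate_word w" "normalized_word_cochain f" for w f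
    using that
  proof (induction w arbitrary: f)
    case (Cons x w)
    show ?case
    proof (cases "degenerate_word w")
      case True
      then show ?thesis
        using Cons.IH[OF True normalized_shift[OF Cons.prems(2)]] Cons.prems g
        by (simp add: word_cup_Cons normalized_word_cochain_def)
    next
      case False
      then obtain w' where w: "w = x # w'" using Cons.prems by (cases w) (auto simp: degenerate_word_Cons)
      have "g (x # x # w') = 0" "f [x, x] = 0"
        using g Cons.prems(2) by (auto simp: normalized_word_cochain_def degenerate_word_Cons)
      then show ?thesis
        by (simp add: w word_cup_Cons shift_apply normalized_shift_shift[OF Cons.prems(2)])
    qed
  qed simp
  then show ?thesis using f by (simp add: normalized_word_cochain_def)
qed

text \<open>
  Removing one or the other of two equal neighbours gives the same word, and all further faces are degenerate.
\<close>

lemma normalized_word_d: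
  assumes "normalized_word_cochain f"
  shows "normalized_word_cochain (word_d f)"
proof -
  have "aug_d f w = 0" if "degenerate_word w" "normalized_word_cochain f" for w f
    using that
  proof (induction w arbitrary: f)
    case (Cons x w)
    show ?case
    proof (cases "degenerate_word w")
      case True
      then show ?thesis
        using Cons.IH[OF True normalized_shift[OF Cons.prems(2)]] Cons.prems
        by (simp add: aug_d_Cons normalized_word_cochain_def)
    next
      case False
      then obtain w' where w: "w = x # w'" using Cons.prems by (cases w) (auto simp: degenerate_word_Cons)
      have "aug_d 0 w' = 0" by (simp add: aug_d_def)
      then show ?thesis
        by (simp add: w aug_d_Cons shift_apply normalized_shift_shift[OF Cons.prems(2)] add2_simps)
    qed
  qed simp
  moreover have "normalized_word_cochain (trunc f)"
    using assms by (simp add: normalized_word_cochain_def trunc_def)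
  ultimately show ?thesis by (simp add: normalized_word_cochain_def word_d_eq)
qed

lemma normalized_word_brace:
  assumes "rels same_normalized bs bs' m" and "normalized_word_cochain a"
  shows "normalized_word_cochain (word_brace bs a)"
  using assms
proof (induction arbitrary: a rule: rels.induct)
  case (rels_Cons k b b' bs bs' m)
  have b: "normalized_word_cochain b" using rels_Cons by (simp add: same_normalized_def)
  have "word_brace (b # bs) a w = 0" if "degenerate_word w" "normalized_word_cochain a" for w a
    using that
  proof (induction w arbitrary: a)
    case (Cons x w)
    have "normalized_word_cochain (word_cup b (word_brace bs (shift x a)))"
      by (intro normalized_word_cup b rels_Cons.IH normalized_shift Cons.prems)
    then have 1: "word_cup b (word_brace bs (shift x a)) (x # w) = 0"
      using Cons.prems by (simp add: normalized_word_cochain_def)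
    have "word_brace (b # bs) (shift x a) w = 0"
    proof (cases "degenerate_word w")
      case True
      then show ?thesis by (intro Cons.IH normalized_shift Cons.prems)
    next
      case False
      then obtain w' where w: "w = x # w'" using Cons.prems by (cases w) (auto simp: degenerate_word_Cons)
      show ?thesis by (simp add: w word_brace_Cons normalized_shift_shift[OF Cons.prems(2)])
    qed
    with 1 show ?case by (simp add: word_brace_Cons)
  qed simp
  with rels_Cons.prems show ?case by (simp add: normalized_word_cochain_def)
qed simp

interpretation normalized: word_relation same_normalized id
proof
  fix n m :: int and f f' h h' a a' :: word_cochain and v :: nat and bs bs'
  show "same_normalized n 0 0" by (simp add: same_normalized_def normalized_word_cochain_def)
  show "same_normalized n (f + h) (f' + h')" if "same_normalized n f f'" "same_normalized n h h'"
    using that by (simp add: same_normalized_def normalized_word_cochain_def)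
  show "same_normalized (n + 1) (word_d f) (word_d f')" if "same_normalized n f f'"
    using that by (simp add: same_normalized_def normalized_word_d)
  show "same_normalized (m + n) (word_cup f h) (word_cup f' h')" if "same_normalized m f f'" "same_normalized n h h'"
    using that by (simp add: same_normalized_def normalized_word_cup)
  show "same_normalized (n - 1) (cone_at (id v) f) (cone_at v f')" if "same_normalized n f f'"
    using that by (auto simp: same_normalized_def normalized_word_cochain_def cone_at_def degenerate_word_Cons)
  show "same_normalized n (at_vertex (id v) f) (at_vertex v f')" if "same_normalized n f f'"
    using that by (auto simp: same_normalized_def normalized_word_cochain_def at_vertex_def degenerate_word_def)
  show "same_normalized n (\<lambda>w. if w = [] then 0 else X (hd w) (length w) w) (\<lambda>w. if w = [] then 0 else X' (hd w) (length w) w)"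
    if "\<And>v m. same_normalized n (X (id v) m) (X' v m)" for X X'
    using that by (auto simp: same_normalized_def normalized_word_cochain_def)
  show "same_normalized (n + m) (word_brace bs a) (word_brace bs' a')"
    if a: "same_normalized n a a'" and bs: "rels same_normalized bs bs' m"
    using normalized_word_brace[OF bs, of a] rels_same[OF bs] a by (auto simp: same_normalized_def)
qed

lemma pullback_add: "pullback g (f + f') = pullback g f + pullback g f'"
  by (simp add: pullback_def fun_eq_iff)

lemma pullback_word_cup: "pullback g (word_cup f f') = word_cup (pullback g f) (pullback g f')"
  by (simp add: pullback_def word_cup_def fun_eq_iff take_map drop_map)

lemma pullback_word_d: "pullback g (word_d f) = word_d (pullback g f)"
  by (simp add: pullback_def word_d_def fun_eq_iff take_map drop_map)

lemma shift_pullback: "shift x (pullback g f) = pullback g (shift (g x) f)"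
  by (simp add: pullback_def shift_def)

lemma pullback_word_brace:
  "pullback g (word_brace bs a) = word_brace (map (pullback g) bs) (pullback g a)"
proof (induction bs arbitrary: a)
  case (Cons b bs)
  note IH = Cons.IH
  have "word_brace (b # bs) a (map g w) = word_brace (map (pullback g) (b # bs)) (pullback g a) w" for w
  proof (induction w arbitrary: a)
    case (Cons x w)
    have "word_cup b (word_brace bs (shift (g x) a)) (map g (x # w))
        = word_cup (pullback g b) (word_brace (map (pullback g) bs) (shift x (pullback g a))) (x # w)"
      unfolding shift_pullback IH[symmetric] pullback_word_cup[symmetric] by (simp add: pullback_def)
    then show ?case using Cons.IH[of "shift (g x) a"]
      by (simp add: word_brace_Cons shift_pullback)
  qed simp
  then show ?case by (simp add: pullback_def[of _ "word_brace _ _"])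
qed simp

lemma rels_is_pullback: "rels (is_pullback g) xs xs' m \<Longrightarrow> xs' = map (pullback g) xs"
  by (induction rule: rels.induct) (auto simp: is_pullback_def)

lemma rels_map_pullback: "\<exists>m. rels (is_pullback g) xs (map (pullback g) xs) m"
proof (induction xs)
  case (Cons x xs)
  then obtain m where "rels (is_pullback g) xs (map (pullback g) xs) m" by blast
  then have "rels (is_pullback g) (x # xs) (pullback g x # map (pullback g) xs) (0 - 1 + m)"
    by (intro rels.rels_Cons) (simp_all add: is_pullback_def)
  then show ?case by auto
qed (auto intro: rels.rels_Nil)

text \<open>
  The filling is natural since its apex is: the first letter of \<open>map g w\<close> is \<open>g (hd w)\<close>.
\<close>

interpretation pullback: word_relation "is_pullback g" g for g
proof
  fix n m :: int and f f' h h' a a' :: word_cochain and v :: nat and bs bs'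
  show "is_pullback g n 0 0" by (simp add: is_pullback_def pullback_def fun_eq_iff)
  show "is_pullback g n (f + h) (f' + h')" if "is_pullback g n f f'" "is_pullback g n h h'"
    using that by (simp add: is_pullback_def pullback_add)
  show "is_pullback g (n + 1) (word_d f) (word_d f')" if "is_pullback g n f f'"
    using that by (simp add: is_pullback_def pullback_word_d)
  show "is_pullback g (m + n) (word_cup f h) (word_cup f' h')" if "is_pullback g m f f'" "is_pullback g n h h'"
    using that by (simp add: is_pullback_def pullback_word_cup)
  show "is_pullback g (n - 1) (cone_at (g v) f) (cone_at v f')" if "is_pullback g n f f'"
    using that by (simp add: is_pullback_def pullback_def cone_at_def fun_eq_iff)
  show "is_pullback g n (at_vertex (g v) f) (at_vertex v f')" if "is_pullback g n f f'"
    using that by (simp add: is_pullback_def pullback_def at_vertex_def fun_eq_iff)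
  show "is_pullback g n (\<lambda>w. if w = [] then 0 else X (hd w) (length w) w) (\<lambda>w. if w = [] then 0 else X' (hd w) (length w) w)"
    if "\<And>v m. is_pullback g n (X (g v) m) (X' v m)" for X X'
    using that by (auto simp: is_pullback_def pullback_def fun_eq_iff hd_map)
  show "is_pullback g (n + m) (word_brace bs a) (word_brace bs' a')"
    if a: "is_pullback g n a a'" and bs: "rels (is_pullback g) bs bs' m"
    using rels_is_pullback[OF bs] a by (simp add: is_pullback_def pullback_word_brace)
qed

section \<open>The operations on functions on words\<close>

lemma remainder_0: "remainder k 0 as bs w = 0"
  by (simp add: remainder_def W.d_0 W.cupop_0)
     (simp flip: zero_fun_def add: W.d_0 W.merge_def)

lemma rels_at_vertex:
  "rels same_degree (map (at_vertex v) fs) (map (at_vertex v) fs) (- int (length fs))"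
proof (induction fs)
  case (Cons f fs)
  have "rels same_degree (at_vertex v f # map (at_vertex v) fs) (at_vertex v f # map (at_vertex v) fs)
      (0 - 1 + - int (length fs))"
    by (intro rels.rels_Cons Cons) (auto simp: same_degree_def has_degree_def at_vertex_def)
  then show ?case by (simp add: algebra_simps)
qed (simp add: rels.rels_Nil)

lemma filling_Nil_fun: "filling k C [] = (\<lambda>bs. 0)"
  by (rule ext) simp

text \<open>
  By induction on the number of arguments plus the length of the word, the defect \<open>Q\<close> vanishes.
  By the hypothesis \<open>closed\<close> and the locality of \<open>remainder\<close>, the internal differential of \<open>Q\<close> vanishes
  at the place in question.  There \<open>\<Phi>\<close> is a contraction of \<open>R = Q + internal2 \<Phi>\<close>, so the homotopy formula
  identifies \<open>Q = R + internal2 \<Phi>\<close> with the contraction of \<open>internal2 R = internal2 Q = 0\<close> plus the value of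
  \<open>R\<close> on cochains concentrated at a vertex.  The latter has negative degree.
\<close>

lemma filling_solves:
  assumes k: "k \<ge> 1" and C_add: "bimultiadditive C"
    and C_degree: "compat2 same_degree (2 - int k) C C"
    and C_Nil: "\<And>bs. C [] bs = 0" "\<And>as. C as [] = 0" "\<And>as bs. C as bs [] = 0"
    and closed: "\<And>\<Phi> Q. bimultiadditive \<Phi> \<Longrightarrow>
      Q = W.total_d \<Phi> + brace_op \<smile> \<Phi> + \<Phi> \<smile> (swap_args ^^ k) brace_op + C \<Longrightarrow>
      W.total_d Q = brace_op \<smile> Q + Q \<smile> (swap_args ^^ k) brace_op"
  shows "W.total_d (filling k C) + brace_op \<smile> filling k C
      + filling k C \<smile> (swap_args ^^ k) brace_op + C = 0"
proof -
  define \<Phi> where "\<Phi> = filling k C"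
  define R where "R = remainder k \<Phi> + C"
  define Q where "Q = W.total_d \<Phi> + brace_op \<smile> \<Phi> + \<Phi> \<smile> (swap_args ^^ k) brace_op + C"
  have \<Phi>_add: "bimultiadditive \<Phi>"
    unfolding \<Phi>_def by (rule bimultiadditive_filling[OF C_add])
  have R_add: "bimultiadditive R"
    unfolding R_def by (intro bimultiadditive_plus bimultiadditive_remainder \<Phi>_add C_add)
  have total_d_split: "W.total_d \<Psi> as bs = W.internal2 \<Psi> as bs
      + (word_d (\<Psi> as bs) + W.merge (\<lambda>u. \<Psi> u bs) as + W.merge (\<Psi> as) bs)" for \<Psi> as bs
    by (simp only: W.total_d_apply W.bar_def W.internal2_def add_ac)
  have Q_eq: "Q as bs = W.internal2 \<Phi> as bs + R as bs" for as bs
    by (simp only: Q_def R_def remainder_def plus_fun_apply total_d_split add_ac)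
  have "W.internal2 Q as bs = remainder k Q as bs" for as bs
  proof -
    have "W.total_d Q as bs = (brace_op \<smile> Q) as bs + (Q \<smile> (swap_args ^^ k) brace_op) as bs"
      using closed[OF \<Phi>_add Q_def] by simp
    from add_eq_move[OF this[unfolded total_d_split]] show ?thesis
      by (simp only: remainder_def add_ac)
  qed
  note internal2_Q = this
  have "compat2 same_degree (1 - int k) \<Phi> \<Phi>"
    unfolding \<Phi>_def by (rule degree.compat2_filling) (use C_degree in \<open>simp add: algebra_simps\<close>)
  then have R_degree: "compat2 same_degree (2 - int k) R R"
    unfolding R_def using degree.compat2_remainder[of "1 - int k" \<Phi> \<Phi> k]
    by (intro degree.compat2_plus C_degree) (simp add: algebra_simps)
  have "Q as bs w = 0" for as bs w
  proof (induction "length as + length bs + length w" arbitrary: as bs w rule: less_induct)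
    case less
    consider "as = []" | "bs = []" | "w = []" | "as \<noteq> []" "bs \<noteq> []" "w \<noteq> []" by blast
    then show ?case
    proof cases
      case 4
      let ?h = "cone_at (hd w)" and ?\<eta> = "at_vertex (hd w)"
      have same: "us \<noteq> [] \<and> vs \<noteq> []" if "length us = length as" "length vs = length bs" for us vs :: "word_cochain list"
        using that 4 by auto
      have "W.internal2 Q us vs w = 0" if "length us = length as" "length vs = length bs" for us vs
      proof -
        have "remainder k Q us vs w = remainder k 0 us vs w"
          by (rule remainder_cong) (use that in \<open>simp add: less.hyps\<close>)
        then show ?thesis by (simp only: internal2_Q remainder_0)
      qed
      moreover have "R = (\<lambda>us vs. Q us vs + W.internal2 \<Phi> us vs)"
        by (intro ext) (simp only: Q_eq add2_simps plus_fun_apply)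
      then have "W.internal2 R us vs = W.internal2 Q us vs + W.internal2 (W.internal2 \<Phi>) us vs" for us vs
        by (simp only: W.internal2_add)
      then have "W.internal2 R us vs = W.internal2 Q us vs" for us vs
        by (simp only: W.internal2_internal2[OF \<Phi>_add] add_0_right)
      ultimately have "contract2 ?h ?\<eta> (W.internal2 R) as bs w = contract2 ?h ?\<eta> (\<lambda>us vs. 0) as bs"
        unfolding contract2_apply by (intro contract2_cong) simp
      then have 1: "contract2 ?h ?\<eta> (W.internal2 R) as bs w = 0"
        by (simp add: contract2_def)
      have "W.internal2 \<Phi> as bs w = W.internal2 (contract2 ?h ?\<eta> R) as bs w"
        unfolding W.internal2_apply
      proof (rule W.internal2_cong)
        fix us vs :: "word_cochain list" assume "length us = length as" "length vs = length bs"
        from same[OF this] 4 show "\<Phi> us vs w = contract2 ?h ?\<eta> R us vs w"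
          by (subst \<Phi>_def, subst filling_eq) (simp add: filling_step_def R_def \<Phi>_def)
      qed
      moreover have "W.internal2 (contract2 ?h ?\<eta> R) as bs w + contract2 ?h ?\<eta> (W.internal2 R) as bs w
          = R as bs w + R (map ?\<eta> as) (map ?\<eta> bs) w"
        using W.internal2_contract2[of ?h ?\<eta> R as bs, OF cone_at_add at_vertex_add cone_at_homotopy
            word_d_at_vertex at_vertex_word_d R_add]
        by (metis plus_fun_apply)
      \<comment> \<open>The degree is \<open>2 - k - m - n\<close>, and \<open>k, m, n \<ge> 1\<close>.\<close>
      moreover have "R (map ?\<eta> as) (map ?\<eta> bs) w = 0"
      proof (rule ccontr)
        assume nz: "R (map ?\<eta> as) (map ?\<eta> bs) w \<noteq> 0"
        have "has_degree (R (map ?\<eta> as) (map ?\<eta> bs)) (- int (length as) + - int (length bs) + (2 - int k))"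
          using R_degree rels_at_vertex[of "hd w" as] rels_at_vertex[of "hd w" bs]
          unfolding compat2_def same_degree_def by blast
        then have "int (length w) = - int (length as) + - int (length bs) + (2 - int k) + 1"
          using nz 4 unfolding has_degree_def by blast
        moreover have "length as \<ge> 1" "length bs \<ge> 1" "length w \<ge> 1"
          using 4 by (simp_all add: Suc_le_eq)
        ultimately show False using k by linarith
      qed
      ultimately show ?thesis
        unfolding Q_eq plus_fun_apply 1 by (simp only: add_0_right add_self)
    next
      case 1
      have "(brace_op \<smile> \<Phi>) [] bs = 0" "(\<Phi> \<smile> (swap_args ^^ k) brace_op) [] bs = 0"
        by (simp_all add: W.cupop_apply \<Phi>_def)
      then show ?thesis
        unfolding 1 Q_def by (simp add: W.total_d_apply C_Nil \<Phi>_def W.d_0 filling_Nil_fun)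
    next
      case 2
      have "(brace_op \<smile> \<Phi>) as [] = 0" "(\<Phi> \<smile> (swap_args ^^ k) brace_op) as [] = 0"
        by (simp_all add: W.cupop_apply \<Phi>_def)
      then show ?thesis
        unfolding 2 Q_def by (simp add: W.total_d_apply C_Nil \<Phi>_def W.d_0)
    next
      case 3
      have "word_d f [] = 0" for f by (simp add: word_d_def)
      then show ?thesis
        unfolding 3 Q_def
        by (simp add: W.total_d_apply C_Nil \<Phi>_def W.bar_apply W.cupop_apply sum_fun_apply)
    qed
  qed
  then show ?thesis unfolding Q_def \<Phi>_def by (simp add: fun_eq_iff)
qed

lemma brace_op_single: "brace_op [a] = (\<lambda>u. word_brace u a)"
  by (rule ext) simp

lemma brace_op_Nil: "length bs \<noteq> 1 \<Longrightarrow> brace_op [] bs = 0"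
  by (auto simp: brace_op_def split: list.splits)

lemma brace_op_long: "length as > 1 \<Longrightarrow> brace_op as bs = 0"
  by (auto simp: brace_op_def split: list.splits)

lemma conv_brace_op_left:
  "conv word_cup (brace_op []) \<phi> bs = (case bs of [] \<Rightarrow> 0 | b # bs' \<Rightarrow> word_cup b (\<phi> bs'))"
proof (cases bs)
  case (Cons b bs')
  have "conv word_cup (\<lambda>u. brace_op [] (b # u)) \<phi> bs' = word_cup b (\<phi> bs')"
    by (cases bs') (simp_all add: conv_Cons conv_Nil conv_zero[OF biadditive_word_cup] flip: zero_fun_def,
        simp add: conv_def)
  then show ?thesis by (simp add: Cons conv_Cons)
qed (simp add: conv_Nil)

lemma conv_brace_op_right:
  "conv word_cup \<phi> (brace_op []) bs = (if bs = [] then 0 else word_cup (\<phi> (butlast bs)) (last bs))"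
proof (cases bs rule: rev_cases)
  case (snoc bs' b)
  have "conv word_cup \<phi> (brace_op []) bs
      = (\<Sum>p\<in>{length bs'}. word_cup (\<phi> (take p bs)) (brace_op [] (drop p bs)))"
    unfolding conv_def by (rule sum.mono_neutral_right) (auto simp: snoc brace_op_Nil)
  then show ?thesis by (simp add: snoc)
qed (simp add: conv_Nil)

text \<open>
  For one argument in the first list this is the formula for the differential of a brace, for two
  the distributivity over products.  For an empty first list the terms cancel in pairs, and for three
  or more arguments there every term is zero.
\<close>

lemma brace_op_equation: "W.total_d brace_op + brace_op \<smile> brace_op = 0"
proof (intro ext)
  fix as bs :: "word_cochain list" and w
  have "W.total_d brace_op as bs + (brace_op \<smile> brace_op) as bs = 0"
  proof (cases as rule: remdups_adj.cases)
    case 1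
    have "W.bar (brace_op []) bs = conv word_cup (brace_op []) (brace_op []) bs + word_d (brace_op [] bs)"
    proof (cases "length bs > 2")
      case True
      have "W.internal (brace_op []) bs = 0" "W.merge (brace_op []) bs = 0"
        unfolding W.internal_def W.merge_def
        by (intro sum.neutral ballI brace_op_Nil; use True in \<open>simp add: apply_at_def merge_at_def\<close>)+
      moreover have "brace_op [] bs = 0" "brace_op [] (tl bs) = 0"
        using True by (auto intro!: brace_op_Nil)
      ultimately show ?thesis
        by (cases bs) (simp_all add: W.bar_def W.d_0 conv_brace_op_left)
    next
      case False
      then consider "bs = []" | b where "bs = [b]" | b c where "bs = [b, c]"
        by (cases bs; cases "tl bs"; cases "tl (tl bs)") auto
      then show ?thesis
        by cases (simp_all add: conv_brace_op_left W.bar_Cons W.d_0)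
    qed
    then show ?thesis
      by (simp add: 1 W.total_d_apply conv_Nil add2_simps)
  next
    case (2 a)
    have "(brace_op \<smile> brace_op) [a] bs = left_end bs a + right_end bs a"
    proof -
      have "(brace_op \<smile> brace_op) [a] bs
          = conv word_cup (brace_op []) (brace_op [a]) bs + conv word_cup (brace_op [a]) (brace_op []) bs"
        by (simp add: conv_Cons conv_Nil)
      then show ?thesis
        by (simp add: conv_brace_op_left conv_brace_op_right left_end_def right_end_def split: list.split)
    qed
    moreover have "W.total_d brace_op [a] bs = word_d (word_brace bs a) + word_brace bs (word_d a) + W.bar (\<lambda>u. word_brace u a) bs"
      by (simp add: W.total_d_apply W.bar_Cons brace_op_single)
    ultimately show ?thesis
      using word_d_word_brace[of bs a]
      by (cases "bs = []") (simp_all add: 2 left_end_def right_end_def)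
  next
    case (3 a1 a2 as')
    have z: "brace_op (a1 # a2 # as') = (\<lambda>_. 0)" by (simp add: fun_eq_iff brace_op_def)
    show ?thesis
    proof (cases as')
      case Nil
      have "(brace_op \<smile> brace_op) [a1, a2] bs = word_brace bs (word_cup a1 a2)"
        by (simp add: conv_Cons conv_Nil word_brace_word_cup brace_op_single z[unfolded Nil] conv_zero[OF biadditive_word_cup] fun_eq_iff)
      moreover have "W.total_d brace_op [a1, a2] bs = word_brace bs (word_cup a1 a2)"
        by (simp add: W.total_d_apply W.bar_Cons z[unfolded Nil] W.d_0)
      ultimately show ?thesis by (simp add: 3 Nil)
    next
      case (Cons a3 as'')
      have len: "length as > 2" by (simp add: 3 Cons)
      have "W.internal (\<lambda>u. brace_op u bs) as = 0" "W.merge (\<lambda>u. brace_op u bs) as = 0"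
        unfolding W.internal_def W.merge_def
        by (intro sum.neutral ballI brace_op_long; use len in \<open>simp add: apply_at_def merge_at_def\<close>)+
      then have "W.bar (\<lambda>u. brace_op u bs) as = 0" by (simp add: W.bar_def)
      moreover have "(brace_op \<smile> brace_op) as bs = 0"
        unfolding W.cupop_apply
      proof (intro sum.neutral ballI)
        fix p q
        have "length (take p as) > 1 \<or> length (drop p as) > 1" by (auto simp: 3 Cons)
        then show "word_cup (brace_op (take p as) (take q bs)) (brace_op (drop p as) (drop q bs)) = 0"
          by (auto simp: brace_op_long)
      qed
      ultimately show ?thesis
        using W.d_0 by (simp add: W.total_d_apply 3 z)
    qed
  qed
  then show "(W.total_d brace_op + brace_op \<smile> brace_op) as bs w = 0 as bs w" by (simp add: fun_eq_iff)
qed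

text \<open>
  Each operation fills the obstruction made from the lower ones.  The sum omits the terms with
  \<open>i = 0\<close> and \<open>i = Suc k\<close>, which involve the operation being defined and belong to \<open>remainder\<close>.
\<close>

fun word_op :: "nat \<Rightarrow> word_op" where
  "word_op 0 = brace_op"
| "word_op (Suc k) = filling (Suc k)
     ((\<Sum>i\<in>{1..<Suc k}. word_op i \<smile> (swap_args ^^ i) (word_op (Suc k - i))) + (word_op k + swap_args (word_op k)))"

declare word_op.simps [simp del]

definition lower_terms :: "nat \<Rightarrow> word_op" where
  "lower_terms k = (\<Sum>i\<in>{1..<Suc k}. word_op i \<smile> (swap_args ^^ i) (word_op (Suc k - i)))
     + (word_op k + swap_args (word_op k))"

lemma word_op_Suc: "word_op (Suc k) = filling (Suc k) (lower_terms k)"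
  unfolding lower_terms_def by (rule word_op.simps)

lemma word_op_Nil: "k \<ge> 1 \<Longrightarrow> word_op k [] bs = 0" "k \<ge> 1 \<Longrightarrow> word_op k as [] = 0" "k \<ge> 1 \<Longrightarrow> word_op k as bs [] = 0"
  by (cases k; simp add: word_op_Suc)+

lemma bimultiadditive_word_op: "bimultiadditive (word_op k)"
proof (induction k rule: less_induct)
  case (less k)
  show ?case
  proof (cases k)
    case 0
    then show ?thesis by (simp add: word_op.simps bimultiadditive_brace_op)
  next
    case (Suc j)
    show ?thesis unfolding Suc word_op_Suc lower_terms_def
      by (intro bimultiadditive_filling bimultiadditive_plus bimultiadditive_sum W.bimultiadditive_cupop
          bimultiadditive_swaps bimultiadditive_swap less) (auto simp: Suc)
  qed
qed

lemma bimultiadditive_lower_terms: "bimultiadditive (lower_terms k)"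
  unfolding lower_terms_def
  by (intro bimultiadditive_plus bimultiadditive_sum W.bimultiadditive_cupop
      bimultiadditive_swaps bimultiadditive_swap bimultiadditive_word_op)

lemma (in word_relation) compat2_lower_terms:
  assumes "\<And>i. i \<le> k \<Longrightarrow> compat2 S (1 - int i) (word_op i) (word_op i)"
  shows "compat2 S (1 - int k) (lower_terms k) (lower_terms k)"
proof -
  have "compat2 S (1 - int k) (word_op i \<smile> (swap_args ^^ i) (word_op (Suc k - i))) (word_op i \<smile> (swap_args ^^ i) (word_op (Suc k - i)))"
    if "i \<in> {1..<Suc k}" for i
  proof -
    have "compat2 S ((1 - int i) + (1 - int (Suc k - i))) (word_op i \<smile> (swap_args ^^ i) (word_op (Suc k - i))) (word_op i \<smile> (swap_args ^^ i) (word_op (Suc k - i)))"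
      by (intro compat2_cupop compat2_swaps assms) (use that in auto)
    moreover have "(1 - int i) + (1 - int (Suc k - i)) = 1 - int k" using that by auto
    ultimately show ?thesis by simp
  qed
  then show ?thesis unfolding lower_terms_def
    by (intro compat2_plus compat2_sum compat2_swap assms) auto
qed

lemma (in word_relation) compat2_word_op: "compat2 S (1 - int k) (word_op k) (word_op k)"
proof (induction k rule: less_induct)
  case (less k)
  show ?case
  proof (cases k)
    case 0
    then show ?thesis using compat2_brace_op by (simp add: word_op.simps)
  next
    case (Suc j)
    have "compat2 S (1 - int j) (lower_terms j) (lower_terms j)"
      by (intro compat2_lower_terms less) (simp add: Suc)
    then show ?thesis unfolding Suc word_op_Suc
      by (intro compat2_filling) simp
  qed
qed

text \<open>
  For \<open>k = 0\<close> the two conventions \<open>E\<^sup>0\<^sub>1\<^sub>,\<^sub>0 = id = E\<^sup>0\<^sub>0\<^sub>,\<^sub>1\<close> cancel.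
\<close>

lemma lower_terms_Nil: "lower_terms k [] bs = 0" "lower_terms k as [] = 0" "lower_terms k as bs [] = 0"
proof -
  have z: "(swap_args ^^ i) (word_op j) [] bs = 0" "(swap_args ^^ i) (word_op j) as [] = 0" if "j \<ge> 1" for i j as bs
    by (induction i arbitrary: as bs) (simp_all add: word_op_Nil[OF that] swap_args_def)
  have e: "word_op k [] bs + swap_args (word_op k) [] bs = 0" "word_op k as [] + swap_args (word_op k) as [] = 0" for as bs
    by (cases k; simp add: word_op_Nil swap_args_def word_op.simps(1); auto simp: brace_op_def split: list.splits)+
  have e': "word_op k as bs [] + swap_args (word_op k) as bs [] = 0" for as bs
  proof (cases k)
    case 0
    have "brace_op as bs [] + brace_op bs as [] = 0"
      by (cases as rule: remdups_adj.cases; cases bs rule: remdups_adj.cases)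
         (simp_all add: word_brace_Nil)
    then show ?thesis by (simp add: 0 swap_args_def word_op.simps)
  qed (simp add: word_op_Nil swap_args_def)
  show "lower_terms k [] bs = 0" "lower_terms k as [] = 0"
    unfolding lower_terms_def
    by (auto simp: sum_fun_apply W.cupop_apply word_op_Nil z e intro!: sum.neutral)
  show "lower_terms k as bs [] = 0"
    unfolding lower_terms_def
    by (auto simp: sum_fun_apply W.cupop_apply e' intro!: sum.neutral)
qed

lemma cup_sum_Suc: "W.cup_sum E (Suc k) = E 0 \<smile> E (Suc k) + E (Suc k) \<smile> (swap_args ^^ Suc k) (E 0)
   + (\<Sum>i\<in>{1..<Suc k}. E i \<smile> (swap_args ^^ i) (E (Suc k - i)))"
proof -
  have "{..Suc k} = insert 0 (insert (Suc k) {1..<Suc k})" by auto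
  then show ?thesis
    unfolding W.cup_sum_def by (simp add: add_ac del: funpow.simps(2))
qed

text \<open>
  To apply \<open>filling_solves\<close>, the sequence is modified at index \<open>k\<close> by an arbitrary operation: this
  leaves the lower defects unchanged, so \<open>total_d_defect\<close> supplies the hypothesis \<open>closed\<close>.
\<close>

theorem word_op_defect: "W.defect word_op k = 0"
proof (induction k rule: less_induct)
  case (less k)
  show ?case
  proof (cases k)
    case 0
    have "W.defect word_op 0 = W.total_d brace_op + brace_op \<smile> brace_op"
      by (simp only: W.defect_def W.cup_sum_def W.symmetrized_pred_def nat.case atMost_0 sum.insert sum.empty
          finite.emptyI empty_iff not_False_eq_True funpow_0 diff_0_eq_0 word_op.simps(1) add_0_right)
    then show ?thesis by (simp only: 0 brace_op_equation)
  next
    case (Suc j)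
    have defect_eq: "W.defect (word_op(k := \<Phi>)) k
        = W.total_d \<Phi> + brace_op \<smile> \<Phi> + \<Phi> \<smile> (swap_args ^^ k) brace_op + lower_terms j" for \<Phi>
    proof -
      have "(\<Sum>i\<in>{1..<Suc j}. (word_op(k := \<Phi>)) i \<smile> (swap_args ^^ i) ((word_op(k := \<Phi>)) (Suc j - i)))
          = (\<Sum>i\<in>{1..<Suc j}. word_op i \<smile> (swap_args ^^ i) (word_op (Suc j - i)))"
        by (intro sum.cong refl) (auto simp: Suc)
      moreover have "(word_op(k := \<Phi>)) 0 = brace_op" "(word_op(k := \<Phi>)) (Suc j) = \<Phi>" "(word_op(k := \<Phi>)) j = word_op j"
        by (simp_all add: Suc word_op.simps(1))
      ultimately show ?thesis
        unfolding Suc W.defect_def cup_sum_Suc W.symmetrized_pred_def lower_terms_def nat.case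
        by (simp only: add_ac)
    qed
    have "W.total_d Q = brace_op \<smile> Q + Q \<smile> (swap_args ^^ k) brace_op"
      if \<Phi>: "bimultiadditive \<Phi>"
        and Q: "Q = W.total_d \<Phi> + brace_op \<smile> \<Phi> + \<Phi> \<smile> (swap_args ^^ k) brace_op + lower_terms j" for \<Phi> Q
    proof -
      have "W.defect (word_op(k := \<Phi>)) i = 0" if "i < k" for i
      proof -
        have "W.defect (word_op(k := \<Phi>)) i = W.defect word_op i"
        proof -
          have "W.cup_sum (word_op(k := \<Phi>)) i = W.cup_sum word_op i"
            unfolding W.cup_sum_def using that by (intro sum.cong refl) auto
          moreover have "W.symmetrized_pred (word_op(k := \<Phi>)) i = W.symmetrized_pred word_op i"
            unfolding W.symmetrized_pred_def using that by (cases i) simp_all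
          ultimately show ?thesis using that by (simp add: W.defect_def)
        qed
        also have "\<dots> = 0" by (rule less[OF that])
        finally show ?thesis .
      qed
      moreover have "W.total_d (W.total_d ((word_op(k := \<Phi>)) k)) = 0"
        by (simp only: fun_upd_same W.total_d_total_d[OF \<Phi>])
      ultimately have "W.total_d (W.defect (word_op(k := \<Phi>)) k)
          = (word_op(k := \<Phi>)) 0 \<smile> W.defect (word_op(k := \<Phi>)) k
          + W.defect (word_op(k := \<Phi>)) k \<smile> (swap_args ^^ k) ((word_op(k := \<Phi>)) 0)"
        by (rule W.total_d_defect)
      moreover have "(word_op(k := \<Phi>)) 0 = brace_op" by (simp add: Suc word_op.simps(1))
      ultimately show ?thesis unfolding Q defect_eq by simp
    qed
    moreover have "compat2 same_degree (2 - int k) (lower_terms j) (lower_terms j)"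
      using degree.compat2_lower_terms[OF degree.compat2_word_op, of j] by (simp add: Suc algebra_simps)
    ultimately have "W.total_d (word_op k) + brace_op \<smile> word_op k + word_op k \<smile> (swap_args ^^ k) brace_op + lower_terms j = 0"
      unfolding Suc word_op_Suc
      by (intro filling_solves bimultiadditive_lower_terms lower_terms_Nil) (auto simp: Suc simp del: funpow.simps)
    then show ?thesis using defect_eq[of "word_op k"] by simp
  qed
qed

section \<open>Singular simplices spanned by words\<close>

text \<open>
  The affine map from the simplex with vertices the positions of \<open>w\<close> that takes the vertex \<open>i\<close> to
  the vertex \<open>w ! i\<close>, in barycentric coordinates.
\<close>

definition vertex_map :: "nat list \<Rightarrow> (nat \<Rightarrow> real) \<Rightarrow> nat \<Rightarrow> real" where
  "vertex_map w x j = (\<Sum>i<length w. if w ! i = j then x i else 0)"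

definition subsimplex :: "((nat \<Rightarrow> real) \<Rightarrow> 'a) \<Rightarrow> nat list \<Rightarrow> (nat \<Rightarrow> real) \<Rightarrow> 'a" where
  "subsimplex \<sigma> w = restrict (\<sigma> \<circ> vertex_map w) (standard_simplex (length w - 1))"

lemma vertex_map_append:
  "vertex_map (u @ v) x j = vertex_map u x j + vertex_map v (\<lambda>i. x (i + length u)) j"
proof -
  have "vertex_map (u @ v) x j = (\<Sum>i<length u. if (u @ v) ! i = j then x i else 0)
      + (\<Sum>i\<in>{length u..<length u + length v}. if (u @ v) ! i = j then x i else 0)"
    unfolding vertex_map_def lessThan_atLeast0
    by (simp add: sum.atLeastLessThan_concat)
  also have "(\<Sum>i<length u. if (u @ v) ! i = j then x i else 0) = vertex_map u x j"
    unfolding vertex_map_def by (intro sum.cong) (auto simp: nth_append)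
  also have "(\<Sum>i\<in>{length u..<length u + length v}. if (u @ v) ! i = j then x i else 0)
      = (\<Sum>i<length v. if (u @ v) ! (i + length u) = j then x (i + length u) else 0)"
    using sum.shift_bounds_nat_ivl[of "\<lambda>i. if (u @ v) ! i = j then x i else 0" 0 "length u" "length v"]
    by (simp add: atLeast0LessThan add.commute)
  also have "\<dots> = vertex_map v (\<lambda>i. x (i + length u)) j"
    unfolding vertex_map_def by (simp add: nth_append)
  finally show ?thesis .
qed

lemma vertex_map_upt: "vertex_map [a..<b] x j = (if a \<le> j \<and> j < b then x (j - a) else 0)"
proof -
  have "vertex_map [a..<b] x j = (\<Sum>i<b - a. if i = j - a \<and> a \<le> j then x i else 0)"
    unfolding vertex_map_def by (intro sum.cong) auto
  then show ?thesis by (cases "a \<le> j") auto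
qed

lemma vertex_map_comp:
  assumes "set u \<subseteq> {..<length w}"
  shows "vertex_map w (vertex_map u x) = vertex_map (map ((!) w) u) x"
proof
  fix j
  have "vertex_map w (vertex_map u x) j
      = (\<Sum>i<length w. \<Sum>k<length u. if w ! i = j \<and> u ! k = i then x k else 0)"
    unfolding vertex_map_def by (intro sum.cong) (auto intro!: sum.cong)
  also have "\<dots> = (\<Sum>k<length u. \<Sum>i<length w. if w ! i = j \<and> u ! k = i then x k else 0)"
    by (rule sum.swap)
  also have "\<dots> = (\<Sum>k<length u. if w ! (u ! k) = j then x k else 0)"
  proof (intro sum.cong refl)
    fix k assume "k \<in> {..<length u}"
    then have "u ! k < length w" using assms nth_mem by fastforce
    moreover have "(\<Sum>i<length w. if w ! i = j \<and> u ! k = i then x k else 0)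
      = (\<Sum>i<length w. if i = u ! k then (if w ! (u ! k) = j then x k else 0) else 0)"
      by (intro sum.cong) auto
    ultimately show "(\<Sum>i<length w. if w ! i = j \<and> u ! k = i then x k else 0) = (if w ! (u ! k) = j then x k else 0)"
      by simp
  qed
  finally show "vertex_map w (vertex_map u x) j = vertex_map (map ((!) w) u) x j"
    by (simp add: vertex_map_def)
qed

lemma vertex_map_in_standard_simplex:
  assumes w: "w \<noteq> []" "set w \<subseteq> {..p}" and x: "x \<in> standard_simplex (length w - 1)"
  shows "vertex_map w x \<in> standard_simplex p"
proof -
  have x0: "0 \<le> x i" for i using x by (simp add: standard_simplex_def)
  have nonneg: "0 \<le> vertex_map w x j" for j
    unfolding vertex_map_def by (intro sum_nonneg) (simp add: x0)
  have le: "w ! i \<le> p" if "i < length w" for i using w(2) that nth_mem by fastforce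
  have zero: "vertex_map w x j = 0" if "j > p" for j
    unfolding vertex_map_def using le that by (intro sum.neutral) fastforce
  have "{..length w - 1} = {..<length w}" using w(1) by (cases w) auto
  then have sum1: "(\<Sum>i<length w. x i) = 1" using x by (simp add: standard_simplex_def)
  have "(\<Sum>j\<le>p. vertex_map w x j) = (\<Sum>i<length w. \<Sum>j\<le>p. if w ! i = j then x i else 0)"
    unfolding vertex_map_def by (rule sum.swap)
  also have "\<dots> = (\<Sum>i<length w. x i)"
    by (intro sum.cong refl) (simp add: le)
  finally have total: "(\<Sum>j\<le>p. vertex_map w x j) = 1" using sum1 by simp
  have "vertex_map w x j \<le> 1" for j
  proof (cases "j \<le> p")
    case True
    then show ?thesis using member_le_sum[of j "{..p}" "vertex_map w x"] nonneg total by simp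
  qed (simp add: zero)
  then show ?thesis using nonneg zero total by (simp add: standard_simplex_def)
qed

lemma continuous_map_vertex_map:
  assumes "w \<noteq> []" "set w \<subseteq> {..p}"
  shows "continuous_map (subtopology (powertop_real UNIV) (standard_simplex (length w - 1)))
      (subtopology (powertop_real UNIV) (standard_simplex p)) (vertex_map w)"
proof -
  have "continuous_map (powertop_real UNIV) euclideanreal (\<lambda>x. vertex_map w x j)" for j
    unfolding vertex_map_def
  proof (intro continuous_map_sum)
    fix i
    show "continuous_map (powertop_real UNIV) euclideanreal (\<lambda>x. if w ! i = j then x i else 0)"
      by (cases "w ! i = j") (auto intro: continuous_map_product_projection)
  qed simp
  then have "continuous_map (subtopology (powertop_real UNIV) (standard_simplex (length w - 1))) euclideanreal (\<lambda>x. vertex_map w x j)" for j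
    by (rule continuous_map_from_subtopology)
  then show ?thesis
    using vertex_map_in_standard_simplex[OF assms]
    by (auto simp: continuous_map_in_subtopology continuous_map_componentwise_UNIV)
qed

lemma singular_simplex_subsimplex:
  assumes "singular_simplex p X \<sigma>" "w \<noteq> []" "set w \<subseteq> {..p}"
  shows "singular_simplex (length w - 1) X (subsimplex \<sigma> w)"
  using continuous_map_compose[OF continuous_map_vertex_map[OF assms(2,3)]] assms(1)
  unfolding singular_simplex_def subsimplex_def by auto

lemma subsimplex_subsimplex:
  assumes "w \<noteq> []" "u \<noteq> []" "set u \<subseteq> {..<length w}"
  shows "subsimplex (subsimplex \<sigma> w) u = subsimplex \<sigma> (map ((!) w) u)"
proof -
  have "set u \<subseteq> {..length w - 1}" using assms(1,3) by (cases w) auto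
  then show ?thesis
    using vertex_map_in_standard_simplex[OF assms(2), of "length w - 1"] vertex_map_comp[OF assms(3)]
    unfolding subsimplex_def length_map by (intro restrict_ext) simp
qed

lemma subsimplex_eqI:
  assumes "\<And>x. x \<in> standard_simplex q \<Longrightarrow> f x = vertex_map w x" and "length w = Suc q"
  shows "restrict (\<sigma> \<circ> f) (standard_simplex q) = subsimplex \<sigma> w"
  using assms unfolding subsimplex_def by (auto intro!: restrict_ext)

lemma standard_simplex_beyond: "x \<in> standard_simplex q \<Longrightarrow> i > q \<Longrightarrow> x i = 0"
  by (simp add: standard_simplex_def)

lemma subsimplex_all:
  assumes "singular_simplex p X \<sigma>"
  shows "subsimplex \<sigma> [0..<Suc p] = \<sigma>"
proof -
  have "restrict (\<sigma> \<circ> id) (standard_simplex p) = subsimplex \<sigma> [0..<Suc p]"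
    by (rule subsimplex_eqI) (auto simp: fun_eq_iff vertex_map_upt standard_simplex_beyond simp del: upt_Suc)
  moreover have "restrict (\<sigma> \<circ> id) (standard_simplex p) = \<sigma>"
    using assms by (simp add: singular_simplex_def extensional_restrict)
  ultimately show ?thesis by simp
qed

lemma front_face_eq:
  assumes "p \<le> n"
  shows "front_face p \<sigma> = subsimplex \<sigma> (take (Suc p) [0..<Suc n])"
proof -
  have "take (Suc p) [0..<Suc n] = [0..<Suc p]" using assms by (simp add: take_upt del: upt_Suc)
  moreover have "restrict (\<sigma> \<circ> id) (standard_simplex p) = subsimplex \<sigma> [0..<Suc p]"
    by (rule subsimplex_eqI) (auto simp: fun_eq_iff vertex_map_upt standard_simplex_beyond simp del: upt_Suc)
  ultimately show ?thesis by (simp add: front_face_def)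
qed

lemma back_face_eq:
  assumes "p \<le> n"
  shows "back_face n (n - p) \<sigma> = subsimplex \<sigma> (drop p [0..<Suc n])"
  unfolding back_face_def using assms
  by (intro subsimplex_eqI) (auto simp: fun_eq_iff vertex_map_upt standard_simplex_beyond simp del: upt_Suc)

lemma singular_face_eq:
  assumes "1 \<le> p" "k \<le> p"
  shows "singular_face p k \<sigma> = subsimplex \<sigma> (take k [0..<Suc p] @ drop (Suc k) [0..<Suc p])"
proof -
  have "take k [0..<Suc p] @ drop (Suc k) [0..<Suc p] = [0..<k] @ [Suc k..<Suc p]"
    using assms by (simp add: take_upt del: upt_Suc)
  then show ?thesis
    unfolding singular_face_def using assms
    by (intro subsimplex_eqI)
      (auto simp: fun_eq_iff vertex_map_append vertex_map_upt simplical_face_def standard_simplex_beyond simp del: upt_Suc)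
qed

lemma degeneracy_eq:
  assumes "i \<le> m"
  shows "restrict (\<tau> \<circ> simplicial_degeneracy i) (standard_simplex (Suc m)) = subsimplex \<tau> ([0..<Suc i] @ [i..<Suc m])"
  using assms
  by (intro subsimplex_eqI)
    (auto simp: fun_eq_iff vertex_map_append vertex_map_upt simplicial_degeneracy_def standard_simplex_beyond
      Suc_diff_le simp del: upt_Suc)

text \<open>
  A repeated letter factors the vertex map through the degeneracy that identifies its two
  positions.
\<close>

lemma degenerate_subsimplex:
  assumes \<sigma>: "singular_simplex p X \<sigma>" and w: "set w \<subseteq> {..p}" "degenerate_word w"
  shows "degenerate_simplex (length w - 1) X (subsimplex \<sigma> w)"
proof -
  obtain us x vs where w_eq: "w = us @ x # x # vs" using w(2) unfolding degenerate_word_def by blast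
  let ?w' = "us @ x # vs" and ?i = "length us" and ?m = "length us + length vs"
  have "subsimplex (subsimplex \<sigma> ?w') ([0..<Suc ?i] @ [?i..<Suc ?m])
      = subsimplex \<sigma> (map ((!) ?w') ([0..<Suc ?i] @ [?i..<Suc ?m]))"
    by (rule subsimplex_subsimplex) auto
  also have "map ((!) ?w') ([0..<Suc ?i] @ [?i..<Suc ?m]) = w"
  proof -
    have "map ((!) ?w') [0..<Suc ?i] = take (Suc ?i) ?w'"
      by (rule nth_equalityI) (auto simp: nth_append less_Suc_eq simp del: upt_Suc)
    moreover have "map ((!) ?w') [?i..<Suc ?m] = drop ?i ?w'"
      by (rule nth_equalityI) (auto simp del: upt_Suc)
    ultimately show ?thesis by (simp add: w_eq)
  qed
  finally have "subsimplex \<sigma> w = restrict (subsimplex \<sigma> ?w' \<circ> simplicial_degeneracy ?i) (standard_simplex (Suc ?m))"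
    by (simp add: degeneracy_eq)
  moreover have "singular_simplex ?m X (subsimplex \<sigma> ?w')"
    using singular_simplex_subsimplex[OF \<sigma>, of ?w'] w(1) w_eq by auto
  ultimately show ?thesis
    unfolding degenerate_simplex_def w_eq by (intro exI[of _ ?m] exI[of _ ?i] exI[of _ "subsimplex \<sigma> ?w'"]) auto
qed

section \<open>Pulling singular cochains back to words\<close>

text \<open>
  Letters above \<open>p\<close> are clamped to \<open>p\<close>, so that every nonempty word gives a singular simplex and pulling back
  commutes with the operations on all words.
\<close>

definition pull :: "nat \<Rightarrow> ((nat \<Rightarrow> real) \<Rightarrow> 'a) \<Rightarrow> 'a cochain \<Rightarrow> word_cochain" where
  "pull p \<sigma> c w = (if w = [] then 0 else c (length w - 1) (subsimplex \<sigma> (map (min p) w)))"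

text \<open>
  Cochains are determined by their pullbacks only as far as their values on singular simplices go;
  all operations below produce cochains that vanish elsewhere.
\<close>

definition supported :: "'a topology \<Rightarrow> 'a cochain \<Rightarrow> bool" where
  "supported X c \<longleftrightarrow> (\<forall>p \<sigma>. c p \<sigma> \<noteq> 0 \<longrightarrow> singular_simplex p X \<sigma>)"

lemma pull_Nil [simp]: "pull p \<sigma> c [] = 0"
  by (simp add: pull_def)

lemma pull_add: "pull p \<sigma> (a + b) = pull p \<sigma> a + pull p \<sigma> b"
  by (simp add: pull_def fun_eq_iff)

lemma pull_0: "pull p \<sigma> 0 = 0"
  by (simp add: pull_def fun_eq_iff)

lemma pull_sum: "pull p \<sigma> (\<Sum>i\<in>A. f i) = (\<Sum>i\<in>A. pull p \<sigma> (f i))"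
  by (induction A rule: infinite_finite_induct)
    (simp_all only: sum.infinite sum.empty sum.insert pull_0 pull_add not_False_eq_True)

lemma clamp_subset: "set (map (min p) w) \<subseteq> {..p::nat}"
  by auto

lemma singular_clamp:
  "singular_simplex p X \<sigma> \<Longrightarrow> w \<noteq> [] \<Longrightarrow> singular_simplex (length w - 1) X (subsimplex \<sigma> (map (min p) w))"
  using singular_simplex_subsimplex[OF _ _ clamp_subset, of p X \<sigma> w] by simp

lemma subsimplex_clamp_sublist:
  assumes "w \<noteq> []" "u \<noteq> []" "set u \<subseteq> {..<length w}"
  shows "subsimplex (subsimplex \<sigma> (map (min p) w)) u = subsimplex \<sigma> (map (min p) (map ((!) w) u))"
proof -
  have "map ((!) (map (min p) w)) u = map (min p) (map ((!) w) u)"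
    using assms(3) by auto
  then show ?thesis using subsimplex_subsimplex[of "map (min p) w" u \<sigma>] assms by (simp del: map_map map_eq_conv)
qed

lemma map_nth_take: "map ((!) w) (take k [0..<length w]) = take k w"
  and map_nth_drop: "map ((!) w) (drop k [0..<length w]) = drop k w"
  by (simp_all only: map_nth flip: take_map drop_map)

lemma pull_coboundary:
  assumes "singular_simplex p X \<sigma>"
  shows "pull p \<sigma> (coboundary X c) = word_d (pull p \<sigma> c)"
proof
  fix w
  show "pull p \<sigma> (coboundary X c) w = word_d (pull p \<sigma> c) w"
  proof (cases "length w \<le> 1")
    case True
    then show ?thesis by (cases w) (auto simp: pull_def coboundary_def word_d_def)
  next
    case False
    define q where "q = length w - 1"
    define \<tau> where "\<tau> = subsimplex \<sigma> (map (min p) w)"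
    have len: "length w = Suc q" "q \<ge> 1" using False by (simp_all add: q_def)
    have w: "w \<noteq> []" using False by auto
    have "c (q - 1) (singular_face q k \<tau>) = pull p \<sigma> c (take k w @ drop (Suc k) w)" if "k \<le> q" for k
    proof -
      let ?u = "take k [0..<Suc q] @ drop (Suc k) [0..<Suc q]"
      have ne: "?u \<noteq> []" using len(2) that by (cases k) (auto simp del: upt_Suc)
      have sub: "set ?u \<subseteq> {..<length w}"
        using set_take_subset[of k "[0..<Suc q]"] set_drop_subset[of "Suc k" "[0..<Suc q]"] len
        by (auto simp del: upt_Suc)
      have "singular_face q k \<tau> = subsimplex \<tau> ?u"
        by (rule singular_face_eq) (use that len in auto)
      also have "\<dots> = subsimplex \<sigma> (map (min p) (map ((!) w) ?u))"
        unfolding \<tau>_def by (rule subsimplex_clamp_sublist[OF w ne sub])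
      also have "map ((!) w) ?u = take k w @ drop (Suc k) w"
        using map_nth_take[of w k] map_nth_drop[of w "Suc k"] by (simp only: map_append len)
      finally show ?thesis
        using that len by (auto simp: pull_def)
    qed
    moreover have "singular_simplex q X \<tau>"
      unfolding \<tau>_def q_def by (rule singular_clamp[OF assms w])
    moreover have "{..<length w} = {..q}" using len by auto
    ultimately have "coboundary X c q \<tau> = (\<Sum>k<length w. pull p \<sigma> c (take k w @ drop (Suc k) w))"
      using len(2) by (simp add: coboundary_def)
    moreover have "pull p \<sigma> (coboundary X c) w = coboundary X c q \<tau>"
      using w by (simp add: pull_def q_def \<tau>_def)
    ultimately show ?thesis using False by (simp add: word_d_def)
  qed
qed

lemma pull_cup:
  assumes "singular_simplex p X \<sigma>"
  shows "pull p \<sigma> (cup X a b) = word_cup (pull p \<sigma> a) (pull p \<sigma> b)"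
proof
  fix w
  show "pull p \<sigma> (cup X a b) w = word_cup (pull p \<sigma> a) (pull p \<sigma> b) w"
  proof (cases "w = []")
    case False
    define q where "q = length w - 1"
    define \<tau> where "\<tau> = subsimplex \<sigma> (map (min p) w)"
    have len: "length w = Suc q" using False by (simp add: q_def)
    have "a k (front_face k \<tau>) * b (q - k) (back_face q (q - k) \<tau>) = pull p \<sigma> a (take (Suc k) w) * pull p \<sigma> b (drop k w)"
      if "k \<le> q" for k
    proof -
      have "front_face k \<tau> = subsimplex \<tau> (take (Suc k) [0..<Suc q])"
        by (rule front_face_eq[OF that])
      also have "\<dots> = subsimplex \<sigma> (map (min p) (map ((!) w) (take (Suc k) [0..<Suc q])))"
        unfolding \<tau>_def
        by (rule subsimplex_clamp_sublist[OF False])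
          (use len set_take_subset[of "Suc k" "[0..<Suc q]"] in \<open>auto simp del: upt_Suc\<close>)
      also have "map ((!) w) (take (Suc k) [0..<Suc q]) = take (Suc k) w"
        using map_nth_take[of w "Suc k"] by (simp only: len)
      finally have 1: "front_face k \<tau> = subsimplex \<sigma> (map (min p) (take (Suc k) w))" .
      have "back_face q (q - k) \<tau> = subsimplex \<tau> (drop k [0..<Suc q])"
        by (rule back_face_eq[OF that])
      also have "\<dots> = subsimplex \<sigma> (map (min p) (map ((!) w) (drop k [0..<Suc q])))"
        unfolding \<tau>_def
        by (rule subsimplex_clamp_sublist[OF False])
          (use that len set_drop_subset[of k "[0..<Suc q]"] in \<open>auto simp del: upt_Suc\<close>)
      also have "map ((!) w) (drop k [0..<Suc q]) = drop k w"
        using map_nth_drop[of w k] by (simp only: len)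
      finally have 2: "back_face q (q - k) \<tau> = subsimplex \<sigma> (map (min p) (drop k w))" .
      show ?thesis using that len False by (simp add: 1 2 pull_def)
    qed
    moreover have "singular_simplex q X \<tau>"
      unfolding \<tau>_def q_def by (rule singular_clamp[OF assms False])
    moreover have "{..<length w} = {..q}" using len by auto
    ultimately have "cup X a b q \<tau> = word_cup (pull p \<sigma> a) (pull p \<sigma> b) w"
      by (simp add: cup_def word_cup_def)
    moreover have "pull p \<sigma> (cup X a b) w = cup X a b q \<tau>"
      using False by (simp add: pull_def q_def \<tau>_def)
    ultimately show ?thesis by simp
  qed simp
qed

lemma pull_all:
  assumes "singular_simplex p X \<sigma>"
  shows "pull p \<sigma> c [0..<Suc p] = c p \<sigma>"
proof -
  have "map (min p) [0..<Suc p] = [0..<Suc p]" by (rule nth_equalityI) (auto simp del: upt_Suc)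
  then show ?thesis using subsimplex_all[OF assms] by (simp add: pull_def del: upt_Suc)
qed

lemma supported_eqI:
  assumes "supported X c" "supported X c'"
    and "\<And>p \<sigma>. singular_simplex p X \<sigma> \<Longrightarrow> pull p \<sigma> c = pull p \<sigma> c'"
  shows "c = c'"
proof (intro ext)
  fix p \<sigma>
  show "c p \<sigma> = c' p \<sigma>"
  proof (cases "singular_simplex p X \<sigma>")
    case True
    then show ?thesis using assms(3)[OF True] pull_all[OF True] by metis
  next
    case False
    then have "c p \<sigma> = 0" "c' p \<sigma> = 0" using assms(1,2) unfolding supported_def by blast+
    then show ?thesis by simp
  qed
qed

text \<open>
  Restricting to a subsimplex amounts to a map of alphabets, so naturality of an operation makes
  it commute with pulling back.
\<close>

lemma pull_subsimplex:
  assumes "w \<noteq> []" "\<And>x. x \<in> set w \<Longrightarrow> x \<le> p"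
  shows "pull (length w - 1) (subsimplex \<sigma> w) c = pullback (\<lambda>i. w ! min (length w - 1) i) (pull p \<sigma> c)"
proof
  fix u
  show "pull (length w - 1) (subsimplex \<sigma> w) c u = pullback (\<lambda>i. w ! min (length w - 1) i) (pull p \<sigma> c) u"
  proof (cases "u = []")
    case False
    have lt: "min (length w - 1) i < length w" for i using assms(1) by (cases w) auto
    have "subsimplex (subsimplex \<sigma> w) (map (min (length w - 1)) u) = subsimplex \<sigma> (map ((!) w) (map (min (length w - 1)) u))"
      by (rule subsimplex_subsimplex[OF assms(1)]) (use False lt in auto)
    also have "map ((!) w) (map (min (length w - 1)) u) = map (min p) (map (\<lambda>i. w ! min (length w - 1) i) u)"
      using assms(2)[OF nth_mem[OF lt]] by simp
    finally show ?thesis using False by (simp add: pull_def pullback_def)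
  qed (simp add: pullback_def)
qed

lemma pull_clamp: "pull p \<sigma> c = pullback (min p) (pull p \<sigma> c)"
  by (auto simp: fun_eq_iff pull_def pullback_def comp_def)

lemma word_op_pullback: "word_op k (map (pullback g) as) (map (pullback g) bs) = pullback g (word_op k as bs)"
proof -
  obtain m n where "rels (is_pullback g) as (map (pullback g) as) m" "rels (is_pullback g) bs (map (pullback g) bs) n"
    using rels_map_pullback by metis
  then have "is_pullback g (m + n + (1 - int k)) (word_op k as bs) (word_op k (map (pullback g) as) (map (pullback g) bs))"
    using pullback.compat2_word_op[of g k] unfolding compat2_def by blast
  then show ?thesis by (simp add: is_pullback_def)
qed

lemma word_op_word_Nil: "as \<noteq> [] \<Longrightarrow> bs \<noteq> [] \<Longrightarrow> word_op k as bs [] = 0"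
proof (cases k)
  case 0
  assume "as \<noteq> []" "bs \<noteq> []"
  then show ?thesis
    by (cases as rule: remdups_adj.cases; cases bs) (auto simp: 0 word_op.simps(1))
qed (simp add: word_op_Nil)

definition cochain_op :: "'a topology \<Rightarrow> nat \<Rightarrow> 'a cochain list \<Rightarrow> 'a cochain list \<Rightarrow> 'a cochain" where
  "cochain_op X k as bs = (\<lambda>p \<sigma>. if singular_simplex p X \<sigma>
     then word_op k (map (pull p \<sigma>) as) (map (pull p \<sigma>) bs) [0..<Suc p] else 0)"

lemma pull_cochain_op:
  assumes \<sigma>: "singular_simplex p X \<sigma>" and ne: "as \<noteq> []" "bs \<noteq> []"
  shows "pull p \<sigma> (cochain_op X k as bs) = word_op k (map (pull p \<sigma>) as) (map (pull p \<sigma>) bs)"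
proof
  fix w
  show "pull p \<sigma> (cochain_op X k as bs) w = word_op k (map (pull p \<sigma>) as) (map (pull p \<sigma>) bs) w"
  proof (cases "w = []")
    case True
    then show ?thesis using ne by (simp add: word_op_word_Nil)
  next
    case False
    let ?v = "map (min p) w"
    let ?\<tau> = "subsimplex \<sigma> ?v"
    let ?g = "\<lambda>i. ?v ! min (length ?v - 1) i"
    have v: "?v \<noteq> []" "\<And>x. x \<in> set ?v \<Longrightarrow> x \<le> p" using False by auto
    have len: "length w = Suc (length ?v - 1)" using False by (cases w) auto
    have pull_\<tau>: "pull (length ?v - 1) ?\<tau> = (\<lambda>c. pullback ?g (pull p \<sigma> c))"
      by (rule ext) (rule pull_subsimplex[OF v])
    have "map ?g [0..<length w] = ?v"
      by (rule nth_equalityI) (use False in \<open>simp_all add: min_absorb2\<close>)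
    then have g: "map ?g [0..<Suc (length ?v - 1)] = ?v" by (simp only: len[symmetric])
    have "pull p \<sigma> (cochain_op X k as bs) w = cochain_op X k as bs (length ?v - 1) ?\<tau>"
      using False by (simp add: pull_def)
    also have "\<dots> = word_op k (map (pull (length ?v - 1) ?\<tau>) as) (map (pull (length ?v - 1) ?\<tau>) bs) [0..<Suc (length ?v - 1)]"
      using singular_clamp[OF \<sigma> False] by (simp add: cochain_op_def del: upt_Suc)
    also have "\<dots> = pullback ?g (word_op k (map (pull p \<sigma>) as) (map (pull p \<sigma>) bs)) [0..<Suc (length ?v - 1)]"
      unfolding pull_\<tau> using word_op_pullback[of k ?g "map (pull p \<sigma>) as" "map (pull p \<sigma>) bs"]
      by (simp add: comp_def del: upt_Suc)
    also have "\<dots> = word_op k (map (pull p \<sigma>) as) (map (pull p \<sigma>) bs) ?v"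
      unfolding pullback_def g ..
    also have "\<dots> = pullback (min p) (word_op k (map (pull p \<sigma>) as) (map (pull p \<sigma>) bs)) w"
      by (simp add: pullback_def)
    also have "\<dots> = word_op k (map (pull p \<sigma>) as) (map (pull p \<sigma>) bs) w"
      unfolding word_op_pullback[symmetric] by (simp add: comp_def flip: pull_clamp)
    finally show ?thesis .
  qed
qed

lemma pull_ext_ops:
  assumes \<sigma>: "singular_simplex p X \<sigma>"
  shows "pull p \<sigma> (ext_ops (cochain_op X) k as bs) = word_op k (map (pull p \<sigma>) as) (map (pull p \<sigma>) bs)"
proof -
  consider "as \<noteq> [] \<and> bs \<noteq> []" | "as = [] \<or> bs = []" "k \<ge> 1" | "as = []" "k = 0" | "bs = []" "k = 0"
    by (cases k) auto
  then show ?thesis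
  proof cases
    case 1
    then show ?thesis by (simp add: ext_ops_def pull_cochain_op[OF \<sigma>])
  next
    case 2
    then show ?thesis by (auto simp: ext_ops_def word_op_Nil pull_0)
  next
    case 3
    then show ?thesis
      by (cases bs rule: remdups_adj.cases) (auto simp: ext_ops_def word_op.simps(1) pull_0)
  next
    case 4
    then show ?thesis
      by (cases as rule: remdups_adj.cases) (auto simp: ext_ops_def word_op.simps(1) pull_0)
  qed
qed

lemma pull_swaps_ext_ops:
  assumes \<sigma>: "singular_simplex p X \<sigma>"
  shows "pull p \<sigma> ((swap_args ^^ i) (ext_ops (cochain_op X) k) as bs)
    = (swap_args ^^ i) (word_op k) (map (pull p \<sigma>) as) (map (pull p \<sigma>) bs)"
  by (induction i arbitrary: as bs) (simp_all add: pull_ext_ops[OF \<sigma>] swap_args_def)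

lemma supported_coboundary: "supported X (coboundary X c)"
  and supported_cup: "supported X (cup X a b)"
  and supported_cochain_op: "supported X (cochain_op X k as bs)"
  by (auto simp: supported_def coboundary_def cup_def cochain_op_def simp del: bit_not_zero_iff split: if_splits)

lemma supported_add: "supported X a \<Longrightarrow> supported X b \<Longrightarrow> supported X (a + b)"
  unfolding supported_def plus_fun_apply by (metis add_0_right)

lemma supported_0: "supported X 0"
  by (simp add: supported_def)

lemma supported_sum: "(\<And>i. i \<in> A \<Longrightarrow> supported X (f i)) \<Longrightarrow> supported X (\<Sum>i\<in>A. f i)"
  by (induction A rule: infinite_finite_induct)
    (simp_all only: sum.infinite sum.empty sum.insert supported_0 supported_add insertI1 insertI2 not_False_eq_True)

text \<open>
  A degenerate simplex is spanned by a word with a repeated letter in a simplex of lower dimension;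
  hence vanishing on degenerate words detects normalization.
\<close>

lemma normalized_cochains_iff:
  "c \<in> normalized_cochains X n \<longleftrightarrow> supported X c \<and>
     (\<forall>p \<sigma>. singular_simplex p X \<sigma> \<longrightarrow> normalized_word_cochain (pull p \<sigma> c) \<and> has_degree (pull p \<sigma> c) n)"
proof safe
  assume c: "c \<in> normalized_cochains X n"
  then have cD: "c p \<sigma> \<noteq> 0 \<Longrightarrow> int p = n \<and> singular_simplex p X \<sigma> \<and> \<not> degenerate_simplex p X \<sigma>" for p \<sigma>
    unfolding normalized_cochains_def by blast
  show "supported X c" unfolding supported_def using cD by blast
  fix p \<sigma> assume \<sigma>: "singular_simplex p X \<sigma>"
  show "normalized_word_cochain (pull p \<sigma> c)"
    unfolding normalized_word_cochain_def
  proof (intro allI impI)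
    fix w assume "degenerate_word w"
    then have "degenerate_word (map (min p) w)"
      unfolding degenerate_word_def by (metis list.simps(9) map_append)
    then have "degenerate_simplex (length w - 1) X (subsimplex \<sigma> (map (min p) w))"
      using degenerate_subsimplex[OF \<sigma> clamp_subset] by (metis length_map)
    then show "pull p \<sigma> c w = 0" using cD unfolding pull_def by metis
  qed
  show "has_degree (pull p \<sigma> c) n"
    unfolding has_degree_def
  proof (intro allI impI)
    fix w :: "nat list" assume "w \<noteq> []" "pull p \<sigma> c w \<noteq> 0"
    then have "int (length w - 1) = n" using cD unfolding pull_def by metis
    then show "int (length w) = n + 1" using \<open>w \<noteq> []\<close> by (cases w) auto
  qed
next
  assume s: "supported X c" and pull: "\<forall>p \<sigma>. singular_simplex p X \<sigma> \<longrightarrow> normalized_word_cochain (pull p \<sigma> c) \<and> has_degree (pull p \<sigma> c) n"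
  have "int p = n \<and> singular_simplex p X \<sigma> \<and> \<not> degenerate_simplex p X \<sigma>" if nz: "c p \<sigma> \<noteq> 0" for p \<sigma>
  proof -
    have \<sigma>: "singular_simplex p X \<sigma>" using s nz unfolding supported_def by blast
    have "pull p \<sigma> c [0..<Suc p] \<noteq> 0" using nz pull_all[OF \<sigma>, of c] by metis
    then have "int (length [0..<Suc p]) = n + 1"
      using pull \<sigma> unfolding has_degree_def by (metis length_0_conv length_upt diff_zero nat.distinct(1))
    moreover have "\<not> degenerate_simplex p X \<sigma>"
    proof
      assume "degenerate_simplex p X \<sigma>"
      then obtain m i \<tau> where m: "p = Suc m" "i \<le> m" and \<tau>: "singular_simplex m X \<tau>"
        and eq: "\<sigma> = restrict (\<tau> \<circ> simplicial_degeneracy i) (standard_simplex p)"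
        unfolding degenerate_simplex_def by blast
      let ?w = "[0..<Suc i] @ [i..<Suc m]"
      have \<sigma>_eq: "\<sigma> = subsimplex \<tau> ?w" unfolding eq m(1) by (rule degeneracy_eq[OF m(2)])
      have "map (min m) ?w = ?w"
        by (rule map_idI) (use m in \<open>auto simp del: upt_Suc\<close>)
      then have "pull m \<tau> c ?w = c p \<sigma>"
        using m by (simp add: pull_def \<sigma>_eq del: upt_Suc)
      moreover have "degenerate_word ?w"
      proof -
        have "[i..<Suc m] = i # [Suc i..<Suc m]" using m(2) by (subst upt_conv_Cons) auto
        then have "?w = [0..<i] @ i # i # [Suc i..<Suc m]" by simp
        then show ?thesis unfolding degenerate_word_def by blast
      qed
      ultimately show False using pull \<tau> nz unfolding normalized_word_cochain_def by metis
    qed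
    ultimately show ?thesis using \<sigma> by simp
  qed
  then show "c \<in> normalized_cochains X n" unfolding normalized_cochains_def by blast
qed

section \<open>The index sets of the brace relation\<close>

lemma slice_shift: "slice (i + s) (j + s) xs = slice i j (drop s xs)"
  by (simp add: slice_def add.commute)

text \<open>
  After the first block, which ends at position \<open>k + l\<close>, the insertion continues on the remaining entries, with
  positions counted from there.
\<close>

lemma brace_insert_Cons:
  assumes "length ks = length bs" "length ls = length bs"
  shows "brace_insert F (b # bs) cs (k # map (\<lambda>x. x + (k + l)) ks) (l # ls)
    = take k cs @ brace F b (take l (drop k cs)) # brace_insert F bs (drop (k + l) cs) ks ls"
proof -
  let ?ks = "k # map (\<lambda>x. x + (k + l)) ks" and ?ls = "l # ls" and ?cs = "drop (k + l) cs"
  define e where "e = (\<lambda>i. if i = 0 then 0 else ?ks ! (i - 1) + ?ls ! (i - 1))"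
  define e' where "e' = (\<lambda>i. if i = 0 then 0 else ks ! (i - 1) + ls ! (i - 1))"
  have e_Suc: "e (Suc i) = e' i + (k + l)" if "i \<le> length bs" for i
    using that assms by (cases i) (auto simp: e_def e'_def)
  have step: "slice (e (Suc i)) (?ks ! Suc i) cs @ [brace F ((b # bs) ! Suc i) (slice (?ks ! Suc i) (?ks ! Suc i + ?ls ! Suc i) cs)]
      = slice (e' i) (ks ! i) ?cs @ [brace F (bs ! i) (slice (ks ! i) (ks ! i + ls ! i) ?cs)]" if "i < length bs" for i
  proof -
    have "?ks ! Suc i = ks ! i + (k + l)" using that assms by simp
    moreover have "?ks ! Suc i + ?ls ! Suc i = (ks ! i + ls ! i) + (k + l)" using that assms by simp
    ultimately show ?thesis using that by (simp only: e_Suc less_imp_le slice_shift nth_Cons_Suc)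
  qed
  have last: "slice (e (Suc (length bs))) (length cs) cs = slice (e' (length bs)) (length ?cs) ?cs"
    by (simp add: e_Suc slice_def add.commute)
  have "brace_insert F (b # bs) cs ?ks ?ls
      = concat (map (\<lambda>i. slice (e i) (?ks ! i) cs @ [brace F ((b # bs) ! i) (slice (?ks ! i) (?ks ! i + ?ls ! i) cs)]) [0..<Suc (length bs)])
        @ slice (e (Suc (length bs))) (length cs) cs"
    unfolding brace_insert_def Let_def e_def by (simp del: upt_Suc)
  also have "[0..<Suc (length bs)] = 0 # map Suc [0..<length bs]"
    by (simp add: map_Suc_upt upt_conv_Cons del: upt_Suc)
  also have "concat (map (\<lambda>i. slice (e i) (?ks ! i) cs @ [brace F ((b # bs) ! i) (slice (?ks ! i) (?ks ! i + ?ls ! i) cs)]) \<dots>)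
      = take k cs @ brace F b (take l (drop k cs)) #
        concat (map (\<lambda>i. slice (e (Suc i)) (?ks ! Suc i) cs @ [brace F ((b # bs) ! Suc i) (slice (?ks ! Suc i) (?ks ! Suc i + ?ls ! Suc i) cs)]) [0..<length bs])"
    by (simp add: e_def slice_def comp_def)
  also have "map (\<lambda>i. slice (e (Suc i)) (?ks ! Suc i) cs @ [brace F ((b # bs) ! Suc i) (slice (?ks ! Suc i) (?ks ! Suc i + ?ls ! Suc i) cs)]) [0..<length bs]
      = map (\<lambda>i. slice (e' i) (ks ! i) ?cs @ [brace F (bs ! i) (slice (ks ! i) (ks ! i + ls ! i) ?cs)]) [0..<length bs]"
    by (intro map_cong refl step) simp
  finally show ?thesis
    unfolding last by (simp add: brace_insert_def Let_def e'_def)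
qed

lemma brace_indices_0: "brace_indices 0 n = {([], [])}"
  by (auto simp: brace_indices_def)

lemma brace_indices_Suc:
  "brace_indices (Suc m) n = (\<lambda>(k, l, ks, ls). (k # map (\<lambda>x. x + (k + l)) ks, l # ls)) `
     (SIGMA k:{..n}. SIGMA l:{..n - k}. brace_indices m (n - (k + l)))" (is "_ = ?f ` ?A")
proof (intro equalityI subsetI)
  fix z assume z: "z \<in> brace_indices (Suc m) n"
  obtain ks' ls' where [simp]: "z = (ks', ls')" by (cases z)
  have len: "length ks' = Suc m" "length ls' = Suc m"
    and ineq: "\<And>i. i < Suc m \<Longrightarrow> ks' ! i + ls' ! i \<le> (if Suc i < Suc m then ks' ! Suc i else n)"
    using z by (auto simp: brace_indices_def)
  obtain k ks0 l ls where [simp]: "ks' = k # ks0" "ls' = l # ls"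
    using len by (metis length_Suc_conv)
  have len': "length ks0 = m" "length ls = m" using len by auto
  have ge: "k + l \<le> ks0 ! i" if "i < m" for i
    using that
  proof (induction i)
    case 0
    then show ?case using ineq[of 0] by simp
  next
    case (Suc i)
    then show ?case using ineq[of "Suc i"] by simp
  qed
  have le: "k + l \<le> n"
  proof (cases m)
    case 0
    then show ?thesis using ineq[of 0] by simp
  next
    case (Suc j)
    then show ?thesis using ineq[of m] ge[of j] by simp
  qed
  let ?ks = "map (\<lambda>x. x - (k + l)) ks0"
  have "map (\<lambda>x. x + (k + l)) ?ks = ks0"
    by (rule nth_equalityI) (use ge len' in auto)
  moreover have "?ks ! i + ls ! i \<le> (if Suc i < m then ?ks ! Suc i else n - (k + l))" if i: "i < m" for i
  proof -
    have "ks0 ! i + ls ! i \<le> (if Suc i < m then ks0 ! Suc i else n)" using ineq[of "Suc i"] i by (auto split: if_splits)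
    then show ?thesis using ge[OF i] i by (auto simp: len' split: if_splits)
  qed
  then have "(?ks, ls) \<in> brace_indices m (n - (k + l))"
    unfolding brace_indices_def mem_Collect_eq prod.case using len' by (intro conjI allI impI) (simp_all only: length_map)
  ultimately show "z \<in> ?f ` ?A"
    using le by (intro image_eqI[of _ _ "(k, l, ?ks, ls)"]) auto
next
  fix z assume "z \<in> ?f ` ?A"
  then obtain k l ks ls where z: "z = (k # map (\<lambda>x. x + (k + l)) ks, l # ls)" and kl: "k \<le> n" "l \<le> n - k"
    and i: "(ks, ls) \<in> brace_indices m (n - (k + l))" by auto
  have len: "length ks = m" "length ls = m"
    and ineq: "\<And>i. i < m \<Longrightarrow> ks ! i + ls ! i \<le> (if Suc i < m then ks ! Suc i else n - (k + l))"
    using i by (auto simp: brace_indices_def)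
  let ?ks = "k # map (\<lambda>x. x + (k + l)) ks"
  have "?ks ! i + (l # ls) ! i \<le> (if Suc i < Suc m then ?ks ! Suc i else n)" if "i < Suc m" for i
    using that kl ineq[of "i - 1"] len by (cases i) (auto split: if_splits)
  then show "z \<in> brace_indices (Suc m) n"
    unfolding z brace_indices_def mem_Collect_eq prod.case using len
    by (intro conjI allI impI) (simp_all only: length_map length_Cons)
qed

lemma finite_brace_indices: "finite (brace_indices m n)"
  by (induction m arbitrary: n) (auto simp: brace_indices_0 brace_indices_Suc)

text \<open>
  The sum over the positions and lengths of all blocks at once is evaluated block by block.
\<close>

lemma sum_brace_indices:
  "(\<Sum>(ks, ls)\<in>brace_indices (length bs) (length cs). G (brace_insert F bs cs ks ls))
    = insertion_sum (brace F) bs G cs"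
proof (induction bs arbitrary: G cs)
  case Nil
  then show ?case by (simp add: brace_indices_0 brace_insert_def slice_def)
next
  case (Cons b bs)
  let ?n = "length cs"
  let ?f = "\<lambda>(k, l, ks, ls). (k # map (\<lambda>x. x + (k + l)) ks, l # ls)"
  let ?A = "SIGMA k:{..?n}. SIGMA l:{..?n - k}. brace_indices (length bs) (?n - (k + l))"
  have inj: "inj_on ?f ?A"
    by (auto simp: inj_on_def inj_map_eq_map[OF injI])
  have "(\<Sum>(ks, ls)\<in>brace_indices (length (b # bs)) ?n. G (brace_insert F (b # bs) cs ks ls))
      = (\<Sum>(k, l, ks, ls)\<in>?A. G (brace_insert F (b # bs) cs (k # map (\<lambda>x. x + (k + l)) ks) (l # ls)))"
    unfolding length_Cons brace_indices_Suc sum.reindex[OF inj] by (intro sum.cong) auto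
  also have "\<dots> = (\<Sum>(k, l, ks, ls)\<in>?A. G (take k cs @ brace F b (take l (drop k cs)) # brace_insert F bs (drop (k + l) cs) ks ls))"
    by (intro sum.cong refl) (auto simp: brace_indices_def brace_insert_Cons)
  also have "\<dots> = (\<Sum>k\<le>?n. \<Sum>l\<le>?n - k. \<Sum>(ks, ls)\<in>brace_indices (length bs) (?n - (k + l)).
      G (take k cs @ brace F b (take l (drop k cs)) # brace_insert F bs (drop (k + l) cs) ks ls))"
    by (simp add: sum.Sigma finite_brace_indices finite_SigmaI)
  also have "\<dots> = insertion_sum (brace F) (b # bs) G cs"
    using Cons.IH[of "\<lambda>L. G (take k cs @ brace F b (take l (drop k cs)) # L)" "drop (k + l) cs" for k l]
    by simp
  finally show ?case .
qed

lemma brace_insert_not_Nil: "bs \<noteq> [] \<Longrightarrow> brace_insert F bs cs ks ls \<noteq> []"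
  unfolding brace_insert_def Let_def by (cases bs) auto

lemma map_slice: "map f (slice i j xs) = slice i j (map f xs)"
  by (simp add: slice_def take_map drop_map)

lemma map_brace_insert:
  assumes "\<And>b u. f (brace F b u) = brace F' (f b) (map f u)"
  shows "map f (brace_insert F bs cs ks ls) = brace_insert F' (map f bs) (map f cs) ks ls"
  unfolding brace_insert_def Let_def
  by (auto simp: map_concat map_slice assms comp_def intro!: arg_cong[where f=concat])

section \<open>The structure equations on words\<close>

lemma word_op_0: "word_op 0 [a] bs = word_brace bs a"
  by (simp add: word_op.simps(1))

lemma word_brace_d:
  assumes "bs \<noteq> []"
  shows "word_d (word_brace bs a) + word_brace bs (word_d a) + (\<Sum>i<length bs. word_brace (apply_at word_d bs i) a)
    = word_cup (hd bs) (word_brace (tl bs) a) + (\<Sum>i<length bs - 1. word_brace (merge_at word_cup bs i) a)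
      + word_cup (word_brace (butlast bs) a) (last bs)"
proof -
  define M I where "M = (\<Sum>i<length bs - 1. word_brace (merge_at word_cup bs i) a)"
    and "I = (\<Sum>i<length bs. word_brace (apply_at word_d bs i) a)"
  have "left_end bs a = word_cup (hd bs) (word_brace (tl bs) a)"
    using assms by (simp add: left_end_def split: list.split)
  moreover have "right_end bs a = word_cup (word_brace (butlast bs) a) (last bs)"
    using assms by (simp add: right_end_def)
  moreover have "W.bar (\<lambda>u. word_brace u a) bs = I + M"
    by (simp only: W.bar_def W.internal_def W.merge_def M_def I_def)
  ultimately have "word_d (word_brace bs a) + word_brace bs (word_d a) + (I + M)
      = word_cup (hd bs) (word_brace (tl bs) a) + word_cup (word_brace (butlast bs) a) (last bs)"
    using word_d_word_brace[OF assms, of a] by (simp only:)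
  then have "word_d (word_brace bs a) + word_brace bs (word_d a) + (I + M) + M
      = word_cup (hd bs) (word_brace (tl bs) a) + word_cup (word_brace (butlast bs) a) (last bs) + M"
    by (simp only:)
  then show ?thesis
    unfolding M_def[symmetric] I_def[symmetric] by (simp only: add2_simps)
qed

lemma word_brace_product:
  assumes "bs \<noteq> []"
  shows "word_cup a1 (word_brace bs a2) + word_brace bs (word_cup a1 a2) + word_cup (word_brace bs a1) a2
    = (\<Sum>p=1..<length bs. word_cup (word_brace (take p bs) a1) (word_brace (drop p bs) a2))"
proof -
  have "{..length bs} = insert 0 (insert (length bs) {1..<length bs})" using assms by (auto simp: Suc_le_eq)
  then have "word_brace bs (word_cup a1 a2) = word_cup a1 (word_brace bs a2) + (word_cup (word_brace bs a1) a2
      + (\<Sum>p=1..<length bs. word_cup (word_brace (take p bs) a1) (word_brace (drop p bs) a2)))"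
    using assms unfolding word_brace_word_cup conv_def by simp
  then show ?thesis by (simp only: add2_simps)
qed

lemma word_brace_brace:
  "word_brace cs (word_brace bs a) = (\<Sum>(ks, ls)\<in>brace_indices (length bs) (length cs).
     word_brace (brace_insert (\<lambda>b u. word_brace u b) bs cs ks ls) a)"
proof -
  have "brace (\<lambda>b u. word_brace u b) = (\<lambda>b u. word_brace u b)"
    by (simp add: fun_eq_iff brace_def)
  then show ?thesis
    using sum_brace_indices[of "\<lambda>L. word_brace L a" "\<lambda>b u. word_brace u b" bs cs]
    by (simp only: word_brace_word_brace)
qed

text \<open>
  In the structure equation, one factor at each excluded corner is an operation without arguments, which is
  zero; so the corners may be included.
\<close>

lemma sum_without_corners:
  fixes f :: "nat \<Rightarrow> nat \<Rightarrow> 'r::comm_monoid_add"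
  assumes "f 0 0 = 0" "f m n = 0"
  shows "(\<Sum>(p, q)\<in>({0..m} \<times> {0..n}) - {(0, 0), (m, n)}. f p q) = (\<Sum>p\<le>m. \<Sum>q\<le>n. f p q)"
proof -
  have "(\<Sum>p\<le>m. \<Sum>q\<le>n. f p q) = (\<Sum>(p, q)\<in>{0..m} \<times> {0..n}. f p q)"
    by (simp add: sum.cartesian_product atLeast0AtMost)
  also have "\<dots> = (\<Sum>(p, q)\<in>({0..m} \<times> {0..n}) - {(0, 0), (m, n)}. f p q)"
    by (rule sum.mono_neutral_right) (use assms in auto)
  finally show ?thesis by simp
qed

lemma word_op_Nil_Nil: "word_op k [] [] = 0"
  by (cases "k = 0") (simp_all add: word_op.simps(1) word_op_Nil)

lemma swaps_word_op_Nil_Nil: "(swap_args ^^ i) (word_op k) [] [] = 0"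
  by (induction i) (simp_all add: word_op_Nil_Nil swap_args_def)

lemma word_op_equation:
  assumes "as \<noteq> []" "bs \<noteq> []"
  shows "word_d (word_op k as bs)
     + (\<Sum>i<length as. word_op k (apply_at word_d as i) bs)
     + (\<Sum>i<length bs. word_op k as (apply_at word_d bs i))
     + (\<Sum>i<length as - 1. word_op k (merge_at word_cup as i) bs)
     + (\<Sum>i<length bs - 1. word_op k as (merge_at word_cup bs i))
     + (\<Sum>i=0..k. \<Sum>(p, q)\<in>({0..length as} \<times> {0..length bs}) - {(0, 0), (length as, length bs)}.
          word_cup (word_op i (take p as) (take q bs)) ((swap_args ^^ i) (word_op (k - i)) (drop p as) (drop q bs)))
     = (if k = 0 then 0 else word_op (k - 1) as bs) + (if k = 0 then 0 else word_op (k - 1) bs as)"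
proof -
  define C where "C = (\<Sum>i=0..k. \<Sum>(p, q)\<in>({0..length as} \<times> {0..length bs}) - {(0, 0), (length as, length bs)}.
          word_cup (word_op i (take p as) (take q bs)) ((swap_args ^^ i) (word_op (k - i)) (drop p as) (drop q bs)))"
  have "W.cup_sum word_op k as bs = (\<Sum>i\<le>k. (word_op i \<smile> (swap_args ^^ i) (word_op (k - i))) as bs)"
    by (simp only: W.cup_sum_def sum_fun_apply)
  also have "\<dots> = C"
    unfolding C_def W.cupop_apply atLeast0AtMost
    by (intro sum.cong refl sum_without_corners[symmetric, unfolded atLeast0AtMost])
      (simp_all add: word_op_Nil_Nil swaps_word_op_Nil_Nil)
  finally have "W.cup_sum word_op k as bs = C" .
  moreover have "W.symmetrized_pred word_op k as bs
      = (if k = 0 then 0 else word_op (k - 1) as bs) + (if k = 0 then 0 else word_op (k - 1) bs as)"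
    by (cases k) (simp_all add: W.symmetrized_pred_def swap_args_def)
  moreover have "W.defect word_op k as bs = 0"
    by (simp only: word_op_defect zero_fun_apply)
  ultimately have "W.total_d (word_op k) as bs + C
      + ((if k = 0 then 0 else word_op (k - 1) as bs) + (if k = 0 then 0 else word_op (k - 1) bs as)) = 0"
    by (simp only: W.defect_def plus_fun_apply)
  then have "W.total_d (word_op k) as bs + C
      = (if k = 0 then 0 else word_op (k - 1) as bs) + (if k = 0 then 0 else word_op (k - 1) bs as)"
    by (rule iffD2[OF eq_iff_add_eq_0])
  then show ?thesis
    unfolding C_def[symmetric] W.total_d_apply W.bar_def W.internal_def W.merge_def by (simp only: add_ac)
qed

section \<open>The structure on singular cochains\<close>

lemma graded_space_cochains: "graded_space_Z2 cochain_scale (normalized_cochains X)"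
proof -
  interpret V: vector_space "cochain_scale :: bit \<Rightarrow> 'a cochain \<Rightarrow> 'a cochain"
    by unfold_locales (auto simp: cochain_scale_def fun_eq_iff algebra_simps)
  show ?thesis
  proof
    fix n
    show "V.subspace (normalized_cochains X n)"
      unfolding V.subspace_def
    proof (intro conjI ballI allI)
      show "0 \<in> normalized_cochains X n" by (simp add: normalized_cochains_def)
      fix a assume a: "a \<in> normalized_cochains X n"
      show "a + b \<in> normalized_cochains X n" if b: "b \<in> normalized_cochains X n" for b
      proof -
        have "a p \<sigma> \<noteq> 0 \<or> b p \<sigma> \<noteq> 0" if "(a + b) p \<sigma> \<noteq> 0" for p \<sigma>
          using that by (metis add_0_right plus_fun_apply)
        then show ?thesis using a b unfolding normalized_cochains_def by blast
      qed
      show "cochain_scale r a \<in> normalized_cochains X n" for r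
      proof -
        have "a p \<sigma> \<noteq> 0" if "cochain_scale r a p \<sigma> \<noteq> 0" for p \<sigma>
          using that unfolding cochain_scale_def by (metis mult_zero_right)
        then show ?thesis using a unfolding normalized_cochains_def by blast
      qed
    qed
  next
    fix N :: "int set" and x :: "int \<Rightarrow> 'a cochain" and n
    assume N: "finite N" and x: "\<And>n. n \<in> N \<Longrightarrow> x n \<in> normalized_cochains X n"
      and sum: "(\<Sum>n\<in>N. x n) = 0" and n: "n \<in> N"
    have "x n p \<sigma> = 0" for p \<sigma>
    proof (rule ccontr)
      assume nz: "x n p \<sigma> \<noteq> 0"
      have z: "x m p \<sigma> = 0" if "m \<in> N" "m \<noteq> n" for m
        using x[OF n] x[OF that(1)] nz that(2) unfolding normalized_cochains_def by blast
      have "(\<Sum>m\<in>N. x m) p \<sigma> = (\<Sum>m\<in>N. x m p \<sigma>)" by (simp only: sum_fun_apply)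
      also have "\<dots> = x n p \<sigma> + (\<Sum>m\<in>N - {n}. x m p \<sigma>)" using N n by (rule sum.remove)
      also have "\<dots> = x n p \<sigma>" by (simp add: z)
      finally show False using nz sum by simp
    qed
    then show "x n = 0" by (simp add: fun_eq_iff)
  qed
qed

lemma has_degree_word_op:
  assumes "rels same_degree as as m" "rels same_degree bs bs n"
  shows "has_degree (word_op k as bs) (m + n + (1 - int k))"
  using degree.compat2_word_op[of k] assms unfolding compat2_def same_degree_def by blast

lemma normalized_word_op:
  assumes "rels same_normalized as as m" "rels same_normalized bs bs n"
  shows "normalized_word_cochain (word_op k as bs)"
  using normalized.compat2_word_op[of k] assms unfolding compat2_def same_normalized_def by blast

lemma (in graded_space_Z2) linear_on_totalI:
  assumes "\<And>x y. x \<in> total \<Longrightarrow> y \<in> total \<Longrightarrow> f (x + y) = f x + f y"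
  shows "linear_on_total f"
  unfolding linear_on_total_def
proof (intro conjI allI ballI)
  fix r x assume "x \<in> total"
  have "0 \<in> total" unfolding total_def by (rule span_zero)
  then have "f 0 = 0" using assms[of 0 0] by simp
  moreover have "scale 0 y = 0" "scale 1 y = y" for y by simp_all
  ultimately show "f (scale r x) = scale r (f x)"
    by (cases r) (simp_all only:)
qed (rule assms)

lemma multiadditive_cochain_op:
  "cochain_op X k (us @ (x + y) # vs) bs = cochain_op X k (us @ x # vs) bs + cochain_op X k (us @ y # vs) bs"
  "cochain_op X k as (us @ (x + y) # vs) = cochain_op X k as (us @ x # vs) + cochain_op X k as (us @ y # vs)"
proof -
  have m: "word_op k (us @ (x + y) # vs) bs = word_op k (us @ x # vs) bs + word_op k (us @ y # vs) bs"
    "word_op k as (us @ (x + y) # vs) = word_op k as (us @ x # vs) + word_op k as (us @ y # vs)" for us x y vs as bs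
    using bimultiadditive_word_op[of k] unfolding bimultiadditive_def multiadditive_def by blast+
  show "cochain_op X k (us @ (x + y) # vs) bs = cochain_op X k (us @ x # vs) bs + cochain_op X k (us @ y # vs) bs"
    "cochain_op X k as (us @ (x + y) # vs) = cochain_op X k as (us @ x # vs) + cochain_op X k as (us @ y # vs)"
    by (simp_all add: cochain_op_def fun_eq_iff pull_add m del: upt_Suc)
qed

context
  fixes X :: "'a topology"
begin

interpretation C: graded_space_Z2 cochain_scale "normalized_cochains X"
  by (rule graded_space_cochains)

lemma supported_total: "x \<in> C.total \<Longrightarrow> supported X x"
proof -
  have "C.span (\<Union>n. normalized_cochains X n) \<subseteq> {x. supported X x}"
  proof (rule C.span_minimal)
    show "(\<Union>n. normalized_cochains X n) \<subseteq> {x. supported X x}"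
      by (auto simp: normalized_cochains_iff)
    show "C.subspace {x. supported X x}"
      unfolding C.subspace_def
      by (auto simp: supported_0 supported_add) (simp add: supported_def cochain_scale_def)
  qed
  then show "x \<in> C.total \<Longrightarrow> supported X x" unfolding C.total_def by blast
qed

lemma rels_homogeneous:
  assumes "C.homogeneous xs ns" and \<sigma>: "singular_simplex p X \<sigma>"
  shows "rels same_degree (map (pull p \<sigma>) xs) (map (pull p \<sigma>) xs) (sum_list ns - int (length xs))"
    and "\<exists>m. rels same_normalized (map (pull p \<sigma>) xs) (map (pull p \<sigma>) xs) m"
proof -
  have "list_all2 (\<lambda>x n. x \<in> normalized_cochains X n) xs ns"
    using assms(1) unfolding C.homogeneous_def .
  then have "rels same_degree (map (pull p \<sigma>) xs) (map (pull p \<sigma>) xs) (sum_list ns - int (length xs)) \<and>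
     (\<exists>m. rels same_normalized (map (pull p \<sigma>) xs) (map (pull p \<sigma>) xs) m)"
  proof (induction rule: list_all2_induct)
    case Nil
    then show ?case by (auto intro: rels.rels_Nil)
  next
    case (Cons x xs n ns)
    have x: "normalized_word_cochain (pull p \<sigma> x)" "has_degree (pull p \<sigma> x) n"
      using Cons \<sigma> by (auto simp: normalized_cochains_iff)
    have "rels same_degree (map (pull p \<sigma>) (x # xs)) (map (pull p \<sigma>) (x # xs)) (n - 1 + (sum_list ns - int (length xs)))"
    proof -
      have "same_degree n (pull p \<sigma> x) (pull p \<sigma> x)" using x by (simp add: same_degree_def)
      then show ?thesis using Cons by (simp add: rels.rels_Cons)
    qed
    then have "rels same_degree (map (pull p \<sigma>) (x # xs)) (map (pull p \<sigma>) (x # xs)) (sum_list (n # ns) - int (length (x # xs)))"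
      by (simp add: algebra_simps)
    moreover obtain m where "rels same_normalized (map (pull p \<sigma>) xs) (map (pull p \<sigma>) xs) m"
      using Cons by blast
    then have "rels same_normalized (map (pull p \<sigma>) (x # xs)) (map (pull p \<sigma>) (x # xs)) (0 - 1 + m)"
      unfolding list.map by (intro rels.rels_Cons) (use x in \<open>auto simp: same_normalized_def\<close>)
    ultimately show ?case by blast
  qed
  then show "rels same_degree (map (pull p \<sigma>) xs) (map (pull p \<sigma>) xs) (sum_list ns - int (length xs))"
    and "\<exists>m. rels same_normalized (map (pull p \<sigma>) xs) (map (pull p \<sigma>) xs) m" by auto
qed

lemma cochain_op_degree:
  assumes "C.homogeneous xs ms" "C.homogeneous ys ns" "xs \<noteq> []" "ys \<noteq> []"
  shows "cochain_op X k xs ys \<in> normalized_cochains X (sum_list ms + sum_list ns + (1 - int k - int (length xs) - int (length ys)))"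
  unfolding normalized_cochains_iff
proof (intro conjI allI impI supported_cochain_op)
  fix p and \<sigma> :: "(nat \<Rightarrow> real) \<Rightarrow> 'a" assume \<sigma>: "singular_simplex p X \<sigma>"
  note pull = pull_cochain_op[OF \<sigma> assms(3,4)]
  obtain m n where "rels same_normalized (map (pull p \<sigma>) xs) (map (pull p \<sigma>) xs) m"
    "rels same_normalized (map (pull p \<sigma>) ys) (map (pull p \<sigma>) ys) n"
    using rels_homogeneous(2)[OF assms(1) \<sigma>] rels_homogeneous(2)[OF assms(2) \<sigma>] by blast
  then show "normalized_word_cochain (pull p \<sigma> (cochain_op X k xs ys))"
    unfolding pull by (rule normalized_word_op)
  show "has_degree (pull p \<sigma> (cochain_op X k xs ys)) (sum_list ms + sum_list ns + (1 - int k - int (length xs) - int (length ys)))"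
    using has_degree_word_op[OF rels_homogeneous(1)[OF assms(1) \<sigma>] rels_homogeneous(1)[OF assms(2) \<sigma>], of k]
    unfolding pull by (simp add: algebra_simps)
qed

text \<open>
  All axioms hold for functions on words and are reflected by the jointly injective pullbacks; only
  the unit, the cochain with value 1 on all vertices, is specific to this place.
\<close>

lemma dg_algebra_cochains: "dg_algebra_Z2 cochain_scale (normalized_cochains X) (coboundary X) (cup X)"
proof (unfold_locales, goal_cases)
  case 1
  have "coboundary X (x + y) = coboundary X x + coboundary X y" for x y
    by (simp add: coboundary_def fun_eq_iff sum.distrib)
  then show ?case by (rule C.linear_on_totalI)
next
  case (2 x n)
  then show ?case
    by (simp add: normalized_cochains_iff supported_coboundary pull_coboundary normalized_word_d has_degree_word_d)
next
  case (3 x)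
  show ?case
    by (rule supported_eqI[OF supported_coboundary supported_0]) (simp add: pull_coboundary W.d_d pull_0)
next
  case (4 y)
  have "cup X (x + x') y = cup X x y + cup X x' y" for x x'
    by (simp add: cup_def fun_eq_iff sum.distrib distrib_right)
  then show ?case by (rule C.linear_on_totalI)
next
  case (5 x)
  have "cup X x (y + y') = cup X x y + cup X x y'" for y y'
    by (simp add: cup_def fun_eq_iff sum.distrib distrib_left)
  then show ?case by (rule C.linear_on_totalI)
next
  case (6 x m y n)
  then show ?case
    by (simp add: normalized_cochains_iff supported_cup pull_cup normalized_word_cup has_degree_word_cup)
next
  case (7 x y z)
  show ?case
    by (rule supported_eqI[OF supported_cup supported_cup]) (simp add: pull_cup word_cup_assoc)
next
  case 8
  define u :: "'a cochain" where "u = (\<lambda>p \<sigma>. if p = 0 \<and> singular_simplex p X \<sigma> then 1 else 0)"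
  have "u \<in> normalized_cochains X 0"
    by (auto simp: u_def normalized_cochains_def degenerate_simplex_def)
  moreover have "cup X u x = x \<and> cup X x u = x" if "x \<in> C.total" for x
  proof -
    have pull_u: "pull p \<sigma> u w = (if length w = 1 then 1 else 0)" if "singular_simplex p X \<sigma>" for p \<sigma> w
    proof (cases "w = []")
      case False
      then show ?thesis
        using singular_clamp[OF that False] by (cases w) (auto simp: pull_def u_def)
    qed simp
    have "word_cup (pull p \<sigma> u) f = trunc f" "word_cup f (pull p \<sigma> u) = trunc f" if \<sigma>: "singular_simplex p X \<sigma>" for p \<sigma> f
    proof -
      have "word_cup (pull p \<sigma> u) f w = trunc f w" for w
      proof (cases w)
        case (Cons v w')
        have "(\<Sum>i<length w. pull p \<sigma> u (take (Suc i) w) * f (drop i w))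
            = (\<Sum>i\<in>{0}. pull p \<sigma> u (take (Suc i) w) * f (drop i w))"
          by (rule sum.mono_neutral_right) (auto simp: Cons pull_u[OF \<sigma>] min_def)
        then show ?thesis by (simp add: word_cup_def trunc_def Cons pull_u[OF \<sigma>])
      qed (simp add: trunc_def)
      moreover have "word_cup f (pull p \<sigma> u) w = trunc f w" for w
      proof (cases "w = []")
        case False
        have "(\<Sum>i<length w. f (take (Suc i) w) * pull p \<sigma> u (drop i w))
            = (\<Sum>i\<in>{length w - 1}. f (take (Suc i) w) * pull p \<sigma> u (drop i w))"
          by (rule sum.mono_neutral_right) (use False in \<open>auto simp: pull_u[OF \<sigma>]\<close>)
        moreover have "length w - (length w - 1) = 1" using False by (cases w) auto
        ultimately show ?thesis using False by (simp add: word_cup_def trunc_def pull_u[OF \<sigma>])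
      qed (simp add: trunc_def)
      ultimately show "word_cup (pull p \<sigma> u) f = trunc f" "word_cup f (pull p \<sigma> u) = trunc f" by auto
    qed
    moreover have "trunc (pull p \<sigma> x) = pull p \<sigma> x" for p \<sigma>
      by (rule trunc_eq) simp
    ultimately have eq: "pull p \<sigma> (cup X u x) = pull p \<sigma> x" "pull p \<sigma> (cup X x u) = pull p \<sigma> x"
      if "singular_simplex p X \<sigma>" for p \<sigma>
      using that by (simp_all add: pull_cup)
    show ?thesis
      by (intro conjI supported_eqI[OF supported_cup supported_total[OF that]] eq)
  qed
  ultimately show ?case by blast
next
  case (9 x y)
  show ?case
    by (rule supported_eqI[OF supported_coboundary supported_add[OF supported_cup supported_cup]])
      (simp add: pull_coboundary pull_cup pull_add W.d_mul)
qed

interpretation A: dg_algebra_Z2 cochain_scale "normalized_cochains X" "coboundary X" "cup X"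
  by (rule dg_algebra_cochains)

abbreviation (input) cochain_brace :: "'a cochain \<Rightarrow> 'a cochain list \<Rightarrow> 'a cochain" where
  "cochain_brace a bs \<equiv> cochain_op X 0 [a] bs"

lemma pull_cochain_brace:
  "singular_simplex p X \<sigma> \<Longrightarrow> bs \<noteq> [] \<Longrightarrow> pull p \<sigma> (cochain_brace a bs) = word_brace (map (pull p \<sigma>) bs) (pull p \<sigma> a)"
  by (simp add: pull_cochain_op word_op_0)

lemma pull_brace:
  "singular_simplex p X \<sigma> \<Longrightarrow> pull p \<sigma> (brace cochain_brace a bs) = word_brace (map (pull p \<sigma>) bs) (pull p \<sigma> a)"
  by (simp add: brace_def pull_cochain_brace)

lemma map_apply_at:
  assumes "\<And>x. f (g x) = g' (f x)" "i < length xs"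
  shows "map f (apply_at g xs i) = apply_at g' (map f xs) i"
  using assms by (simp add: apply_at_def map_update)

lemma map_merge_at:
  assumes "\<And>x y. f (m x y) = m' (f x) (f y)" "i < length xs - 1"
  shows "map f (merge_at m xs i) = merge_at m' (map f xs) i"
proof -
  have "i < length xs" "Suc i < length xs" using assms(2) by auto
  then show ?thesis by (simp add: merge_at_def take_map drop_map assms(1))
qed

lemma homotopy_G_algebra_cochains:
  "homotopy_G_algebra_Z2 cochain_scale (normalized_cochains X) (coboundary X) (cup X) cochain_brace"
proof (unfold_locales, goal_cases)
  case (1 bs)
  have "cochain_op X 0 [x + y] bs = cochain_op X 0 [x] bs + cochain_op X 0 [y] bs" for x y
    using multiadditive_cochain_op(1)[of X 0 "[]" x y "[]" bs] by simp
  then show ?case by (intro C.linear_on_totalI)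
next
  case (2 a k)
  then show ?case
    unfolding C.multilinear_on_total_def by (intro ballI impI C.linear_on_totalI multiadditive_cochain_op)
next
  case (3 a n bs ns)
  then show ?case
    using cochain_op_degree[of "[a]" "[n]" bs ns 0] by (simp add: C.homogeneous_def algebra_simps)
next
  case (4 a bs k)
  have ne: "bs \<noteq> []" using 4 by auto
  have ne': "apply_at (coboundary X) bs i \<noteq> []" "merge_at (cup X) bs i \<noteq> []" for i
    using ne by (auto simp: apply_at_def merge_at_def)
  show ?case
  proof (rule supported_eqI)
    fix p and \<sigma> :: "(nat \<Rightarrow> real) \<Rightarrow> 'a" assume \<sigma>: "singular_simplex p X \<sigma>"
    let ?P = "pull p \<sigma>"
    have "?P (\<Sum>i<k. cochain_brace a (apply_at (coboundary X) bs i))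
        = (\<Sum>i<length (map ?P bs). word_brace (apply_at word_d (map ?P bs) i) (?P a))"
      unfolding pull_sum using 4(3)
      by (intro sum.cong) (auto simp: pull_cochain_brace[OF \<sigma> ne'(1)] map_apply_at[where f="?P" and g="coboundary X" and g'=word_d, OF pull_coboundary[OF \<sigma>]])
    moreover have "?P (\<Sum>i<k - 1. cochain_brace a (merge_at (cup X) bs i))
        = (\<Sum>i<length (map ?P bs) - 1. word_brace (merge_at word_cup (map ?P bs) i) (?P a))"
      unfolding pull_sum using 4(3)
      by (intro sum.cong) (auto simp: pull_cochain_brace[OF \<sigma> ne'(2)] map_merge_at[where f="?P" and m="cup X" and m'=word_cup, OF pull_cup[OF \<sigma>]])
    ultimately show "?P (coboundary X (cochain_brace a bs) + cochain_brace (coboundary X a) bs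
          + (\<Sum>i<k. cochain_brace a (apply_at (coboundary X) bs i)))
        = ?P (cup X (hd bs) (brace cochain_brace a (tl bs)) + (\<Sum>i<k - 1. cochain_brace a (merge_at (cup X) bs i))
          + cup X (brace cochain_brace a (butlast bs)) (last bs))"
      using word_brace_d[of "map ?P bs" "?P a"] ne
      by (simp only: pull_add pull_coboundary[OF \<sigma>] pull_cup[OF \<sigma>] pull_cochain_brace[OF \<sigma> ne] pull_brace[OF \<sigma>]
          list.map_disc_iff hd_map last_map map_tl map_butlast simp_thms)
  qed (intro supported_add supported_sum supported_coboundary supported_cup supported_cochain_op)+
next
  case (5 a1 a2 bs k)
  have ne: "bs \<noteq> []" using 5 by auto
  show ?case
  proof (rule supported_eqI)
    fix p and \<sigma> :: "(nat \<Rightarrow> real) \<Rightarrow> 'a" assume \<sigma>: "singular_simplex p X \<sigma>"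
    let ?P = "pull p \<sigma>"
    have "?P (\<Sum>q=1..<k. cup X (cochain_brace a1 (take q bs)) (cochain_brace a2 (drop q bs)))
      = (\<Sum>q=1..<length (map ?P bs). word_cup (word_brace (take q (map ?P bs)) (?P a1)) (word_brace (drop q (map ?P bs)) (?P a2)))"
      unfolding pull_sum using 5(4) ne
      by (intro sum.cong) (auto simp: pull_cup[OF \<sigma>] pull_cochain_brace[OF \<sigma>] take_map drop_map)
    then show "?P (cup X a1 (cochain_brace a2 bs) + cochain_brace (cup X a1 a2) bs + cup X (cochain_brace a1 bs) a2)
       = ?P (\<Sum>q=1..<k. cup X (cochain_brace a1 (take q bs)) (cochain_brace a2 (drop q bs)))"
      using word_brace_product[of "map ?P bs" "?P a1" "?P a2"] ne
      by (simp only: pull_add pull_cup[OF \<sigma>] pull_cochain_brace[OF \<sigma> ne] list.map_disc_iff simp_thms)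
  qed (intro supported_add supported_sum supported_cup supported_cochain_op)+
next
  case (6 a bs cs m n)
  have ne: "bs \<noteq> []" "cs \<noteq> []" using 6 by auto
  show ?case
  proof (rule supported_eqI)
    fix p and \<sigma> :: "(nat \<Rightarrow> real) \<Rightarrow> 'a" assume \<sigma>: "singular_simplex p X \<sigma>"
    let ?P = "pull p \<sigma>"
    have "?P (brace cochain_brace b u) = brace (\<lambda>b u. word_brace u b) (?P b) (map ?P u)" for b u
      unfolding pull_brace[OF \<sigma>] by (simp add: brace_def)
    then have P: "map ?P (brace_insert cochain_brace bs cs ks ls)
        = brace_insert (\<lambda>b u. word_brace u b) (map ?P bs) (map ?P cs) ks ls" for ks ls
      by (rule map_brace_insert)
    have "?P (\<Sum>(ks, ls)\<in>brace_indices m n. cochain_brace a (brace_insert cochain_brace bs cs ks ls))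
       = (\<Sum>(ks, ls)\<in>brace_indices (length (map ?P bs)) (length (map ?P cs)).
            word_brace (brace_insert (\<lambda>b u. word_brace u b) (map ?P bs) (map ?P cs) ks ls) (?P a))"
      unfolding pull_sum using 6(4,5)
      by (intro sum.cong) (auto simp: pull_cochain_brace[OF \<sigma> brace_insert_not_Nil[OF ne(1)]] P)
    then show "?P (cochain_brace (cochain_brace a bs) cs)
       = ?P (\<Sum>(ks, ls)\<in>brace_indices m n. cochain_brace a (brace_insert cochain_brace bs cs ks ls))"
      by (simp only: pull_cochain_brace[OF \<sigma>] ne not_False_eq_True word_brace_brace)
  next
    show "supported X (\<Sum>(ks, ls)\<in>brace_indices m n. cochain_brace a (brace_insert cochain_brace bs cs ks ls))"
      by (intro supported_sum) (auto intro: supported_cochain_op)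
  qed (rule supported_cochain_op)
qed

lemma extended_homotopy_G_algebra_cochains:
  "extended_homotopy_G_algebra_Z2 cochain_scale (normalized_cochains X) (coboundary X) (cup X) (cochain_op X)"
proof -
  interpret H: homotopy_G_algebra_Z2 cochain_scale "normalized_cochains X" "coboundary X" "cup X" "\<lambda>a bs. cochain_op X 0 [a] bs"
    by (rule homotopy_G_algebra_cochains)
  show ?thesis
  proof (unfold_locales, goal_cases)
    case (1 p ys k)
    then show ?case
      unfolding C.multilinear_on_total_def by (intro ballI impI C.linear_on_totalI multiadditive_cochain_op)
  next
    case (2 q xs k)
    then show ?case
      unfolding C.multilinear_on_total_def by (intro ballI impI C.linear_on_totalI multiadditive_cochain_op)
  next
    case (3 xs ms ys ns p q k)
    then have "xs \<noteq> []" "ys \<noteq> []" by auto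
    with 3 show ?case using cochain_op_degree[of xs ms ys ns k] by simp
  next
    case (4 xs ys)
    then show ?case
      by (auto simp: cochain_op_def fun_eq_iff word_op.simps(1) brace_op_long)
  next
    case (5 as bs m n k)
    have ne: "as \<noteq> []" "bs \<noteq> []" using 5 by auto
    have ne': "apply_at (coboundary X) as i \<noteq> []" "merge_at (cup X) as i \<noteq> []"
       "apply_at (coboundary X) bs i \<noteq> []" "merge_at (cup X) bs i \<noteq> []" for i
      using ne by (auto simp: apply_at_def merge_at_def)
    let ?E = "cochain_op X" and ?I = "({0..m} \<times> {0..n}) - {(0, 0), (m, n)}"
    show ?case
    proof (rule supported_eqI)
      fix p and \<sigma> :: "(nat \<Rightarrow> real) \<Rightarrow> 'a" assume \<sigma>: "singular_simplex p X \<sigma>"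
      let ?P = "pull p \<sigma>"
      let ?as = "map ?P as" and ?bs = "map ?P bs"
      have len: "length ?as = m" "length ?bs = n" using 5 by simp_all
      have 1: "?P (\<Sum>i<m. ?E k (apply_at (coboundary X) as i) bs) = (\<Sum>i<m. word_op k (apply_at word_d ?as i) ?bs)"
        unfolding pull_sum using 5(3)
        by (intro sum.cong) (auto simp: pull_cochain_op[OF \<sigma> ne'(1) ne(2)] map_apply_at[where f="?P" and g="coboundary X" and g'=word_d, OF pull_coboundary[OF \<sigma>]])
      have 2: "?P (\<Sum>i<n. ?E k as (apply_at (coboundary X) bs i)) = (\<Sum>i<n. word_op k ?as (apply_at word_d ?bs i))"
        unfolding pull_sum using 5(4)
        by (intro sum.cong) (auto simp: pull_cochain_op[OF \<sigma> ne(1) ne'(3)] map_apply_at[where f="?P" and g="coboundary X" and g'=word_d, OF pull_coboundary[OF \<sigma>]])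
      have 3: "?P (\<Sum>i<m - 1. ?E k (merge_at (cup X) as i) bs) = (\<Sum>i<m - 1. word_op k (merge_at word_cup ?as i) ?bs)"
        unfolding pull_sum using 5(3)
        by (intro sum.cong) (auto simp: pull_cochain_op[OF \<sigma> ne'(2) ne(2)] map_merge_at[where f="?P" and m="cup X" and m'=word_cup, OF pull_cup[OF \<sigma>]])
      have 4: "?P (\<Sum>i<n - 1. ?E k as (merge_at (cup X) bs i)) = (\<Sum>i<n - 1. word_op k ?as (merge_at word_cup ?bs i))"
        unfolding pull_sum using 5(4)
        by (intro sum.cong) (auto simp: pull_cochain_op[OF \<sigma> ne(1) ne'(4)] map_merge_at[where f="?P" and m="cup X" and m'=word_cup, OF pull_cup[OF \<sigma>]])
      have 5: "?P (\<Sum>i=0..k. \<Sum>(q, r)\<in>?I. cup X (ext_ops ?E i (take q as) (take r bs))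
            ((swap_args ^^ i) (ext_ops ?E (k - i)) (drop q as) (drop r bs)))
          = (\<Sum>i=0..k. \<Sum>(q, r)\<in>?I. word_cup (word_op i (take q ?as) (take r ?bs))
            ((swap_args ^^ i) (word_op (k - i)) (drop q ?as) (drop r ?bs)))"
        unfolding pull_sum
        by (intro sum.cong refl) (auto simp: pull_cup[OF \<sigma>] pull_ext_ops[OF \<sigma>] pull_swaps_ext_ops[OF \<sigma>] take_map drop_map)
      have 6: "?P (pred_ops ?E k as bs) = (if k = 0 then 0 else word_op (k - 1) ?as ?bs)"
        "?P (pred_ops ?E k bs as) = (if k = 0 then 0 else word_op (k - 1) ?bs ?as)"
        by (simp_all add: pred_ops_def pull_0 pull_cochain_op[OF \<sigma>] ne)
      show "?P (coboundary X (?E k as bs) + (\<Sum>i<m. ?E k (apply_at (coboundary X) as i) bs)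
          + (\<Sum>i<n. ?E k as (apply_at (coboundary X) bs i)) + (\<Sum>i<m - 1. ?E k (merge_at (cup X) as i) bs)
          + (\<Sum>i<n - 1. ?E k as (merge_at (cup X) bs i))
          + (\<Sum>i=0..k. \<Sum>(q, r)\<in>?I. cup X (ext_ops ?E i (take q as) (take r bs))
            ((swap_args ^^ i) (ext_ops ?E (k - i)) (drop q as) (drop r bs))))
        = ?P (pred_ops ?E k as bs + pred_ops ?E k bs as)"
        using word_op_equation[of ?as ?bs k] ne
        unfolding pull_add 1 2 3 4 5 6 pull_coboundary[OF \<sigma>] pull_cochain_op[OF \<sigma> ne] len
        by (simp only: list.map_disc_iff simp_thms)
    next
      show "supported X (pred_ops ?E k as bs + pred_ops ?E k bs as)"
        by (intro supported_add) (simp_all add: pred_ops_def supported_0 supported_cochain_op)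
      have "supported X (case z of (q, r) \<Rightarrow> cup X (f q r) (g q r))" for z :: "nat \<times> nat" and f g
        by (cases z) (simp add: supported_cup)
      then show "supported X (coboundary X (?E k as bs) + (\<Sum>i<m. ?E k (apply_at (coboundary X) as i) bs)
          + (\<Sum>i<n. ?E k as (apply_at (coboundary X) bs i)) + (\<Sum>i<m - 1. ?E k (merge_at (cup X) as i) bs)
          + (\<Sum>i<n - 1. ?E k as (merge_at (cup X) bs i))
          + (\<Sum>i=0..k. \<Sum>(q, r)\<in>?I. cup X (ext_ops ?E i (take q as) (take r bs))
            ((swap_args ^^ i) (ext_ops ?E (k - i)) (drop q as) (drop r bs))))"
        by (intro supported_add supported_sum supported_coboundary supported_cochain_op)
    qed
  qed
qed

end

theorem theorem1:
  fixes X :: "'a topology"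
  shows "\<exists>E :: nat \<Rightarrow> 'a cochain list \<Rightarrow> 'a cochain list \<Rightarrow> 'a cochain.
    extended_homotopy_G_algebra_Z2 cochain_scale (normalized_cochains X) (coboundary X) (cup X) E"
  using extended_homotopy_G_algebra_cochains by blast

end
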